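(* (1) The identifiable nonlinear Gaussian additive noise models (ANMs) of SCORE form a proper subclass of the continuous nonlinear semiparametric GLM DAGs: every distribution following a nonlinear Gaussian ANM on a DAG $G$ follows a nonlinear semiparametric GLM DAG on $G$ with all coordinates continuous, and there exists a distribution following a nonlinear semiparametric GLM DAG with all coordinates continuous that is not a nonlinear Gaussian ANM. (For all of these semiparametric GLM DAGs the DAG is identifiable from the distribution within the nonlinear semiparametric GLM DAG class.) (2) Let $P$ follow a nonlinear semiparametric GLM DAG on $G$ whose own-factor curvature $\kappa_j$ is constant for every node $j$ (this includes the nonlinear Gaussian ANMs). Then for every nonempty ancestral set $R$ and every $j\in R$, $$\operatorname{Var}(H_{j,R})=0\iff S_j(R)=0\iff j\text{ is a sink of }G_R .$$
   Context: Graph notation. $G=(V,E)$ is a DAG with $V=\{1,\dots,d\}$; $\operatorname{Pa}_G(j)$ denotes parents; a source has no parents, a sink no children. $G_R$ is the induced subgraph on $R\subseteq V$. $R$ is ancestral if it is obtained from $V$ by repeatedly removing a sink of the current induced subgraph (equivalently, it contains the parents of all its elements). Variables. $X=(X_1,\dots,X_d)$ has law $P$. Each $X_j$ is continuous (support $\mathcal X_j\subseteq\mathbb R$ a connected interval with nonempty interior, $\nu_j$ Lebesgue measure, $\mathring{\mathcal X}_j=\operatorname{int}\mathcal X_j$) or count (support $\mathcal X_j$ a set of consecutive integers, bounded below, with at least three elements, $\nu_j$ counting measure, $\mathring{\mathcal X}_j=\mathcal X_j$). $p$ is the density of $P$ with respect to $\bigotimes_j\nu_j$ (densities include mass functions).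 $\mathring{\mathcal X}_A=\prod_{i\in A}\mathring{\mathcal X}_i$; $P_R,p_R$ are the law and density of $X_R$. Semiparametric GLM DAG. $P$ follows a semiparametric GLM DAG on $G$ if $p(x)=\prod_jp_j(x_j\mid x_{\operatorname{Pa}_G(j)})$, where source marginal densities $p_j$ are arbitrary, and for every non-source $j$ $$p_j(x_j\mid x_{\operatorname{Pa}_G(j)})=b_j(x_j)\exp\{x_j\eta_j(x_{\operatorname{Pa}_G(j)})-A_j(\eta_j(x_{\operatorname{Pa}_G(j)}))\},\quad A_j(t)=\log\int_{\mathcal X_j}b_j(u)e^{ut}\,d\nu_j(u),$$ where $\mathcal X_j,b_j$ do not depend on the parent values, and $\eta_j$ is nonconstant in every parent coordinate on $\mathring{\mathcal X}_{\operatorname{Pa}_G(j)}$. It is nonlinear if for every edge $k\to i$ there are fixed values $z$ of the other parents of $i$ in the interior of their product support such that $\eta_i(\cdot,z)$ is not affine on $\mathring{\mathcal X}_k$. Regularity (part of the class). Densities are finite and strictly positive on product-support interiors. Source densities and $b_j$ are finite and strictly positive on support interiors with logarithms $C^2$ in continuous coordinates. Each $\eta_j$ is finite and jointly $C^2$ in its continuous parent coordinates for each fixed choice of count parents. $\eta_j(\mathring{\mathcal X}_{\operatorname{Pa}_G(j)})\subseteq\operatorname{int}\{t:A_j(t)<\infty\}$. Nonlinear Gaussian ANM on $G$: $X_i=f_i(X_{\operatorname{Pa}_G(i)})+\varepsilon_i$ for all $i$, with jointly independent $\varepsilon_i\sim\mathcal N(0,\tau_i^2)$, $\tau_i>0$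 ($f_i$ a constant for sources), each $f_i$ being $C^2$ and, for each edge $k\to i$, there are fixed values $z$ of the other parents such that $f_i(\cdot,z)$ is not affine on $\mathbb R$. Curvature. For continuous $X_j$, $\mathcal D_j^2f=\partial_{x_j}^2f$; for count $X_j$, $\mathcal D_j^2f(x)=f(x+2e_j)-2f(x+e_j)+f(x)$, defined only where $x_j,x_j+1,x_j+2\in\mathcal X_j$. Admissible event $\mathcal A_j^{(2)}$: $\{X_j,X_j+1,X_j+2\in\mathcal X_j\}$ for count $X_j$, $\{X_j\in\mathring{\mathcal X}_j\}$ for continuous. Own-factor curvature: $\kappa_j(x_j)=\mathcal D_j^2\log p_j(x_j\mid x_{\operatorname{Pa}_G(j)})$, which equals $\mathcal D_j^2\log b_j(x_j)$ for a non-source and $\mathcal D_j^2\log p_j(x_j)$ for a source. $H_{j,R}=\mathcal D_j^2\log p_R$. All variances and expectations of $H_{j,R}$ are under $P_R(\,\cdot\mid\mathcal A_j^{(2)})$, including in the conditional curvature score $S_j(R)=\mathbb E[\operatorname{Var}\{H_{j,R}(X_R)\mid X_j\}]$. Moment condition (for (2)): $H_{j,R}\in L^2(P_R(\cdot\mid\mathcal A_j^{(2)}))$ for every nonempty ancestral $R$ and $j\in R$. *)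

theory Defs
  imports "HOL-Probability.Probability"
begin

section \<open>Directed acyclic graphs on \<open>{1..d}\<close>\<close>

text \<open>A graph is its edge set; \<open>(i, j) \<in> E\<close> is the edge from \<open>i\<close> to \<open>j\<close>.\<close>

definition dag :: "nat \<Rightarrow> (nat \<times> nat) set \<Rightarrow> bool" where
  "dag d E \<longleftrightarrow> E \<subseteq> {1..d} \<times> {1..d} \<and> acyclic E"

definition Pa :: "(nat \<times> nat) set \<Rightarrow> nat \<Rightarrow> nat set" where
  "Pa E j = {i. (i, j) \<in> E}"

definition sink_in :: "(nat \<times> nat) set \<Rightarrow> nat set \<Rightarrow> nat \<Rightarrow> bool" where
  "sink_in E R j \<longleftrightarrow> j \<in> R \<and> (\<forall>i\<in>R. (j, i) \<notin> E)"

inductive ancestral :: "nat \<Rightarrow> (nat \<times> nat) set \<Rightarrow> nat set \<Rightarrow> bool" for d E where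
  all: "ancestral d E {1..d}"
| remove_sink: "ancestral d E R \<Longrightarrow> sink_in E R j \<Longrightarrow> ancestral d E (R - {j})"

section \<open>Smoothness and affinity\<close>

text \<open>
  Functions of the coordinates in a finite set \<open>I\<close> take arguments in the extensional function
  space \<open>I \<rightarrow>\<^sub>E UNIV\<close>, on which the product topology of \<open>nat \<Rightarrow> real\<close> is that of \<open>\<real>\<^sup>I\<close>.
\<close>

definition pd :: "nat \<Rightarrow> ((nat \<Rightarrow> real) \<Rightarrow> real) \<Rightarrow> (nat \<Rightarrow> real) \<Rightarrow> real" where
  "pd i f x = deriv (\<lambda>t. f (x(i := t))) (x i)"

text \<open>
  In the next two definitions \<open>I\<close> is the set of coordinates in which \<open>f\<close> is differentiated, and
  \<open>D\<close> is meant to be relatively open in those coordinates.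
\<close>

definition C1_in :: "nat set \<Rightarrow> (nat \<Rightarrow> real) set \<Rightarrow> ((nat \<Rightarrow> real) \<Rightarrow> real) \<Rightarrow> bool" where
  "C1_in I D f \<longleftrightarrow> continuous_on D f \<and>
     (\<forall>i\<in>I. (\<forall>x\<in>D. (\<lambda>t. f (x(i := t))) differentiable at (x i)) \<and> continuous_on D (pd i f))"

definition C2_in :: "nat set \<Rightarrow> (nat \<Rightarrow> real) set \<Rightarrow> ((nat \<Rightarrow> real) \<Rightarrow> real) \<Rightarrow> bool" where
  "C2_in I D f \<longleftrightarrow> C1_in I D f \<and> (\<forall>i\<in>I. C1_in I D (pd i f))"

definition C2_real_on :: "real set \<Rightarrow> (real \<Rightarrow> real) \<Rightarrow> bool" where
  "C2_real_on S g \<longleftrightarrow> (\<exists>g' g''. (\<forall>x\<in>S. (g has_real_derivative g' x) (at x) \<and>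
     (g' has_real_derivative g'' x) (at x)) \<and> continuous_on S g'')"

definition affine_fun_on :: "real set \<Rightarrow> (real \<Rightarrow> real) \<Rightarrow> bool" where
  "affine_fun_on S g \<longleftrightarrow> (\<exists>a c. \<forall>t\<in>S. g t = a + c * t)"

section \<open>Continuous and count variables\<close>

datatype var_kind = Continuous | Count

fun valid_support :: "var_kind \<Rightarrow> real set \<Rightarrow> bool" where
  "valid_support Continuous S \<longleftrightarrow> is_interval S \<and> interior S \<noteq> {}"
| "valid_support Count S \<longleftrightarrow> S \<subseteq> \<int> \<and> bdd_below S \<and>
     (\<forall>a\<in>S. \<forall>b\<in>S. \<forall>c\<in>\<int>. a \<le> c \<and> c \<le> b \<longrightarrow> c \<in> S) \<and> (infinite S \<or> 3 \<le> card S)"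

fun support_interior :: "var_kind \<Rightarrow> real set \<Rightarrow> real set" where
  "support_interior Continuous S = interior S"
| "support_interior Count S = S"

text \<open>The reference measure restricted to the support, as a measure on the Borel sets.\<close>

fun ref_measure :: "var_kind \<Rightarrow> real set \<Rightarrow> real measure" where
  "ref_measure Continuous S = density lborel (indicator S)"
| "ref_measure Count S = distr (count_space S) borel (\<lambda>x. x)"

fun admissible_values :: "var_kind \<Rightarrow> real set \<Rightarrow> real set" where
  "admissible_values Continuous S = interior S"
| "admissible_values Count S = {t \<in> S. t + 1 \<in> S \<and> t + 2 \<in> S}"

fun curv :: "var_kind \<Rightarrow> nat \<Rightarrow> ((nat \<Rightarrow> real) \<Rightarrow> real) \<Rightarrow> (nat \<Rightarrow> real) \<Rightarrow> real" where
  "curv Continuous j f x = (deriv ^^ 2) (\<lambda>t. f (x(j := t))) (x j)"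
| "curv Count j f x = f (x(j := x j + 2)) - 2 * f (x(j := x j + 1)) + f x"

section \<open>Semiparametric GLM DAGs\<close>

text \<open>
  The ingredients of a semiparametric GLM DAG: kinds and supports of the variables, the densities
  of the source nodes, the carriers \<open>b\<^sub>j\<close> and natural parameters \<open>\<eta>\<^sub>j\<close> of the non-source nodes (the
  latter a function of the parent coordinates), and the joint density.
\<close>

record glm_model =
  kind :: "nat \<Rightarrow> var_kind"
  var_supp :: "nat \<Rightarrow> real set"
  src_dens :: "nat \<Rightarrow> real \<Rightarrow> real"
  carrier_dens :: "nat \<Rightarrow> real \<Rightarrow> real"
  nat_par :: "nat \<Rightarrow> (nat \<Rightarrow> real) \<Rightarrow> real"
  joint_dens :: "(nat \<Rightarrow> real) \<Rightarrow> real"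

definition supp_int :: "glm_model \<Rightarrow> nat \<Rightarrow> real set" where
  "supp_int M j = support_interior (kind M j) (var_supp M j)"

definition supp_int_prod :: "glm_model \<Rightarrow> nat set \<Rightarrow> (nat \<Rightarrow> real) set" where
  "supp_int_prod M A = (\<Pi>\<^sub>E i\<in>A. supp_int M i)"

definition nu :: "glm_model \<Rightarrow> nat \<Rightarrow> real measure" where
  "nu M j = ref_measure (kind M j) (var_supp M j)"

definition partition_fun :: "glm_model \<Rightarrow> nat \<Rightarrow> real \<Rightarrow> ennreal" where
  "partition_fun M j t = (\<integral>\<^sup>+u. ennreal (carrier_dens M j u * exp (u * t)) \<partial>nu M j)"

text \<open>\<open>log_partition\<close> is meaningful on \<open>natural_domain\<close>, i.e. where it is finite.\<close>

definition log_partition :: "glm_model \<Rightarrow> nat \<Rightarrow> real \<Rightarrow> real" where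
  "log_partition M j t = ln (enn2real (partition_fun M j t))"

definition natural_domain :: "glm_model \<Rightarrow> nat \<Rightarrow> real set" where
  "natural_domain M j = {t. partition_fun M j t < \<infinity>}"

text \<open>The conditional density of \<open>x\<^sub>j\<close> given its parents, both read off from \<open>x\<close>.\<close>

definition cond_dens ::
    "(nat \<times> nat) set \<Rightarrow> glm_model \<Rightarrow> nat \<Rightarrow> (nat \<Rightarrow> real) \<Rightarrow> real" where
  "cond_dens E M j x =
     (if Pa E j = {} then src_dens M j (x j)
      else let \<eta> = nat_par M j (restrict x (Pa E j))
           in carrier_dens M j (x j) * exp (x j * \<eta> - log_partition M j \<eta>))"

definition source_regular :: "glm_model \<Rightarrow> nat \<Rightarrow> bool" where
  "source_regular M j \<longleftrightarrow>
     src_dens M j \<in> borel_measurable borel \<and>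
     (\<integral>\<^sup>+u. ennreal (src_dens M j u) \<partial>nu M j) = 1 \<and>
     (\<forall>u\<in>supp_int M j. 0 < src_dens M j u) \<and>
     (kind M j = Continuous \<longrightarrow> C2_real_on (supp_int M j) (\<lambda>u. ln (src_dens M j u)))"

definition nonsource_regular :: "(nat \<times> nat) set \<Rightarrow> glm_model \<Rightarrow> nat \<Rightarrow> bool" where
  "nonsource_regular E M j \<longleftrightarrow>
     carrier_dens M j \<in> borel_measurable borel \<and>
     (\<forall>u\<in>supp_int M j. 0 < carrier_dens M j u) \<and>
     (kind M j = Continuous \<longrightarrow> C2_real_on (supp_int M j) (\<lambda>u. ln (carrier_dens M j u))) \<and>
     (\<forall>w. C2_in {i \<in> Pa E j. kind M i = Continuous}
            {x \<in> supp_int_prod M (Pa E j). \<forall>i\<in>Pa E j. kind M i = Count \<longrightarrow> x i = w i}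
            (nat_par M j)) \<and>
     nat_par M j ` supp_int_prod M (Pa E j) \<subseteq> interior (natural_domain M j) \<and>
     (\<forall>k\<in>Pa E j. \<exists>x\<in>supp_int_prod M (Pa E j). \<exists>t\<in>supp_int M k.
        nat_par M j (x(k := t)) \<noteq> nat_par M j x)"

text \<open>
  The law \<open>P\<close> lives on the product of the Borel spaces indexed by \<open>{1..d}\<close>. The version
  \<open>joint_dens M\<close> of its density is pinned down on the product of the support interiors, whose
  complement is null for the product reference measure.
\<close>

definition semi_glm_dag ::
    "nat \<Rightarrow> (nat \<times> nat) set \<Rightarrow> glm_model \<Rightarrow> (nat \<Rightarrow> real) measure \<Rightarrow> bool" where
  "semi_glm_dag d E M P \<longleftrightarrow>
     dag d E \<and> prob_space P \<and>
     (\<forall>j\<in>{1..d}. valid_support (kind M j) (var_supp M j)) \<and>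
     joint_dens M \<in> borel_measurable (Pi\<^sub>M {1..d} (\<lambda>_. borel)) \<and>
     P = density (Pi\<^sub>M {1..d} (nu M)) (\<lambda>x. ennreal (joint_dens M x)) \<and>
     (\<forall>x\<in>supp_int_prod M {1..d}. 0 < joint_dens M x \<and>
        joint_dens M x = (\<Prod>j\<in>{1..d}. cond_dens E M j x)) \<and>
     (\<forall>j\<in>{1..d}. if Pa E j = {} then source_regular M j else nonsource_regular E M j)"

definition nonlinear_glm :: "(nat \<times> nat) set \<Rightarrow> glm_model \<Rightarrow> bool" where
  "nonlinear_glm E M \<longleftrightarrow> (\<forall>(k, i)\<in>E. \<exists>z\<in>supp_int_prod M (Pa E i - {k}).
     \<not> affine_fun_on (supp_int M k) (\<lambda>t. nat_par M i (z(k := t))))"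

definition all_continuous :: "nat \<Rightarrow> glm_model \<Rightarrow> bool" where
  "all_continuous d M \<longleftrightarrow> (\<forall>j\<in>{1..d}. kind M j = Continuous)"

section \<open>Nonlinear Gaussian additive noise models\<close>

text \<open>
  The variables are the coordinates under their joint law \<open>P\<close>, so the noise variables are the
  residuals \<open>x\<^sub>i - f\<^sub>i(x\<^bsub>Pa(i)\<^esub>)\<close>. For a source \<open>i\<close>, \<open>f\<^sub>i\<close> is only evaluated at the unique element of
  \<open>{} \<rightarrow>\<^sub>E UNIV\<close>, hence is a constant.
\<close>

definition gaussian_anm :: "nat \<Rightarrow> (nat \<times> nat) set \<Rightarrow> (nat \<Rightarrow> real) measure \<Rightarrow> bool" where
  "gaussian_anm d E P \<longleftrightarrow>
     dag d E \<and> prob_space P \<and> sets P = sets (Pi\<^sub>M {1..d} (\<lambda>_. borel)) \<and>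
     (\<exists>(f :: nat \<Rightarrow> (nat \<Rightarrow> real) \<Rightarrow> real) (\<tau> :: nat \<Rightarrow> real).
        (\<forall>i\<in>{1..d}. C2_in (Pa E i) (Pa E i \<rightarrow>\<^sub>E UNIV) (f i)) \<and>
        (\<forall>(k, i)\<in>E. \<exists>z\<in>(Pa E i - {k}) \<rightarrow>\<^sub>E UNIV.
           \<not> affine_fun_on UNIV (\<lambda>t. f i (z(k := t)))) \<and>
        (\<forall>i\<in>{1..d}. 0 < \<tau> i \<and>
           distributed P lborel (\<lambda>x. x i - f i (restrict x (Pa E i))) (normal_density 0 (\<tau> i))) \<and>
        prob_space.indep_vars P (\<lambda>_. borel) (\<lambda>i x. x i - f i (restrict x (Pa E i))) {1..d})"

section \<open>Curvature of marginal log-densities\<close>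

definition own_curvature ::
    "(nat \<times> nat) set \<Rightarrow> glm_model \<Rightarrow> nat \<Rightarrow> (nat \<Rightarrow> real) \<Rightarrow> real" where
  "own_curvature E M j x = curv (kind M j) j (\<lambda>y. ln (cond_dens E M j y)) x"

definition admissible_dom :: "glm_model \<Rightarrow> nat set \<Rightarrow> nat \<Rightarrow> (nat \<Rightarrow> real) set" where
  "admissible_dom M R j =
     {x \<in> supp_int_prod M R. x j \<in> admissible_values (kind M j) (var_supp M j)}"

definition constant_own_curvature :: "nat \<Rightarrow> (nat \<times> nat) set \<Rightarrow> glm_model \<Rightarrow> bool" where
  "constant_own_curvature d E M \<longleftrightarrow>
     (\<forall>j\<in>{1..d}. \<exists>c. \<forall>x\<in>admissible_dom M {1..d} j. own_curvature E M j x = c)"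

definition marg_law :: "nat set \<Rightarrow> (nat \<Rightarrow> real) measure \<Rightarrow> (nat \<Rightarrow> real) measure" where
  "marg_law R P = distr P (Pi\<^sub>M R (\<lambda>_. borel)) (\<lambda>x. restrict x R)"

definition marg_dens :: "nat \<Rightarrow> glm_model \<Rightarrow> nat set \<Rightarrow> (nat \<Rightarrow> real) \<Rightarrow> real" where
  "marg_dens d M R x =
     (\<integral>y. joint_dens M (merge R ({1..d} - R) (x, y)) \<partial>Pi\<^sub>M ({1..d} - R) (nu M))"

definition cond_law ::
    "glm_model \<Rightarrow> (nat \<Rightarrow> real) measure \<Rightarrow> nat set \<Rightarrow> nat \<Rightarrow> (nat \<Rightarrow> real) measure" where
  "cond_law M P R j = uniform_measure (marg_law R P)
     {x \<in> space (marg_law R P). x j \<in> admissible_values (kind M j) (var_supp M j)}"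

text \<open>
  The curvature is only defined on \<open>admissible_dom M R j\<close>, whose complement is null for
  \<open>cond_law M P R j\<close>; it is extended by zero to avoid measurability artefacts on that null set.
\<close>

definition curv_H :: "nat \<Rightarrow> glm_model \<Rightarrow> nat set \<Rightarrow> nat \<Rightarrow> (nat \<Rightarrow> real) \<Rightarrow> real" where
  "curv_H d M R j x =
     (if x \<in> admissible_dom M R j
      then curv (kind M j) j (\<lambda>y. ln (marg_dens d M R y)) x else 0)"

definition moment_condition ::
    "nat \<Rightarrow> (nat \<times> nat) set \<Rightarrow> glm_model \<Rightarrow> (nat \<Rightarrow> real) measure \<Rightarrow> bool" where
  "moment_condition d E M P \<longleftrightarrow> (\<forall>R j. ancestral d E R \<and> R \<noteq> {} \<and> j \<in> R \<longrightarrow>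
     curv_H d M R j \<in> borel_measurable (cond_law M P R j) \<and>
     integrable (cond_law M P R j) (\<lambda>x. (curv_H d M R j x)\<^sup>2))"

definition curv_variance ::
    "nat \<Rightarrow> glm_model \<Rightarrow> (nat \<Rightarrow> real) measure \<Rightarrow> nat set \<Rightarrow> nat \<Rightarrow> real" where
  "curv_variance d M P R j = prob_space.variance (cond_law M P R j) (curv_H d M R j)"

definition sigma_coord :: "(nat \<Rightarrow> real) measure \<Rightarrow> nat \<Rightarrow> (nat \<Rightarrow> real) measure" where
  "sigma_coord Q j = vimage_algebra (space Q) (\<lambda>x. x j) borel"

definition cond_variance ::
    "'a measure \<Rightarrow> 'a measure \<Rightarrow> ('a \<Rightarrow> real) \<Rightarrow> 'a \<Rightarrow> real" where
  "cond_variance Q F Y = real_cond_exp Q F (\<lambda>x. (Y x - real_cond_exp Q F Y x)\<^sup>2)"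

definition curv_score ::
    "nat \<Rightarrow> glm_model \<Rightarrow> (nat \<Rightarrow> real) measure \<Rightarrow> nat set \<Rightarrow> nat \<Rightarrow> real" where
  "curv_score d M P R j =
     (\<integral>x. cond_variance (cond_law M P R j) (sigma_coord (cond_law M P R j) j) (curv_H d M R j) x
        \<partial>cond_law M P R j)"

end

(*
  For an ancestral set R the marginal density is the product of the conditional densities of the
  nodes in R, because integrating out a sink removes exactly its own factor. If j is a sink of G_R,
  only its own factor involves x_j, and there the parents enter only through terms affine in x_j,
  so H depends on x_j alone. If j has
  children in R, let i be one that is not a parent of another child of j: then
  H(x) = C + x_i * (curvature of eta_i in x_j), with C not depending on x_i. If H is almost surely a
  function of x_j, two values of x_i show that the curvature of eta_i vanishes almost everywhere,
  hence everywhere by continuity, and eta_i would be affine in x_j. This gives the curvature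
  criterion and, since H is determined by P, that two models of P have the same sinks in common ancestral
  sets; removing sinks one by one and comparing the conditional densities of the removed sinks
  identifies the parents. A Gaussian ANM is a GLM DAG with Gaussian carriers and eta_i = f_i / tau_i^2:
  the residual map is a composition of shears, so it preserves Lebesgue measure. The uniform
  distribution on the unit cube is a GLM DAG without edges that is not a Gaussian ANM.
*)
theory Submission
  imports Defs
begin

text \<open>Two gaps lie between the curvature computation and the statement. \<open>curv\<close> is
  built on the total function \<open>deriv\<close>, so additivity needs existing derivatives. Hence
  computations use a relation \<open>curv_at\<close>, and the log-partition must be shown twice
  differentiable although the value of its curvature never matters: along x_j it does not involve
  x_i and disappears into C. The second gap is that a law fixes densities and curvatures only almost
  everywhere, whereas nonlinearity is witnessed at single points. In the identifiability part only
  one of the two models is assumed continuous. The law then excludes count variables in the other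
  one and fixes the support interiors, while endpoints of supports stay undetermined.\<close>

section \<open>Second derivatives\<close>

text \<open>The first derivative has to exist near \<open>x\<close>, not just at \<open>x\<close>,
  because \<open>deriv ^^ 2\<close> differentiates the function \<open>deriv f\<close>. Carrying the
  value as an argument keeps the arbitrary values of \<open>deriv\<close> at nondifferentiable
  points out of the calculus below.\<close>

definition has_d2 :: "(real \<Rightarrow> real) \<Rightarrow> real \<Rightarrow> real \<Rightarrow> bool" where
  "has_d2 f v x \<longleftrightarrow> (\<exists>f'. (\<forall>\<^sub>F t in nhds x. (f has_real_derivative f' t) (at t)) \<and>
     (f' has_real_derivative v) (at x))"

lemma has_d2I:
  assumes "open S" "x \<in> S" "\<And>t. t \<in> S \<Longrightarrow> (f has_real_derivative f' t) (at t)"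
    "(f' has_real_derivative v) (at x)"
  shows "has_d2 f v x"
  unfolding has_d2_def using assms eventually_nhds by blast

lemma has_d2_imp_deriv2:
  assumes "has_d2 f v x"
  shows "(deriv ^^ 2) f x = v"
proof -
  obtain f' where f': "\<forall>\<^sub>F t in nhds x. (f has_real_derivative f' t) (at t)"
    "(f' has_real_derivative v) (at x)" using assms has_d2_def by auto
  have "\<forall>\<^sub>F t in nhds x. deriv f t = f' t"
    using f'(1) by eventually_elim (rule DERIV_imp_deriv)
  then have "deriv (deriv f) x = deriv f' x" by (intro deriv_cong_ev) auto
  also have "\<dots> = v" using f'(2) by (rule DERIV_imp_deriv)
  finally show ?thesis by (simp add: numeral_2_eq_2)
qed

lemma has_d2_cong:
  assumes "has_d2 f v x" "open S" "x \<in> S" "\<And>t. t \<in> S \<Longrightarrow> f t = g t"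
  shows "has_d2 g v x"
proof -
  obtain f' where f': "\<forall>\<^sub>F t in nhds x. (f has_real_derivative f' t) (at t)"
    "(f' has_real_derivative v) (at x)" using assms has_d2_def by auto
  have "\<forall>\<^sub>F t in nhds x. t \<in> S" using assms by (simp add: eventually_nhds_in_open)
  with f'(1) have "\<forall>\<^sub>F t in nhds x. (g has_real_derivative f' t) (at t)"
  proof eventually_elim
    case (elim t)
    have "\<forall>\<^sub>F s in nhds t. f s = g s"
      using eventually_nhds_in_open[OF assms(2) elim(2)] by eventually_elim (rule assms(4))
    then show ?case using elim(1) DERIV_cong_ev[of t t f g "f' t" "f' t"] by simp
  qed
  then show ?thesis using f'(2) has_d2_def by blast
qed

lemma has_d2_const: "has_d2 (\<lambda>t. c) 0 x"
  by (rule has_d2I[where S=UNIV and f'="\<lambda>_. 0"]) auto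

lemma has_d2_add:
  assumes "has_d2 f v x" "has_d2 g w x"
  shows "has_d2 (\<lambda>t. f t + g t) (v + w) x"
proof -
  obtain f' g' where f': "\<forall>\<^sub>F t in nhds x. (f has_real_derivative f' t) (at t)"
      "(f' has_real_derivative v) (at x)"
    and g': "\<forall>\<^sub>F t in nhds x. (g has_real_derivative g' t) (at t)"
      "(g' has_real_derivative w) (at x)" using assms unfolding has_d2_def by blast
  have "\<forall>\<^sub>F t in nhds x. ((\<lambda>t. f t + g t) has_real_derivative f' t + g' t) (at t)"
    using f'(1) g'(1) by eventually_elim (rule DERIV_add)
  then show ?thesis unfolding has_d2_def
    by (intro exI[of _ "\<lambda>t. f' t + g' t"]) (auto intro: DERIV_add f' g')
qed

lemma has_d2_cmult:
  assumes "has_d2 f v x"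
  shows "has_d2 (\<lambda>t. c * f t) (c * v) x"
proof -
  obtain f' where f': "\<forall>\<^sub>F t in nhds x. (f has_real_derivative f' t) (at t)"
      "(f' has_real_derivative v) (at x)" using assms has_d2_def by metis
  have "\<forall>\<^sub>F t in nhds x. ((\<lambda>t. c * f t) has_real_derivative c * f' t) (at t)"
    using f'(1) by eventually_elim (rule DERIV_cmult)
  then show ?thesis unfolding has_d2_def
    by (intro exI[of _ "\<lambda>t. c * f' t"]) (auto intro: DERIV_cmult f')
qed

text \<open>Chain rule with \<open>h\<close> a log-partition function, defined sensibly only on an
  open set. The value of the second derivative cancels later, so only its existence is
  stated.\<close>

lemma has_d2_comp:
  assumes f: "has_d2 f v x" and U: "open U" "f x \<in> U"
    and h: "\<And>s. s \<in> U \<Longrightarrow> (h has_real_derivative h' s) (at s)"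
      "(h' has_real_derivative w) (at (f x))"
  shows "\<exists>c. has_d2 (\<lambda>t. h (f t)) c x"
proof -
  obtain f' where f': "\<forall>\<^sub>F t in nhds x. (f has_real_derivative f' t) (at t)"
      "(f' has_real_derivative v) (at x)" using f has_d2_def by metis
  have fx: "(f has_real_derivative f' x) (at x)" using f'(1) eventually_nhds_x_imp_x by fastforce
  then have "isCont f x" by (rule DERIV_isCont)
  then have "\<forall>\<^sub>F t in nhds x. f t \<in> U"
    using topological_tendstoD[of f "f x" "nhds x" U] U by (simp add: isCont_def tendsto_at_iff_tendsto_nhds)
  with f'(1) have *: "\<forall>\<^sub>F t in nhds x. ((\<lambda>t. h (f t)) has_real_derivative h' (f t) * f' t) (at t)"
    by eventually_elim (auto intro: DERIV_chain2 h)
  have "((\<lambda>t. h' (f t) * f' t) has_real_derivative w * f' x * f' x + v * h' (f x)) (at x)"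
    by (rule DERIV_mult[OF DERIV_chain2[OF h(2) fx] f'(2)])
  with * have "has_d2 (\<lambda>t. h (f t)) (w * f' x * f' x + v * h' (f x)) x"
    unfolding has_d2_def by (intro exI[of _ "\<lambda>t. h' (f t) * f' t"] conjI)
  then show ?thesis ..
qed

lemma affine_fun_on_if_deriv2_zero:
  fixes g :: "real \<Rightarrow> real"
  assumes S: "open S" "convex S"
    and g: "\<And>t. t \<in> S \<Longrightarrow> (g has_real_derivative g' t) (at t)"
      "\<And>t. t \<in> S \<Longrightarrow> (g' has_real_derivative 0) (at t)"
  shows "affine_fun_on S g"
proof -
  have "(g' has_real_derivative 0) (at t within S)" if "t \<in> S" for t
    using g(2)[OF that] by (rule has_field_derivative_at_within)
  from has_field_derivative_zero_constant[OF S(2) this]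
  have "\<exists>c. \<forall>t\<in>S. g' t = c" by auto
  then obtain c where c: "\<And>t. t \<in> S \<Longrightarrow> g' t = c" by blast
  define h where "h = (\<lambda>t. g t - c * t)"
  have "(h has_real_derivative 0) (at t within S)" if "t \<in> S" for t
  proof -
    have "(h has_real_derivative g' t - c * 1) (at t)"
      unfolding h_def by (intro DERIV_diff g(1) that DERIV_cmult DERIV_ident)
    then show ?thesis using c[OF that] by (simp add: has_field_derivative_at_within)
  qed
  from has_field_derivative_zero_constant[OF S(2) this]
  obtain a where a: "\<forall>t\<in>S. h t = a" by blast
  have "g t = a + c * t" if "t \<in> S" for t using a that by (simp add: h_def algebra_simps)
  then show ?thesis unfolding affine_fun_on_def by blast
qed

text \<open>The support has a least element \<open>a\<close>. A vanishing second difference is a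
  two-step recursion, so \<open>g a\<close> and the first increment \<open>c\<close> determine
  \<open>g\<close> at every later integer of the support.\<close>

lemma affine_fun_on_if_difference2_zero:
  fixes g :: "real \<Rightarrow> real"
  assumes S: "valid_support Count S"
    and g: "\<And>t. t \<in> S \<Longrightarrow> t + 1 \<in> S \<Longrightarrow> t + 2 \<in> S \<Longrightarrow> g (t + 2) - 2 * g (t + 1) + g t = 0"
  shows "affine_fun_on S g"
proof (cases "S = {}")
  case False
  have SZ: "S \<subseteq> \<int>" and bd: "bdd_below S"
    and cv: "\<And>a b c. a \<in> S \<Longrightarrow> b \<in> S \<Longrightarrow> c \<in> \<int> \<Longrightarrow> a \<le> c \<Longrightarrow> c \<le> b \<Longrightarrow> c \<in> S"
    using S[unfolded valid_support.simps] by (elim conjE; blast)+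
  obtain s0 where s0: "s0 \<in> S" using False by blast
  obtain B where B: "\<And>s. s \<in> S \<Longrightarrow> B \<le> s" using bd unfolding bdd_below_def by blast
  define K where "K = {k::int. of_int k \<in> S}"
  have "s0 \<in> \<int>" using s0 SZ by blast
  then obtain k0 where "s0 = of_int k0" by (rule Ints_cases)
  then have k0: "k0 \<in> K" using s0 unfolding K_def by simp
  have Kb: "floor B \<le> k" if "k \<in> K" for k
    using B[of "of_int k"] that K_def by (simp add: floor_le_iff)
  obtain k where k: "k \<in> K" "\<And>l. l \<in> K \<Longrightarrow> k \<le> l"
  proof -
    \<comment> \<open>Measuring the distance to the lower bound by a natural number reduces the
      existence of a minimum to the least-number principle.\<close>
    have "\<exists>k\<in>K. \<forall>l\<in>K. nat (k - floor B) \<le> nat (l - floor B)"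
      using ex_has_least_nat[of "\<lambda>k. k \<in> K" k0 "\<lambda>k. nat (k - floor B)"] k0 by blast
    then obtain k where "k \<in> K" and le: "\<And>l. l \<in> K \<Longrightarrow> nat (k - floor B) \<le> nat (l - floor B)" by blast
    moreover have "k \<le> l" if "l \<in> K" for l using le[OF that] Kb[OF that] Kb[OF \<open>k \<in> K\<close>] by linarith
    ultimately show ?thesis using that by blast
  qed
  define a where "a = (of_int k :: real)"
  define c where "c = g (a + 1) - g a"
  have aS: "a \<in> S" using k K_def a_def by simp
  have main: "a + real n \<in> S \<Longrightarrow> g (a + real n) = g a + real n * c" for n
  proof (induction n rule: less_induct)
    case (less n)
    consider "n = 0" | "n = 1" | m where "n = m + 2"
      by (metis One_nat_def add_2_eq_Suc' less_2_cases not_less_eq old.nat.exhaust)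
    then show ?case
    proof cases
      case 3
      have Z: "a + real m \<in> \<int>" "a + real m + 1 \<in> \<int>" unfolding a_def by auto
      have m: "a + real m \<in> S" "a + real m + 1 \<in> S" "a + real m + 2 \<in> S"
        using cv[OF aS less.prems Z(1)] cv[OF aS less.prems Z(2)] 3 less.prems by (auto simp: algebra_simps)
      have "g (a + real m) = g a + real m * c" using less.IH[of m] 3 m by simp
      moreover have "g (a + real m + 1) = g a + (real m + 1) * c"
        using less.IH[of "m + 1"] 3 m by (simp add: algebra_simps)
      moreover have "g (a + real m + 2) = 2 * g (a + real m + 1) - g (a + real m)" using g[OF m] by simp
      ultimately show ?thesis using 3 by (simp add: algebra_simps)
    qed (auto simp: c_def)
  qed
  have "g t = (g a - a * c) + c * t" if "t \<in> S" for t
  proof -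
    have "t \<in> \<int>" using that SZ by blast
    then obtain l where l: "t = of_int l" by (rule Ints_cases)
    then have "k \<le> l" using k(2) that K_def by simp
    then have "t = a + real (nat (l - k))" by (simp add: l a_def)
    then show ?thesis using main[of "nat (l - k)"] that by (simp add: algebra_simps)
  qed
  then show ?thesis unfolding affine_fun_on_def by blast
qed (auto simp: affine_fun_on_def)

section \<open>Log-partition functions\<close>

text \<open>Each of the factors \<open>\<bar>u\<bar>\<close> and
  \<open>exp (\<bar>h\<bar> * \<bar>u\<bar>)\<close> costs one
  \<open>exp (\<delta> * \<bar>u\<bar>)\<close>, hence the \<open>2 * \<delta>\<close>. The two
  exponentials on the right cover the two signs of \<open>u\<close>.\<close>

lemma exp_moment_bound:
  fixes u h \<delta> t :: real
  assumes "0 < \<delta>" "\<bar>h\<bar> \<le> \<delta>"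
  shows "\<bar>u\<bar> * (exp (u * t) * exp (\<bar>h\<bar> * \<bar>u\<bar>)) \<le> (exp (u * (t + 2 * \<delta>)) + exp (u * (t - 2 * \<delta>))) / \<delta>"
proof -
  have "\<delta> * \<bar>u\<bar> \<le> exp (\<delta> * \<bar>u\<bar>)" using exp_ge_add_one_self[of "\<delta> * \<bar>u\<bar>"] by linarith
  then have "\<bar>u\<bar> \<le> exp (\<delta> * \<bar>u\<bar>) / \<delta>" using assms by (simp add: field_simps)
  moreover have "exp (\<bar>h\<bar> * \<bar>u\<bar>) \<le> exp (\<delta> * \<bar>u\<bar>)" using assms by (simp add: mult_right_mono)
  ultimately have "\<bar>u\<bar> * exp (\<bar>h\<bar> * \<bar>u\<bar>) \<le> exp (\<delta> * \<bar>u\<bar>) / \<delta> * exp (\<delta> * \<bar>u\<bar>)"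
    by (intro mult_mono) auto
  then have "\<bar>u\<bar> * exp (\<bar>h\<bar> * \<bar>u\<bar>) * exp (u * t) \<le> exp (\<delta> * \<bar>u\<bar>) / \<delta> * exp (\<delta> * \<bar>u\<bar>) * exp (u * t)"
    by (intro mult_right_mono) auto
  also have "\<dots> = exp (2 * \<delta> * \<bar>u\<bar> + u * t) / \<delta>"
    by (simp add: exp_add[symmetric] algebra_simps)
  also have "exp (2 * \<delta> * \<bar>u\<bar> + u * t) \<le> exp (u * (t + 2 * \<delta>)) + exp (u * (t - 2 * \<delta>))"
    by (cases "u \<ge> 0") (simp_all add: algebra_simps)
  finally show ?thesis using assms by (simp add: divide_right_mono mult_ac)
qed

lemma abs_exp_minus_one_le: "\<bar>exp a - 1\<bar> \<le> \<bar>a\<bar> * exp \<bar>a\<bar>" for a :: real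
proof (cases "a \<ge> 0")
  case True
  have "1 - a \<le> exp (- a)" using exp_ge_add_one_self[of "-a"] by simp
  then have "(1 - a) * exp a \<le> exp (-a) * exp a" by (intro mult_right_mono) auto
  then show ?thesis using True by (simp add: exp_minus algebra_simps)
next
  case False
  then have "\<bar>exp a - 1\<bar> \<le> \<bar>a\<bar>" using exp_ge_add_one_self[of a] exp_less_one_iff[of a] by linarith
  also have "\<dots> \<le> \<bar>a\<bar> * exp \<bar>a\<bar>" using mult_left_mono[of 1 "exp \<bar>a\<bar>" "\<bar>a\<bar>"] by simp
  finally show ?thesis .
qed

text \<open>Differentiation under the integral by dominated convergence of the difference quotients.
  The first conclusion has the form of the integrability hypothesis with \<open>u * g u\<close> for
  \<open>g u\<close>, so the lemma can be iterated.\<close>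

lemma exp_moment_deriv:
  fixes g :: "real \<Rightarrow> real" and N :: "real measure"
  assumes [measurable_cong]: "sets N = sets borel"
    and [measurable]: "g \<in> borel_measurable borel"
    and S: "open S" "\<And>t. t \<in> S \<Longrightarrow> integrable N (\<lambda>u. g u * exp (u * t))" and t: "t \<in> S"
  shows "integrable N (\<lambda>u. u * g u * exp (u * t))"
    "((\<lambda>t. \<integral>u. g u * exp (u * t) \<partial>N) has_real_derivative (\<integral>u. u * g u * exp (u * t) \<partial>N)) (at t)"
proof -
  obtain e where e: "0 < e" "cball t e \<subseteq> S" using open_contains_cball[of S] S(1) t by metis
  \<comment> \<open>Half the radius, because the majorant needs exponential moments at distance
    \<open>2 * \<delta>\<close> from \<open>t\<close>.\<close>
  define \<delta> where "\<delta> = e / 2"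
  have \<delta>: "0 < \<delta>" using e \<delta>_def by simp
  have tS: "t + 2 * \<delta> \<in> S" "t - 2 * \<delta> \<in> S" "\<And>h. \<bar>h\<bar> \<le> \<delta> \<Longrightarrow> t + h \<in> S"
    using e unfolding \<delta>_def by (auto simp: subset_iff dist_real_def)
  define w where "w = (\<lambda>u. \<bar>g u * exp (u * (t + 2 * \<delta>))\<bar> / \<delta> + \<bar>g u * exp (u * (t - 2 * \<delta>))\<bar> / \<delta>)"
  have w: "integrable N w" unfolding w_def
    by (intro Bochner_Integration.integrable_add integrable_divide integrable_abs S(2) tS)
  have bnd: "\<bar>g u\<bar> * (\<bar>u\<bar> * (exp (u * t) * exp (\<bar>h\<bar> * \<bar>u\<bar>))) \<le> w u" if "\<bar>h\<bar> \<le> \<delta>" for u h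
  proof -
    have "\<bar>g u\<bar> * (\<bar>u\<bar> * (exp (u * t) * exp (\<bar>h\<bar> * \<bar>u\<bar>)))
        \<le> \<bar>g u\<bar> * ((exp (u * (t + 2 * \<delta>)) + exp (u * (t - 2 * \<delta>))) / \<delta>)"
      using exp_moment_bound[OF \<delta> that] by (intro mult_left_mono) auto
    also have "\<dots> = w u" unfolding w_def by (simp add: abs_mult add_divide_distrib algebra_simps)
    finally show ?thesis .
  qed
  show int: "integrable N (\<lambda>u. u * g u * exp (u * t))"
  proof (rule Bochner_Integration.integrable_bound[OF w])
    show "AE u in N. norm (u * g u * exp (u * t)) \<le> norm (w u)"
    proof (rule AE_I2)
      fix u show "norm (u * g u * exp (u * t)) \<le> norm (w u)"
        using bnd[of 0 u] \<delta> by (simp add: abs_mult mult_ac)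
    qed
  qed auto
  have "((\<lambda>h. ((\<integral>u. g u * exp (u * (t + h)) \<partial>N) - (\<integral>u. g u * exp (u * t) \<partial>N)) / h)
      \<longlongrightarrow> (\<integral>u. u * g u * exp (u * t) \<partial>N)) (at 0)"
    unfolding tendsto_at_iff_sequentially
  proof safe
    fix X :: "nat \<Rightarrow> real" assume X: "\<forall>i. X i \<in> UNIV - {0}" "X \<longlonglongrightarrow> 0"
    then have X0: "X i \<noteq> 0" for i by auto
    define q where "q = (\<lambda>h u. (g u * exp (u * (t + h)) - g u * exp (u * t)) / h)"
    have "\<forall>\<^sub>F i in sequentially. \<bar>X i\<bar> < \<delta>" using X(2) \<delta> by (simp add: LIMSEQ_iff eventually_sequentially)
    \<comment> \<open>The majorant holds only for increments up to \<open>\<delta>\<close>, so the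
      sequence is shifted by \<open>n0\<close>; the limit does not notice.\<close>
    then obtain n0 where "\<forall>i\<ge>n0. \<bar>X i\<bar> < \<delta>" unfolding eventually_sequentially by blast
    then have n0: "\<bar>X (i + n0)\<bar> \<le> \<delta>" for i by (simp add: less_imp_le)
    have "(\<lambda>i. \<integral>u. q (X (i + n0)) u \<partial>N) \<longlonglongrightarrow> (\<integral>u. u * g u * exp (u * t) \<partial>N)"
    proof (rule integral_dominated_convergence[where w=w])
      show "AE u in N. (\<lambda>i. q (X (i + n0)) u) \<longlonglongrightarrow> u * g u * exp (u * t)"
      proof (rule AE_I2)
        fix u
        have "((\<lambda>s. g u * exp (u * s)) has_real_derivative u * g u * exp (u * t)) (at t)"
          by (auto intro!: derivative_eq_intros)
        then have "((\<lambda>h. q h u) \<longlongrightarrow> u * g u * exp (u * t)) (at 0)"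
          by (simp add: DERIV_def q_def)
        then have "(\<lambda>i. q (X i) u) \<longlonglongrightarrow> u * g u * exp (u * t)"
          by (rule filterlim_compose) (simp add: filterlim_at X(2) X0)
        then show "(\<lambda>i. q (X (i + n0)) u) \<longlonglongrightarrow> u * g u * exp (u * t)"
          by (rule LIMSEQ_ignore_initial_segment)
      qed
      show "AE u in N. norm (q (X (i + n0)) u) \<le> w u" for i
      proof (rule AE_I2)
        fix u
        define h where "h = X (i + n0)"
        have h: "h \<noteq> 0" "\<bar>h\<bar> \<le> \<delta>" using X0 n0 h_def by auto
        have "q h u = g u * exp (u * t) * (exp (u * h) - 1) / h"
          unfolding q_def by (simp add: exp_add algebra_simps)
        then have "\<bar>q h u\<bar> = \<bar>g u\<bar> * exp (u * t) * \<bar>exp (u * h) - 1\<bar> / \<bar>h\<bar>"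
          by (simp add: abs_mult)
        also have "\<dots> \<le> \<bar>g u\<bar> * exp (u * t) * (\<bar>u * h\<bar> * exp \<bar>u * h\<bar>) / \<bar>h\<bar>"
          by (intro divide_right_mono mult_left_mono abs_exp_minus_one_le) auto
        also have "\<dots> = \<bar>g u\<bar> * (\<bar>u\<bar> * (exp (u * t) * exp (\<bar>h\<bar> * \<bar>u\<bar>)))"
          using h by (simp add: abs_mult mult_ac)
        also have "\<dots> \<le> w u" using bnd h by blast
        finally show "norm (q (X (i + n0)) u) \<le> w u" by (simp add: h_def)
      qed
    qed (use w in \<open>auto simp: q_def\<close>)
    moreover have "(\<integral>u. q (X (i + n0)) u \<partial>N) =
        ((\<integral>u. g u * exp (u * (t + X (i + n0))) \<partial>N) - (\<integral>u. g u * exp (u * t) \<partial>N)) / X (i + n0)" for i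
      unfolding q_def using S(2)[OF t] S(2)[OF tS(3)[OF n0[of i]]] by simp
    ultimately have "(\<lambda>i. ((\<integral>u. g u * exp (u * (t + X (i + n0))) \<partial>N) - (\<integral>u. g u * exp (u * t) \<partial>N)) / X (i + n0))
        \<longlonglongrightarrow> (\<integral>u. u * g u * exp (u * t) \<partial>N)" by simp
    then show "((\<lambda>h. ((\<integral>u. g u * exp (u * (t + h)) \<partial>N) - (\<integral>u. g u * exp (u * t) \<partial>N)) / h) \<circ> X)
        \<longlonglongrightarrow> (\<integral>u. u * g u * exp (u * t) \<partial>N)"
      unfolding comp_def
      by (rule LIMSEQ_offset[where k=n0])
  qed
  then show "((\<lambda>t. \<integral>u. g u * exp (u * t) \<partial>N) has_real_derivative (\<integral>u. u * g u * exp (u * t) \<partial>N)) (at t)"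
    by (simp add: DERIV_def)
qed

text \<open>The carrier is only known to be positive on the support interior. Since
  \<open>ennreal\<close> truncates negative reals to 0, truncating the carrier leaves the partition
  function unchanged and gives a nonnegative integrand.\<close>

lemma partition_fun_eq_integral:
  assumes [measurable_cong]: "sets (nu M j) = sets borel"
    and [measurable]: "carrier_dens M j \<in> borel_measurable borel"
    and t: "t \<in> natural_domain M j"
  defines "g \<equiv> \<lambda>u. max 0 (carrier_dens M j u)"
  shows "integrable (nu M j) (\<lambda>u. g u * exp (u * t))"
    "enn2real (partition_fun M j t) = (\<integral>u. g u * exp (u * t) \<partial>nu M j)"
proof -
  have [measurable]: "g \<in> borel_measurable borel" unfolding g_def by measurable
  have "ennreal (carrier_dens M j u * exp (u * t)) = ennreal (g u * exp (u * t))" for u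
    unfolding g_def by (cases "0 \<le> carrier_dens M j u")
      (auto simp: max_def ennreal_neg mult_nonpos_nonneg)
  then have eq: "partition_fun M j t = (\<integral>\<^sup>+u. ennreal (g u * exp (u * t)) \<partial>nu M j)"
    unfolding partition_fun_def by simp
  have fin: "partition_fun M j t < \<infinity>" using t by (simp add: natural_domain_def)
  have g0: "0 \<le> g u" for u by (simp add: g_def)
  show int: "integrable (nu M j) (\<lambda>u. g u * exp (u * t))"
    using fin g0 unfolding eq by (intro integrableI_nonneg) (auto simp: mult_nonneg_nonneg)
  show "enn2real (partition_fun M j t) = (\<integral>u. g u * exp (u * t) \<partial>nu M j)"
    unfolding eq using int g0 by (subst integral_eq_nn_integral) auto
qed

lemma partition_fun_pos:
  assumes [measurable_cong]: "sets (nu M j) = sets borel"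
    and [measurable]: "carrier_dens M j \<in> borel_measurable borel"
    and pos: "AE u in nu M j. 0 < carrier_dens M j u" and nz: "\<not> (AE u in nu M j. False)"
  shows "0 < partition_fun M j t"
proof (rule ccontr)
  assume "\<not> ?thesis"
  then have "(\<integral>\<^sup>+u. ennreal (carrier_dens M j u * exp (u * t)) \<partial>nu M j) = 0"
    by (simp add: partition_fun_def)
  then have "AE u in nu M j. ennreal (carrier_dens M j u * exp (u * t)) = 0"
    by (subst (asm) nn_integral_0_iff_AE) auto
  with pos have "AE u in nu M j. False" by eventually_elim (auto simp: ennreal_eq_0_iff mult_le_0_iff)
  with nz show False by simp
qed

text \<open>In the interior of the natural domain all moments of the tilted carrier can be
  differentiated in \<open>t\<close>; the two derivatives are the mean and the variance of the
  tilted law.\<close>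

lemma log_partition_twice_differentiable:
  assumes sN: "sets (nu M j) = sets borel"
    and bm: "carrier_dens M j \<in> borel_measurable borel"
    and pos: "AE u in nu M j. 0 < carrier_dens M j u" and nz: "\<not> (AE u in nu M j. False)"
  obtains A' A'' where
    "\<And>t. t \<in> interior (natural_domain M j) \<Longrightarrow> (log_partition M j has_real_derivative A' t) (at t)"
    "\<And>t. t \<in> interior (natural_domain M j) \<Longrightarrow> (A' has_real_derivative A'' t) (at t)"
proof -
  define g where "g = (\<lambda>u. max 0 (carrier_dens M j u))"
  have [measurable]: "g \<in> borel_measurable borel" unfolding g_def using bm by measurable
  let ?N = "nu M j" and ?S = "interior (natural_domain M j)"
  \<comment> \<open>\<open>Z k\<close> is the unnormalised \<open>k\<close>-th moment;
    \<open>exp_moment_deriv\<close> for \<open>g u\<close> and then for \<open>u * g u\<close> gives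
    Z 0' = Z 1 and Z 1' = Z 2.\<close>
  define Z where "Z k t = (\<integral>u. u ^ k * g u * exp (u * t) \<partial>?N)" for k t
  have I0: "integrable ?N (\<lambda>u. g u * exp (u * t))" if "t \<in> ?S" for t
    using partition_fun_eq_integral(1)[OF sN bm] that interior_subset unfolding g_def by blast
  have D0: "(Z 0 has_real_derivative Z 1 t) (at t)" "integrable ?N (\<lambda>u. (u * g u) * exp (u * t))"
    if "t \<in> ?S" for t
    using exp_moment_deriv[OF sN _ _ I0 that] unfolding Z_def by (auto simp: fun_eq_iff)
  have D1: "(Z 1 has_real_derivative Z 2 t) (at t)" if "t \<in> ?S" for t
    using exp_moment_deriv(2)[OF sN _ _ D0(2) that] unfolding Z_def
    by (auto simp: power2_eq_square mult.assoc)
  have Zeq: "enn2real (partition_fun M j t) = Z 0 t" if "t \<in> ?S" for t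
    using partition_fun_eq_integral(2)[OF sN bm] that interior_subset unfolding g_def Z_def by force
  have Zpos: "0 < Z 0 t" if "t \<in> ?S" for t
    using partition_fun_pos[OF assms, of t] that interior_subset[of "natural_domain M j"]
    by (auto simp: natural_domain_def enn2real_positive_iff less_top Zeq[OF that, symmetric])
  have lnd: "((\<lambda>t. ln (Z 0 t)) has_real_derivative Z 1 t / Z 0 t) (at t)" if "t \<in> ?S" for t
    using D0(1)[OF that] Zpos[OF that] by (auto intro!: derivative_eq_intros)
  have "(log_partition M j has_real_derivative Z 1 t / Z 0 t) (at t)" if "t \<in> ?S" for t
  proof (rule DERIV_cong_ev[THEN iffD1, OF refl _ refl lnd[OF that]])
    show "\<forall>\<^sub>F s in nhds t. ln (Z 0 s) = log_partition M j s"
      using eventually_nhds_in_open[OF open_interior that]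
      by eventually_elim (simp add: log_partition_def Zeq)
  qed
  moreover have "((\<lambda>t. Z 1 t / Z 0 t) has_real_derivative
      (Z 2 t * Z 0 t - Z 1 t * Z 1 t) / (Z 0 t * Z 0 t)) (at t)" if "t \<in> ?S" for t
    using D0(1)[OF that] D1[OF that] Zpos[OF that] by (auto intro!: derivative_eq_intros)
  ultimately show ?thesis by (rule that)
qed

section \<open>Reference measures and their products\<close>

lemma sets_nu [simp, measurable_cong]: "sets (nu M j) = sets borel"
  by (cases "kind M j") (auto simp: nu_def)

lemma space_nu [simp]: "space (nu M j) = UNIV"
  by (cases "kind M j") (auto simp: nu_def)

lemma countable_valid_support: "valid_support Count S \<Longrightarrow> countable S"
proof -
  assume "valid_support Count S"
  then have "S \<subseteq> range of_int" by (simp add: Ints_def)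
  then show ?thesis by (rule countable_subset) simp
qed

lemma valid_support_borel: "valid_support k S \<Longrightarrow> S \<in> sets borel"
proof (cases k)
  case Continuous
  assume "valid_support k S"
  then have "is_interval S" using Continuous by simp
  then show ?thesis by (rule real_interval_borel_measurable)
next
  case Count
  assume "valid_support k S"
  then have "countable S" unfolding Count by (rule countable_valid_support)
  show ?thesis by (rule sets.countable[OF _ \<open>countable S\<close>]) simp
qed

lemma supp_int_subset: "supp_int M j \<subseteq> var_supp M j"
  by (cases "kind M j") (auto simp: supp_int_def interior_subset)

lemma supp_int_borel [measurable]:
  assumes "valid_support (kind M j) (var_supp M j)"
  shows "supp_int M j \<in> sets borel"
  using valid_support_borel[OF assms] by (cases "kind M j") (auto simp: supp_int_def)

lemma open_supp_int: "kind M j = Continuous \<Longrightarrow> open (supp_int M j)"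
  by (simp add: supp_int_def)

lemma convex_supp_int:
  "valid_support (kind M j) (var_supp M j) \<Longrightarrow> kind M j = Continuous \<Longrightarrow> convex (supp_int M j)"
  by (simp add: supp_int_def is_interval_convex_1 convex_interior)

lemma supp_int_minus_singleton:
  assumes "valid_support (kind M j) (var_supp M j)"
  shows "supp_int M j - {c} \<noteq> {}"
proof (cases "kind M j")
  case Continuous
  then have ne: "interior (var_supp M j) \<noteq> {}" using assms by simp
  have "\<not> interior (var_supp M j) \<subseteq> {c}"
    using ne open_interior[of "var_supp M j"] by (metis not_open_singleton subset_singletonD)
  then show ?thesis by (auto simp: supp_int_def Continuous)
next
  case Count
  then have "infinite (var_supp M j) \<or> 3 \<le> card (var_supp M j)" using assms by simp
  then have "\<not> var_supp M j \<subseteq> {c}"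
    using card_mono[of "{c}" "var_supp M j"] finite_subset[of "var_supp M j" "{c}"] by auto
  then show ?thesis by (auto simp: supp_int_def Count)
qed

lemma sigma_finite_nu:
  assumes v: "valid_support (kind M j) (var_supp M j)"
  shows "sigma_finite_measure (nu M j)"
proof (cases "kind M j")
  case Continuous
  have [measurable]: "var_supp M j \<in> sets borel" using valid_support_borel[OF v] .
  let ?A = "range (\<lambda>n::nat. {- real n..real n})"
  have fin: "emeasure (nu M j) {- real n..real n} < \<infinity>" for n
  proof -
    have "emeasure (nu M j) {- real n..real n}
        = (\<integral>\<^sup>+u. indicator (var_supp M j) u * indicator {- real n..real n} u \<partial>lborel)"
      by (simp add: nu_def Continuous emeasure_density)
    also have "\<dots> \<le> (\<integral>\<^sup>+u. indicator {- real n..real n} u \<partial>lborel)"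
      by (intro nn_integral_mono) (auto split: split_indicator)
    also have "\<dots> = ennreal (2 * real n)" by simp
    also have "\<dots> < \<infinity>" by simp
    finally show ?thesis .
  qed
  have "emeasure (nu M j) a \<noteq> \<infinity>" if a: "a \<in> ?A" for a
  proof -
    obtain n where "a = {- real n..real n}" using a by blast
    then show ?thesis using fin[of n] by simp
  qed
  moreover have "(\<Union>?A) = UNIV"
  proof -
    have "\<exists>n. x \<in> {- real n..real n}" for x :: real
      using real_arch_simple[of "\<bar>x\<bar>"] by (metis abs_le_iff atLeastAtMost_iff minus_le_iff)
    then show ?thesis by blast
  qed
  ultimately show ?thesis by (intro sigma_finite_measure.intro exI[of _ ?A]) auto
next
  case Count
  let ?S = "var_supp M j"
  have S: "countable ?S" "?S \<in> sets borel"
    using countable_valid_support[OF v[unfolded Count]] valid_support_borel[OF v] .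
  \<comment> \<open>The atoms of the support have mass one. Its complement is null and completes the
    cover of the real line, on which the measure is defined.\<close>
  let ?A = "insert (- ?S) ((\<lambda>x. {x}) ` ?S)"
  have e: "emeasure (nu M j) B = emeasure (count_space ?S) (B \<inter> ?S)" if "B \<in> sets borel" for B
    using that by (simp add: nu_def Count emeasure_distr)
  have "emeasure (nu M j) a \<noteq> \<infinity>" if "a \<in> ?A" for a
    using that S(2) by (auto simp: e borel_comp)
  then show ?thesis using S by (intro sigma_finite_measure.intro exI[of _ ?A]) (auto simp: borel_comp)
qed

text \<open>For an interval this is negligibility of the frontier of a convex set. It is the reason
  why fixing the density on support interiors determines the law.\<close>

lemma AE_nu_supp_int:
  assumes v: "valid_support (kind M j) (var_supp M j)"
  shows "AE u in nu M j. u \<in> supp_int M j"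
proof (cases "kind M j")
  case Continuous
  let ?S = "var_supp M j"
  have [measurable]: "?S \<in> sets borel" using valid_support_borel[OF v] .
  have "negligible (frontier ?S)"
    using v Continuous by (intro negligible_convex_frontier) (simp add: is_interval_convex)
  then have "frontier ?S \<in> null_sets lborel"
    using frontier_closed[of ?S] by (simp add: negligible_iff_null_sets null_sets_completion_iff)
  then have "AE u in lborel. u \<notin> frontier ?S" by (rule AE_not_in)
  then have "AE u in lborel. u \<in> ?S \<longrightarrow> u \<in> interior ?S"
    by eventually_elim (use closure_subset in \<open>auto simp: frontier_def\<close>)
  moreover have "indicator ?S \<in> borel_measurable lborel" by measurable
  ultimately show ?thesis
    unfolding nu_def Continuous ref_measure.simps supp_int_def support_interior.simps
    by (subst AE_density) (auto elim!: eventually_mono split: split_indicator_asm)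
next
  case Count
  then have "{x \<in> space borel. x \<in> var_supp M j} \<in> sets borel"
    using valid_support_borel[OF v] by simp
  then show ?thesis unfolding nu_def Count ref_measure.simps supp_int_def support_interior.simps
    by (subst AE_distr_iff) (auto simp: AE_count_space)
qed

lemma emeasure_nu_open_pos:
  assumes v: "valid_support (kind M j) (var_supp M j)" and k: "kind M j = Continuous"
    and U: "open U" "U \<subseteq> supp_int M j" "U \<noteq> {}"
  shows "0 < emeasure (nu M j) U"
proof -
  have [measurable]: "var_supp M j \<in> sets borel" "U \<in> sets borel"
    using valid_support_borel[OF v] U by auto
  have "emeasure (nu M j) U = (\<integral>\<^sup>+u. indicator U u \<partial>lborel)"
    using order.trans[OF U(2) supp_int_subset]
    by (auto simp: nu_def k emeasure_density simp del: nn_integral_indicator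
        intro!: nn_integral_cong split: split_indicator)
  then have e: "emeasure (nu M j) U = emeasure lborel U" by simp
  have "U \<notin> null_sets lebesgue"
    using open_not_negligible[OF U(1,3)] by (simp add: negligible_iff_null_sets)
  then have "U \<notin> null_sets lborel" by (simp add: null_sets_completion_iff)
  then have "emeasure lborel U \<noteq> 0" by (auto simp: null_sets_def)
  then show ?thesis unfolding e by (simp add: zero_less_iff_neq_zero)
qed

lemma emeasure_nu_singleton:
  assumes "kind M j = Count" "u \<in> supp_int M j"
  shows "emeasure (nu M j) {u} = 1"
  using assms by (simp add: nu_def emeasure_distr supp_int_def)

text \<open>This is how "two values of x_i" is used: an affine function of x_i that is almost
  everywhere constant must have slope zero.\<close>

lemma not_AE_nu_eq:
  assumes v: "valid_support (kind M j) (var_supp M j)"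
  shows "\<not> (AE u in nu M j. u = c)"
proof
  assume ae: "AE u in nu M j. u = c"
  \<comment> \<open>A set of positive measure that avoids \<open>c\<close>: an open set for a
    continuous variable, an atom for a count variable.\<close>
  define U where "U = (if kind M j = Continuous then supp_int M j - {c}
     else {SOME u. u \<in> supp_int M j - {c}})"
  have U: "0 < emeasure (nu M j) U" "c \<notin> U" "U \<in> sets borel"
  proof -
    have s: "(SOME u. u \<in> supp_int M j - {c}) \<in> supp_int M j - {c}"
      unfolding some_in_eq by (rule supp_int_minus_singleton[OF v])
    show "c \<notin> U" using s unfolding U_def by auto
    show "U \<in> sets borel" using supp_int_borel[OF v] unfolding U_def by auto
    show "0 < emeasure (nu M j) U"
    proof (cases "kind M j")
      case Continuous
      then show ?thesis using supp_int_minus_singleton[OF v, of c] open_supp_int[OF Continuous]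
        unfolding U_def by (auto intro!: emeasure_nu_open_pos[OF v])
    next
      case Count
      then show ?thesis using s unfolding U_def by (simp add: emeasure_nu_singleton)
    qed
  qed
  have "AE u in nu M j. u \<notin> U" using ae by eventually_elim (use U in auto)
  then have "emeasure (nu M j) U = 0"
    using U(3) by (subst (asm) AE_iff_measurable[OF _ refl]) auto
  with U(1) show False by simp
qed

lemma not_AE_nu_False:
  assumes "valid_support (kind M j) (var_supp M j)"
  shows "\<not> (AE u in nu M j. False)"
  using not_AE_nu_eq[OF assms, of 0] eventually_mono by blast

lemma in_supp_int_prodD: "x \<in> supp_int_prod M A \<Longrightarrow> i \<in> A \<Longrightarrow> x i \<in> supp_int M i"
  by (auto simp: supp_int_prod_def)

lemma restrict_in_supp_int_prod:
  "x \<in> supp_int_prod M A \<Longrightarrow> B \<subseteq> A \<Longrightarrow> restrict x B \<in> supp_int_prod M B"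
  by (auto simp: supp_int_prod_def)

lemma upd_in_supp_int_prod:
  "x \<in> supp_int_prod M (insert i A) \<or> x \<in> supp_int_prod M A \<Longrightarrow> t \<in> supp_int M i \<Longrightarrow>
   x(i := t) \<in> supp_int_prod M (insert i A)"
  by (auto simp: supp_int_prod_def PiE_iff extensional_def)

lemma upd_in_supp_int_prod':
  "x \<in> supp_int_prod M A \<Longrightarrow> i \<in> A \<Longrightarrow> t \<in> supp_int M i \<Longrightarrow> x(i := t) \<in> supp_int_prod M A"
  by (auto simp: supp_int_prod_def PiE_iff extensional_def)

section \<open>Almost-everywhere statements on products of reference measures\<close>

locale glm_supports =
  fixes d :: nat and M :: glm_model
  assumes supports: "j \<in> {1..d} \<Longrightarrow> valid_support (kind M j) (var_supp M j)"
begin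

text \<open>Outside \<open>{1..d}\<close> the measures \<open>nu M j\<close> are unconstrained, hence possibly not sigma-finite.\<close>

definition nu' :: "nat \<Rightarrow> real measure" where
  "nu' j = (if j \<in> {1..d} then nu M j else lborel)"

sublocale product_sigma_finite nu'
  unfolding product_sigma_finite_def nu'_def
  using sigma_finite_nu[OF supports] sigma_finite_lborel by (simp only: split: if_split) blast

lemma PiM_nu: "I \<subseteq> {1..d} \<Longrightarrow> Pi\<^sub>M I (nu M) = Pi\<^sub>M I nu'"
  by (intro PiM_cong) (auto simp: nu'_def)

lemma supp_int_nonempty: "j \<in> {1..d} \<Longrightarrow> supp_int M j \<noteq> {}"
  using supp_int_minus_singleton[OF supports] by blast

lemma supp_int_prod_nonempty: "A \<subseteq> {1..d} \<Longrightarrow> supp_int_prod M A \<noteq> {}"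
  using supp_int_nonempty by (auto simp: supp_int_prod_def PiE_eq_empty_iff)

lemma ex_extension:
  assumes "A \<subseteq> B" "B \<subseteq> {1..d}" "x \<in> supp_int_prod M A"
  obtains y where "y \<in> supp_int_prod M B" "restrict y A = x"
proof -
  obtain z where z: "z \<in> supp_int_prod M B" using supp_int_prod_nonempty[OF assms(2)] by blast
  let ?y = "\<lambda>i. if i \<in> A then x i else z i"
  have "?y \<in> supp_int_prod M B"
    using z assms(1,3) by (auto simp: supp_int_prod_def PiE_iff extensional_def)
  moreover have "restrict ?y A = x"
    using assms(3) by (auto simp: supp_int_prod_def PiE_iff extensional_def restrict_def)
  ultimately show ?thesis using that by blast
qed

lemma AE_supp_int_prod:
  assumes I: "finite I" "I \<subseteq> {1..d}"
  shows "AE x in Pi\<^sub>M I (nu M). x \<in> supp_int_prod M I"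
proof -
  have 1: "AE x in Pi\<^sub>M I nu'. x i \<in> supp_int M i" if i: "i \<in> I" for i
  proof (rule AE_I)
    let ?A = "\<lambda>l. if l = i then - supp_int M i else UNIV"
    have iv: "i \<in> {1..d}" using i I by blast
    have ms: "?A l \<in> sets (nu' l)" for l
      using supp_int_borel[OF supports[OF iv]] by (auto simp: nu'_def borel_comp)
    show "{x \<in> space (Pi\<^sub>M I nu'). \<not> x i \<in> supp_int M i} \<subseteq> Pi\<^sub>E I ?A"
      by (auto simp: space_PiM PiE_iff extensional_def)
    show "Pi\<^sub>E I ?A \<in> sets (Pi\<^sub>M I nu')"
      using ms by (intro sets_PiM_I_finite I)
    have "AE u in nu M i. u \<in> supp_int M i" using AE_nu_supp_int[OF supports[OF iv]] .
    then have "emeasure (nu M i) (- supp_int M i) = 0"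
      using supp_int_borel[OF supports[OF iv]]
      by (subst (asm) AE_iff_measurable[OF _ refl]) (auto simp: Compl_eq borel_comp)
    then have "emeasure (nu' i) (?A i) = 0" using iv by (simp add: nu'_def)
    then show "emeasure (Pi\<^sub>M I nu') (Pi\<^sub>E I ?A) = 0"
      using emeasure_PiM[OF I(1) ms] I(1) i by (auto simp: prod_zero_iff)
  qed
  have "AE x in Pi\<^sub>M I nu'. \<forall>i\<in>I. x i \<in> supp_int M i"
    using 1 I(1) by (intro AE_finite_allI) auto
  moreover have "AE x in Pi\<^sub>M I nu'. x \<in> space (Pi\<^sub>M I nu')" by simp
  ultimately show ?thesis unfolding PiM_nu[OF I(2)]
    by eventually_elim (auto simp: supp_int_prod_def space_PiM PiE_iff)
qed

text \<open>Fubini for null sets. \<open>Q\<close> may be nonmeasurable, so the argument runs on a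
  measurable null set \<open>N\<close> that covers its exceptions.\<close>

lemma AE_PiM_insert:
  assumes I: "finite I" "i \<notin> I" "insert i I \<subseteq> {1..d}"
    and ae: "AE x in Pi\<^sub>M (insert i I) (nu M). Q x"
  shows "AE x in Pi\<^sub>M I (nu M). AE u in nu M i. Q (x(i := u))"
proof -
  have I': "I \<subseteq> {1..d}" "i \<in> {1..d}" using I by auto
  from ae obtain N where N: "{x \<in> space (Pi\<^sub>M (insert i I) nu'). \<not> Q x} \<subseteq> N"
    "N \<in> null_sets (Pi\<^sub>M (insert i I) nu')"
    unfolding PiM_nu[OF I(3)] by (auto simp: eventually_ae_filter)
  then have [measurable]: "N \<in> sets (Pi\<^sub>M (insert i I) nu')" by auto
  have m: "(\<lambda>(x, u). x(i := u)) \<in> Pi\<^sub>M I nu' \<Otimes>\<^sub>M nu' i \<rightarrow>\<^sub>M Pi\<^sub>M (insert i I) nu'"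
    by (rule measurable_add_dim)
  have "(\<lambda>(x, u). indicator N (x(i := u)) :: ennreal) \<in> borel_measurable (Pi\<^sub>M I nu' \<Otimes>\<^sub>M nu' i)"
    using measurable_compose[OF m borel_measurable_indicator[of N]] by (simp add: case_prod_beta')
  then have [measurable]: "(\<lambda>x. \<integral>\<^sup>+u. indicator N (x(i := u)) \<partial>nu' i) \<in> borel_measurable (Pi\<^sub>M I nu')"
    by (rule sigma_finite_measure.borel_measurable_nn_integral[OF sigma_finite_measures])
  have "0 = (\<integral>\<^sup>+x. indicator N x \<partial>Pi\<^sub>M (insert i I) nu')" using null_setsD1[OF N(2)] by simp
  also have "\<dots> = (\<integral>\<^sup>+x. (\<integral>\<^sup>+u. indicator N (x(i := u)) \<partial>nu' i) \<partial>Pi\<^sub>M I nu')"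
    by (rule product_nn_integral_insert[OF I(1,2)]) simp
  finally have "AE x in Pi\<^sub>M I nu'. (\<integral>\<^sup>+u. indicator N (x(i := u)) \<partial>nu' i) = 0"
    by (simp add: nn_integral_0_iff_AE)
  moreover have "AE x in Pi\<^sub>M I nu'. x \<in> space (Pi\<^sub>M I nu')" by simp
  ultimately have "AE x in Pi\<^sub>M I nu'. AE u in nu' i. Q (x(i := u))"
  proof eventually_elim
    case (elim x)
    have mu: "(\<lambda>u. x(i := u)) \<in> nu' i \<rightarrow>\<^sub>M Pi\<^sub>M (insert i I) nu'"
      using measurable_component_update[OF elim(2) I(2)] .
    have "(\<lambda>u. indicator N (x(i := u)) :: ennreal) \<in> borel_measurable (nu' i)"
      using measurable_compose[OF mu borel_measurable_indicator[of N]] by simp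
    then have "AE u in nu' i. indicator N (x(i := u)) = (0::ennreal)"
      using elim(1) by (simp add: nn_integral_0_iff_AE)
    then show ?case
    proof (rule AE_mp, intro AE_I2 impI)
      fix u assume u: "u \<in> space (nu' i)" "indicator N (x(i := u)) = (0::ennreal)"
      have "x(i := u) \<in> space (Pi\<^sub>M (insert i I) nu')" using measurable_space[OF mu u(1)] .
      then show "Q (x(i := u))" using N(1) u(2) by (auto simp: indicator_eq_0_iff)
    qed
  qed
  moreover have e: "nu' i = nu M i" using I'(2) by (simp add: nu'_def)
  ultimately show ?thesis unfolding PiM_nu[OF I'(1)] e by blast
qed

text \<open>A nonzero value would persist on a box around \<open>x\<close> that is open in the
  continuous coordinates and a single point in the count coordinates, and such a box has positive
  measure. This is why continuity on slices with frozen count coordinates is enough.\<close>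

lemma eq_0_if_AE_eq_0:
  fixes g :: "(nat \<Rightarrow> real) \<Rightarrow> real"
  assumes I: "finite I" "I \<subseteq> {1..d}"
    and D: "\<And>i. i \<in> I \<Longrightarrow> D i \<subseteq> supp_int M i"
      "\<And>i. i \<in> I \<Longrightarrow> kind M i = Continuous \<Longrightarrow> open (D i)"
    and cont: "\<And>w. continuous_on {x \<in> Pi\<^sub>E I D. \<forall>i\<in>I. kind M i = Count \<longrightarrow> x i = w i} g"
    and ae: "AE x in Pi\<^sub>M I (nu M). x \<in> Pi\<^sub>E I D \<longrightarrow> g x = 0"
    and x: "x \<in> Pi\<^sub>E I D"
  shows "g x = 0"
proof (rule ccontr)
  assume nz: "g x \<noteq> 0"
  \<comment> \<open>The slice through \<open>x\<close> itself: the count coordinates are frozen at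
    their values in \<open>x\<close>.\<close>
  let ?D = "{y \<in> Pi\<^sub>E I D. \<forall>i\<in>I. kind M i = Count \<longrightarrow> y i = x i}"
  have "openin (top_of_set ?D) (?D \<inter> g -` (- {0}))"
    using cont[of x] by (rule continuous_openin_preimage_gen) auto
  then obtain W where W: "open W" "?D \<inter> g -` (- {0}) = ?D \<inter> W" by (auto simp: openin_open)
  have "x \<in> W" using W(2) x nz by blast
  then obtain X where X: "x \<in> Pi\<^sub>E UNIV X" "\<And>i. open (X i)" "Pi\<^sub>E UNIV X \<subseteq> W"
    using product_topology_open_contains_basis[of "\<lambda>i. euclidean" UNIV W x] W(1)
    by (auto simp: open_fun_def)
  define B where "B i = (if kind M i = Continuous then X i \<inter> D i else {x i})" for i
  have B: "B i \<in> sets borel" "0 < emeasure (nu M i) (B i)" "x i \<in> B i" "B i \<subseteq> X i \<inter> D i" if i: "i \<in> I" for i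
  proof -
    have xi: "x i \<in> X i" "x i \<in> D i" using X(1) x i by auto
    show "B i \<in> sets borel" unfolding B_def using X(2) D(2)[OF i] by auto
    show "x i \<in> B i" "B i \<subseteq> X i \<inter> D i" unfolding B_def using xi by auto
    show "0 < emeasure (nu M i) (B i)"
    proof (cases "kind M i")
      case Continuous
      have "0 < emeasure (nu M i) (X i \<inter> D i)"
        by (rule emeasure_nu_open_pos) (use X(2)[of i] D[OF i] xi supports I(2) i Continuous in blast)+
      then show ?thesis unfolding B_def using Continuous by simp
    next
      case Count
      then show ?thesis unfolding B_def using D(1)[OF i] xi by (auto simp: emeasure_nu_singleton)
    qed
  qed
  have sub: "g y \<noteq> 0 \<and> y \<in> Pi\<^sub>E I D" if y: "y \<in> Pi\<^sub>E I B" for y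
  proof -
    \<comment> \<open>The basic open set constrains all coordinates; outside \<open>I\<close> the
      points \<open>x\<close> and \<open>y\<close> agree because both are \<open>undefined\<close>
      there.\<close>
    have "y i \<in> X i" for i
    proof (cases "i \<in> I")
      case True then show ?thesis using y B(4)[OF True] by auto
    next
      case False
      then have "y i = x i" using y x by (auto simp: PiE_iff extensional_def)
      then show ?thesis using X(1) by auto
    qed
    then have "y \<in> W" using X(3) by auto
    moreover have "y \<in> Pi\<^sub>E I D" using y B(4) PiE_mono[of I B D] by blast
    moreover have "y i = x i" if "i \<in> I" "kind M i = Count" for i
    proof -
      have "y i \<in> B i" using y that by auto
      then show ?thesis unfolding B_def using that by simp
    qed
    ultimately show ?thesis using W(2) by blast
  qed
  have Bs: "B i \<in> sets (nu' i)" if "i \<in> I" for i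
    using B(1)[OF that] that I(2) by (auto simp: nu'_def)
  have BM: "Pi\<^sub>E I B \<in> sets (Pi\<^sub>M I nu')"
    using Bs by (intro sets_PiM_I_finite I)
  have "AE y in Pi\<^sub>M I nu'. y \<notin> Pi\<^sub>E I B"
    using ae unfolding PiM_nu[OF I(2)] by eventually_elim (use sub in blast)
  then have "emeasure (Pi\<^sub>M I nu') (Pi\<^sub>E I B) = 0"
    using AE_iff_null_sets[OF BM] by blast
  moreover have "emeasure (Pi\<^sub>M I nu') (Pi\<^sub>E I B) = (\<Prod>i\<in>I. emeasure (nu' i) (B i))"
    using Bs by (intro emeasure_PiM I)
  moreover have "emeasure (nu' i) (B i) \<noteq> 0" if "i \<in> I" for i
    using B(2)[OF that] that I(2) by (auto simp: nu'_def)
  ultimately show False using I(1) by (simp add: prod_zero_iff)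
qed

end

section \<open>Ancestral sets\<close>

lemma ancestral_subset: "ancestral d E R \<Longrightarrow> R \<subseteq> {1..d}"
  by (induction rule: ancestral.induct) auto

lemma ancestral_finite: "ancestral d E R \<Longrightarrow> finite R"
  by (rule finite_subset[OF ancestral_subset finite_atLeastAtMost])

lemma Pa_subset: "dag d E \<Longrightarrow> Pa E j \<subseteq> {1..d}"
  by (auto simp: dag_def Pa_def)

lemma ancestral_Pa_subset:
  assumes "ancestral d E R" "dag d E"
  shows "j \<in> R \<Longrightarrow> Pa E j \<subseteq> R"
  using assms(1)
proof (induction arbitrary: j rule: ancestral.induct)
  case all then show ?case using Pa_subset[OF assms(2)] by blast
next
  case (remove_sink R s)
  then show ?case by (auto simp: sink_in_def Pa_def)
qed

lemma dag_irrefl: "dag d E \<Longrightarrow> (j, j) \<notin> E"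
  by (auto simp: dag_def acyclic_def)

lemma wf_converse_dag: "dag d E \<Longrightarrow> wf (E\<inverse>)"
  unfolding dag_def
  by (elim conjE, rule finite_acyclic_wf_converse) (rule finite_subset, auto)

text \<open>Take a child of \<open>j\<close> in \<open>R\<close> that is minimal for the converse
  edge relation, which is well-founded on a finite acyclic graph.\<close>

lemma ex_last_child:
  assumes "dag d E" "j \<in> R" "\<not> sink_in E R j"
  shows "\<exists>i\<in>R. (j, i) \<in> E \<and> (\<forall>l\<in>R. (j, l) \<in> E \<longrightarrow> (i, l) \<notin> E)"
proof -
  let ?Q = "{i \<in> R. (j, i) \<in> E}"
  obtain i0 where i0: "i0 \<in> ?Q" using assms by (auto simp: sink_in_def)
  have "\<exists>i\<in>?Q. \<forall>l. (l, i) \<in> E\<inverse> \<longrightarrow> l \<notin> ?Q"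
    by (rule wf_eq_minimal[THEN iffD1, rule_format, OF wf_converse_dag[OF assms(1)] i0])
  then show ?thesis by blast
qed

lemma ex_sink:
  assumes "dag d E" "R \<noteq> {}"
  obtains s where "sink_in E R s"
proof -
  obtain s where "s \<in> R" "\<And>l. (l, s) \<in> E\<inverse> \<Longrightarrow> l \<notin> R"
    using wfE_min'[OF wf_converse_dag[OF assms(1)] assms(2)] by blast
  then show ?thesis using that by (auto simp: sink_in_def)
qed

text \<open>The rule generated with \<open>ancestral\<close> descends from the full vertex set. This
  one climbs from the empty set, adding at each step a node that is a sink of the larger set;
  finiteness provides the sink and cardinality the induction.\<close>

lemma ancestral_induct [consumes 2, case_names empty step]:
  assumes "dag d E" and R: "ancestral d E R" and empty: "Q {}"
    and step: "\<And>R s. ancestral d E R \<Longrightarrow> sink_in E R s \<Longrightarrow> ancestral d E (R - {s}) \<Longrightarrow> Q (R - {s}) \<Longrightarrow> Q R"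
  shows "Q R"
  using R
proof (induction "card R" arbitrary: R)
  case 0
  then show ?case using ancestral_finite empty by auto
next
  case (Suc n)
  then have "R \<noteq> {}" by auto
  then obtain s where s: "sink_in E R s" using ex_sink[OF assms(1)] by blast
  have a: "ancestral d E (R - {s})" using ancestral.remove_sink[OF Suc.prems s] .
  have "s \<in> R" using s by (simp add: sink_in_def)
  then have "n = card (R - {s})" using Suc.hyps(2) ancestral_finite[OF Suc.prems] by simp
  then show ?case using step[OF Suc.prems s a] Suc.hyps(1)[OF _ a] by blast
qed

section \<open>Curvature as a relation\<close>

text \<open>For continuous coordinates the relation also asserts that the derivatives exist, which
  makes it additive; for count coordinates there is nothing to assert beyond the value.\<close>

fun curv_at :: "var_kind \<Rightarrow> nat \<Rightarrow> ((nat \<Rightarrow> real) \<Rightarrow> real) \<Rightarrow> (nat \<Rightarrow> real) \<Rightarrow> real \<Rightarrow> bool" where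
  "curv_at Continuous j f x v \<longleftrightarrow> has_d2 (\<lambda>t. f (x(j := t))) v (x j)"
| "curv_at Count j f x v \<longleftrightarrow> v = curv Count j f x"

lemma curv_at_imp_curv: "curv_at k j f x v \<Longrightarrow> curv k j f x = v"
  by (cases k) (auto simp: has_d2_imp_deriv2)

text \<open>Agreement on the support interior suffices: at an admissible value the curvature sees
  only a neighbourhood in the interior, or the three support points t, t + 1, t + 2.\<close>

lemma curv_at_cong:
  assumes "curv_at k j f x v" "x j \<in> admissible_values k S"
    "\<And>t. t \<in> support_interior k S \<Longrightarrow> f (x(j := t)) = g (x(j := t))"
  shows "curv_at k j g x v"
proof (cases k)
  case Continuous
  then show ?thesis using assms by (auto intro: has_d2_cong[where S="interior S"])
next
  case Count
  then have "f (x(j := x j)) = g (x(j := x j))" using assms(2) by (intro assms(3)) auto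
  then show ?thesis using assms Count by auto
qed

lemma curv_at_const: "curv_at k j (\<lambda>y. c) x 0"
  by (cases k) (auto simp: has_d2_const)

lemma curv_at_add:
  "curv_at k j f x v \<Longrightarrow> curv_at k j g x w \<Longrightarrow> curv_at k j (\<lambda>y. f y + g y) x (v + w)"
  by (cases k) (auto intro: has_d2_add)

lemma curv_at_cmult: "curv_at k j f x v \<Longrightarrow> curv_at k j (\<lambda>y. c * f y) x (c * v)"
  by (cases k) (auto intro: has_d2_cmult simp del: curv.simps(1) simp: right_diff_distrib distrib_left)

lemma curv_at_sum:
  "finite A \<Longrightarrow> (\<And>l. l \<in> A \<Longrightarrow> curv_at k j (f l) x (v l)) \<Longrightarrow>
   curv_at k j (\<lambda>y. \<Sum>l\<in>A. f l y) x (\<Sum>l\<in>A. v l)"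
  by (induction A rule: finite_induct) (auto intro: curv_at_const curv_at_add)

text \<open>Applied to the exponent x_j \<eta> - A(\<eta>) of the own factor: this is why the
  parents of a node do not influence its own-factor curvature.\<close>

lemma curv_at_linear: "curv_at k j (\<lambda>y. c * y j + a) x 0"
proof (cases k)
  case Continuous
  have "has_d2 (\<lambda>t. c * t + a) 0 (x j)"
    by (rule has_d2I[where S=UNIV and f'="\<lambda>_. c"]) (auto intro!: derivative_eq_intros)
  then show ?thesis using Continuous by simp
next
  case Count then show ?thesis by (simp add: algebra_simps)
qed

lemma admissible_values_subset: "admissible_values k S \<subseteq> support_interior k S"
  by (cases k) auto

section \<open>Marginals over ancestral sets\<close>

definition adm :: "glm_model \<Rightarrow> nat \<Rightarrow> real set" where
  "adm M j = admissible_values (kind M j) (var_supp M j)"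

lemma adm_subset: "adm M j \<subseteq> supp_int M j"
  using admissible_values_subset by (simp add: adm_def supp_int_def)

lemma restrict_upd: "j \<in> A \<Longrightarrow> restrict (x(j := t)) A = (restrict x A)(j := t)"
  by (auto simp: restrict_def)

lemma restrict_upd_notin: "j \<notin> A \<Longrightarrow> restrict (x(j := t)) A = restrict x A"
  by (auto simp: restrict_def)

lemma cond_dens_cong:
  assumes "x j = y j" "\<And>i. i \<in> Pa E j \<Longrightarrow> x i = y i"
  shows "cond_dens E M j x = cond_dens E M j y"
proof -
  have "restrict x (Pa E j) = restrict y (Pa E j)" using assms by (auto simp: restrict_def)
  then show ?thesis using assms(1) by (simp add: cond_dens_def)
qed

section \<open>Normalisation of the conditional densities and marginalisation\<close>

locale semi_glm =
  fixes d :: nat and E :: "(nat \<times> nat) set" and M :: glm_model and P :: "(nat \<Rightarrow> real) measure"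
  assumes semi: "semi_glm_dag d E M P"

sublocale semi_glm \<subseteq> glm_supports d M
  by unfold_locales (use semi in \<open>auto simp: semi_glm_dag_def\<close>)

context semi_glm
begin

lemma dag: "dag d E"
  and prob: "prob_space P"
  and joint_measurable: "joint_dens M \<in> borel_measurable (Pi\<^sub>M {1..d} (\<lambda>_. borel))"
  and P_eq: "P = density (Pi\<^sub>M {1..d} (nu M)) (\<lambda>x. ennreal (joint_dens M x))"
  and joint_pos: "x \<in> supp_int_prod M {1..d} \<Longrightarrow> 0 < joint_dens M x"
  and joint_eq: "x \<in> supp_int_prod M {1..d} \<Longrightarrow>
    joint_dens M x = (\<Prod>j\<in>{1..d}. cond_dens E M j x)"
  and source: "j \<in> {1..d} \<Longrightarrow> Pa E j = {} \<Longrightarrow> source_regular M j"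
  and nonsource: "j \<in> {1..d} \<Longrightarrow> Pa E j \<noteq> {} \<Longrightarrow> nonsource_regular E M j"
  using semi unfolding semi_glm_dag_def by meson+

lemma Pa_V: "Pa E j \<subseteq> {1..d}"
  using Pa_subset[OF dag] .

lemma nat_par_interior:
  assumes "j \<in> {1..d}" "Pa E j \<noteq> {}" "z \<in> supp_int_prod M (Pa E j)"
  shows "nat_par M j z \<in> interior (natural_domain M j)"
  using nonsource[OF assms(1,2)] assms(3) by (auto simp: nonsource_regular_def)

lemma AE_carrier_pos:
  assumes "j \<in> {1..d}" "Pa E j \<noteq> {}"
  shows "AE u in nu M j. 0 < carrier_dens M j u"
  using AE_nu_supp_int[OF supports[OF assms(1)]]
  by eventually_elim (use nonsource[OF assms] in \<open>auto simp: nonsource_regular_def\<close>)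

lemma cond_dens_pos:
  assumes "j \<in> {1..d}" "x j \<in> supp_int M j"
  shows "0 < cond_dens E M j x"
  using assms source[OF assms(1)] nonsource[OF assms(1)]
  by (auto simp: cond_dens_def Let_def source_regular_def nonsource_regular_def)

lemma cond_dens_measurable:
  assumes "j \<in> {1..d}"
  shows "(\<lambda>u. cond_dens E M j (x(j := u))) \<in> borel_measurable borel"
proof (cases "Pa E j = {}")
  case True
  then show ?thesis using source[OF assms] by (simp add: cond_dens_def source_regular_def)
next
  case False
  have j: "j \<notin> Pa E j" using dag_irrefl[OF dag] by (simp add: Pa_def)
  have [measurable]: "carrier_dens M j \<in> borel_measurable borel"
    using nonsource[OF assms False] by (simp add: nonsource_regular_def)
  show ?thesis using False by (simp add: cond_dens_def restrict_upd_notin[OF j] Let_def)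
qed

text \<open>The factor exp(-A(\<eta>)) is the inverse of the partition function, which is finite
  since \<eta> lies in the natural domain and positive since the carrier is almost everywhere
  positive for a nonzero measure.\<close>

lemma nn_integral_cond_dens:
  assumes j: "j \<in> {1..d}" and x: "restrict x (Pa E j) \<in> supp_int_prod M (Pa E j)"
  shows "(\<integral>\<^sup>+u. ennreal (cond_dens E M j (x(j := u))) \<partial>nu M j) = 1"
proof (cases "Pa E j = {}")
  case True
  then show ?thesis using source[OF j] by (simp add: cond_dens_def source_regular_def)
next
  case False
  have jp: "j \<notin> Pa E j" using dag_irrefl[OF dag] by (simp add: Pa_def)
  have bm [measurable]: "carrier_dens M j \<in> borel_measurable borel"
    using nonsource[OF j False] by (simp add: nonsource_regular_def)
  define \<eta> where "\<eta> = nat_par M j (restrict x (Pa E j))"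
  define Z where "Z = partition_fun M j \<eta>"
  have "\<eta> \<in> natural_domain M j"
    unfolding \<eta>_def using nat_par_interior[OF j False x] interior_subset by blast
  then have Zf: "Z < \<infinity>" by (simp add: natural_domain_def Z_def)
  have Z0: "0 < Z" unfolding Z_def
    by (rule partition_fun_pos[OF sets_nu bm AE_carrier_pos[OF j False]
          not_AE_nu_False[OF supports[OF j]]])
  obtain z where z: "Z = ennreal z" "0 < z"
    using Zf Z0 by (cases Z) (auto simp: ennreal_zero_less_divide)
  have c: "cond_dens E M j (x(j := u)) = inverse z * (carrier_dens M j u * exp (u * \<eta>))" for u
    using False z
    by (simp add: cond_dens_def Let_def restrict_upd_notin[OF jp] \<eta>_def[symmetric]
        log_partition_def Z_def[symmetric] exp_diff field_simps)
  have "(\<integral>\<^sup>+u. ennreal (cond_dens E M j (x(j := u))) \<partial>nu M j)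
      = (\<integral>\<^sup>+u. ennreal (inverse z) * ennreal (carrier_dens M j u * exp (u * \<eta>)) \<partial>nu M j)"
    unfolding c using z by (simp add: ennreal_mult')
  also have "\<dots> = ennreal (inverse z) * Z"
    by (subst nn_integral_cmult) (auto simp: Z_def partition_fun_def)
  also have "\<dots> = 1" using z by (simp add: ennreal_mult'[symmetric])
  finally show ?thesis .
qed

text \<open>For ancestral \<open>R\<close> this is the marginal density
  (\<open>marg_dens_eq\<close>), in a form whose logarithm can be treated factor by factor.\<close>

definition qdens :: "nat set \<Rightarrow> (nat \<Rightarrow> real) \<Rightarrow> real" where
  "qdens R x = (\<Prod>l\<in>R. cond_dens E M l x)"

lemma qdens_pos: "R \<subseteq> {1..d} \<Longrightarrow> x \<in> supp_int_prod M R \<Longrightarrow> 0 < qdens R x"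
  unfolding qdens_def by (intro prod_pos cond_dens_pos) (auto dest: in_supp_int_prodD)

lemma merge_in_supp_int_prod:
  assumes "x \<in> supp_int_prod M R" "y \<in> supp_int_prod M ({1..d} - R)" "R \<subseteq> {1..d}"
  shows "merge R ({1..d} - R) (x, y) \<in> supp_int_prod M {1..d}"
  using assms by (auto simp: supp_int_prod_def merge_def PiE_iff extensional_def)

lemma joint_merge_measurable:
  assumes R: "R \<subseteq> {1..d}" and x: "x \<in> supp_int_prod M R"
  shows "(\<lambda>y. joint_dens M (merge R ({1..d} - R) (x, y)))
    \<in> borel_measurable (Pi\<^sub>M ({1..d} - R) nu')"
proof -
  have V: "R \<union> ({1..d} - R) = {1..d}" using R by blast
  have s: "sets (nu' l) = sets borel" for l by (auto simp: nu'_def)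
  have "joint_dens M \<in> borel_measurable (Pi\<^sub>M (R \<union> ({1..d} - R)) nu')"
    using joint_measurable unfolding V by (simp cong: measurable_cong_sets sets_PiM_cong add: s)
  moreover have "(\<lambda>y. merge R ({1..d} - R) (x, y)) \<in> Pi\<^sub>M ({1..d} - R) nu' \<rightarrow>\<^sub>M
      Pi\<^sub>M (R \<union> ({1..d} - R)) nu'"
  proof (rule measurable_compose[OF measurable_Pair1' measurable_merge])
    show "x \<in> space (Pi\<^sub>M R nu')"
      using x sets_eq_imp_space_eq[OF s] by (auto simp: space_PiM supp_int_prod_def PiE_iff)
  qed
  ultimately show ?thesis by (rule measurable_compose[rotated])
qed

text \<open>Induction downwards from all nodes. Nonnegative integrals allow the order of integration
  to be changed without integrability; the innermost one is the induction hypothesis at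
  \<open>x(s := u)\<close>.\<close>

lemma nn_integral_joint_merge:
  assumes "ancestral d E R"
  shows "x \<in> supp_int_prod M R \<Longrightarrow>
    (\<integral>\<^sup>+y. ennreal (joint_dens M (merge R ({1..d} - R) (x, y))) \<partial>Pi\<^sub>M ({1..d} - R) nu')
      = ennreal (qdens R x)"
  using assms
proof (induction arbitrary: x rule: ancestral.induct)
  case all
  have "merge {1..d} {} (x, \<lambda>k. undefined) = x"
    using all by (auto simp: merge_def supp_int_prod_def PiE_iff extensional_def)
  then show ?case using joint_eq[OF all] by (simp add: nn_integral_empty qdens_def)
next
  case (remove_sink R s)
  let ?R = "R - {s}" and ?W = "{1..d} - R"
  have RV: "R \<subseteq> {1..d}" using remove_sink.hyps(1) by (rule ancestral_subset)
  have s: "s \<in> R" "s \<in> {1..d}" using remove_sink.hyps(2) RV by (auto simp: sink_in_def)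
  have W: "{1..d} - ?R = insert s ?W" using s by auto
  have fR: "finite R" by (rule finite_subset[OF RV finite_atLeastAtMost])
  have xs: "x(s := u) \<in> supp_int_prod M R" if "u \<in> supp_int M s" for u
    using upd_in_supp_int_prod[OF disjI2[OF remove_sink.prems] that] s by (simp add: insert_absorb)
  have Pas: "Pa E s \<subseteq> ?R"
    using ancestral_Pa_subset[OF remove_sink.hyps(1) dag s(1)] dag_irrefl[OF dag] by (auto simp: Pa_def)
  \<comment> \<open>Since \<open>s\<close> is a sink of \<open>R\<close>, no remaining factor reads
    x_s, so they all leave the integral over \<open>u\<close>.\<close>
  have q: "qdens R (x(s := u)) = qdens ?R x * cond_dens E M s (x(s := u))" for u
  proof -
    have "qdens ?R (x(s := u)) = qdens ?R x"
      unfolding qdens_def using remove_sink.hyps(2)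
      by (intro prod.cong refl cond_dens_cong) (auto simp: sink_in_def Pa_def)
    then show ?thesis unfolding qdens_def using prod.remove[OF fR s(1), of "\<lambda>l. cond_dens E M l (x(s := u))"] by (simp add: mult.commute)
  qed
  have m: "merge ?R (insert s ?W) (x, y(s := u)) = merge R ?W (x(s := u), y)" for y u
    using s by (auto simp: merge_def)
  have "(\<integral>\<^sup>+y. ennreal (joint_dens M (merge ?R (insert s ?W) (x, y))) \<partial>Pi\<^sub>M (insert s ?W) nu')
      = (\<integral>\<^sup>+u. (\<integral>\<^sup>+y. ennreal (joint_dens M (merge R ?W (x(s := u), y))) \<partial>Pi\<^sub>M ?W nu') \<partial>nu' s)"
    unfolding m[symmetric]
    using joint_merge_measurable[OF order.trans[OF Diff_subset RV] remove_sink.prems] s(1) unfolding W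
    by (intro product_nn_integral_insert_rev) auto
  also have "\<dots> = (\<integral>\<^sup>+u. (\<integral>\<^sup>+y. ennreal (joint_dens M (merge R ?W (x(s := u), y))) \<partial>Pi\<^sub>M ?W nu') \<partial>nu M s)"
    using s by (simp add: nu'_def)
  also have "\<dots> = (\<integral>\<^sup>+u. ennreal (qdens ?R x) * ennreal (cond_dens E M s (x(s := u))) \<partial>nu M s)"
  \<comment> \<open>The induction hypothesis speaks only of \<open>u\<close> in the support
    interior, hence the almost-everywhere congruence.\<close>
  proof (rule nn_integral_cong_AE)
    show "AE u in nu M s. (\<integral>\<^sup>+y. ennreal (joint_dens M (merge R ?W (x(s := u), y))) \<partial>Pi\<^sub>M ?W nu')
        = ennreal (qdens ?R x) * ennreal (cond_dens E M s (x(s := u)))"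
      using AE_nu_supp_int[OF supports[OF s(2)]]
    proof eventually_elim
      case (elim u)
      have "0 < cond_dens E M s (x(s := u))" using elim s(2) by (intro cond_dens_pos) auto
      then show ?case unfolding remove_sink.IH[OF xs[OF elim]] q by (simp add: ennreal_mult'')
    qed
  qed
  also have "\<dots> = ennreal (qdens ?R x) * (\<integral>\<^sup>+u. ennreal (cond_dens E M s (x(s := u))) \<partial>nu M s)"
    using cond_dens_measurable[OF s(2)] by (intro nn_integral_cmult) simp
  also have "\<dots> = ennreal (qdens ?R x)"
    using nn_integral_cond_dens[OF s(2) restrict_in_supp_int_prod[OF remove_sink.prems Pas]] by simp
  finally show ?case unfolding W .
qed

lemma marg_dens_eq:
  assumes R: "ancestral d E R" and x: "x \<in> supp_int_prod M R"
  shows "marg_dens d M R x = qdens R x"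
proof -
  let ?W = "{1..d} - R"
  note RV = ancestral_subset[OF R]
  have "AE y in Pi\<^sub>M ?W (nu M). y \<in> supp_int_prod M ?W" by (rule AE_supp_int_prod) auto
  \<comment> \<open>\<open>joint_dens\<close> is pinned down on support interiors only, so its sign
    is known only almost everywhere; this is what the passage to the Bochner integral needs.\<close>
  then have ae: "AE y in Pi\<^sub>M ?W nu'. 0 \<le> joint_dens M (merge R ?W (x, y))"
    unfolding PiM_nu[OF Diff_subset]
    by eventually_elim (use merge_in_supp_int_prod[OF x _ RV] joint_pos in \<open>auto intro: less_imp_le\<close>)
  have "marg_dens d M R x = (\<integral>y. joint_dens M (merge R ?W (x, y)) \<partial>Pi\<^sub>M ?W nu')"
    by (simp add: marg_dens_def PiM_nu)
  also have "\<dots> = enn2real (ennreal (qdens R x))"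
    using integral_eq_nn_integral[OF joint_merge_measurable[OF RV x] ae] nn_integral_joint_merge[OF R x]
    by simp
  finally show ?thesis using qdens_pos[OF RV x] by simp
qed

section \<open>Curvature of the factors\<close>

text \<open>The quantifier order is the content: one function \<kappa> of x_j serves all parent
  values, because the parents contribute only a term affine in x_j to the logarithm.\<close>

lemma curv_at_own_factor:
  assumes j: "j \<in> {1..d}"
  obtains \<kappa> where "\<And>x. x j \<in> adm M j \<Longrightarrow>
    curv_at (kind M j) j (\<lambda>y. ln (cond_dens E M j y)) x (\<kappa> (x j))"
proof -
  define b where "b = (if Pa E j = {} then src_dens M j else carrier_dens M j)"
  have jp: "j \<notin> Pa E j" using dag_irrefl[OF dag] by (simp add: Pa_def)
  have bpos: "0 < b u" if "u \<in> supp_int M j" for u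
    using that source[OF j] nonsource[OF j] by (auto simp: b_def source_regular_def nonsource_regular_def)
  have "\<exists>v. \<forall>x. x j = t \<longrightarrow> curv_at (kind M j) j (\<lambda>y. ln (b (y j))) x v" if t: "t \<in> adm M j" for t
  proof (cases "kind M j")
    case Continuous
    have "C2_real_on (supp_int M j) (\<lambda>u. ln (b u))"
      using source[OF j] nonsource[OF j] Continuous by (auto simp: b_def source_regular_def nonsource_regular_def)
    then obtain g' g'' where g: "\<And>u. u \<in> supp_int M j \<Longrightarrow> ((\<lambda>u. ln (b u)) has_real_derivative g' u) (at u)"
      "\<And>u. u \<in> supp_int M j \<Longrightarrow> (g' has_real_derivative g'' u) (at u)"
      unfolding C2_real_on_def by blast
    have "t \<in> supp_int M j" using t adm_subset by blast
    then have "has_d2 (\<lambda>u. ln (b u)) (g'' t) t"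
      using open_supp_int[OF Continuous] g by (intro has_d2I[where S="supp_int M j" and f'=g']) auto
    then show ?thesis using Continuous by auto
  qed auto
  then obtain \<kappa> where \<kappa>: "\<And>x. x j \<in> adm M j \<Longrightarrow> curv_at (kind M j) j (\<lambda>y. ln (b (y j))) x (\<kappa> (x j))"
    by metis
  have "curv_at (kind M j) j (\<lambda>y. ln (cond_dens E M j y)) x (\<kappa> (x j))" if x: "x j \<in> adm M j" for x
  proof -
    \<comment> \<open>With zero natural parameter and zero normaliser a source has the same form as
      a non-source, so both are treated together.\<close>
    define \<eta> where "\<eta> = (if Pa E j = {} then 0 else nat_par M j (restrict x (Pa E j)))"
    define a where "a = (if Pa E j = {} then 0 else log_partition M j \<eta>)"
    have "curv_at (kind M j) j (\<lambda>y. ln (b (y j)) + (\<eta> * y j + (- a))) x (\<kappa> (x j) + 0)"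
      by (intro curv_at_add curv_at_linear \<kappa> x)
    then have c: "curv_at (kind M j) j (\<lambda>y. ln (b (y j)) + (\<eta> * y j + (- a))) x (\<kappa> (x j))" by simp
    show ?thesis
    proof (rule curv_at_cong[OF c x[unfolded adm_def]])
      fix t assume "t \<in> support_interior (kind M j) (var_supp M j)"
      then have t: "0 < b t" using bpos by (simp add: supp_int_def)
      show "ln (b ((x(j := t)) j)) + (\<eta> * (x(j := t)) j + (- a)) = ln (cond_dens E M j (x(j := t)))"
        using t by (cases "Pa E j = {}")
          (simp_all add: cond_dens_def b_def \<eta>_def a_def Let_def restrict_upd_notin[OF jp] ln_mult mult.commute)
    qed
  qed
  then show ?thesis using that by blast
qed

lemma nat_par_derivs:
  assumes i: "i \<in> {1..d}" and j: "j \<in> Pa E i" "kind M j = Continuous"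
    and z: "z \<in> supp_int_prod M (Pa E i)"
  shows "((\<lambda>t. nat_par M i (z(j := t))) has_real_derivative pd j (nat_par M i) z) (at (z j))"
    "((\<lambda>t. pd j (nat_par M i) (z(j := t))) has_real_derivative
        curv Continuous j (nat_par M i) z) (at (z j))"
proof -
  let ?D = "{x \<in> supp_int_prod M (Pa E i). \<forall>l\<in>Pa E i. kind M l = Count \<longrightarrow> x l = z l}"
  have C2: "C2_in {l \<in> Pa E i. kind M l = Continuous} ?D (nat_par M i)"
    using nonsource[OF i] j(1) unfolding nonsource_regular_def by auto
  have zD: "z \<in> ?D" using z by simp
  have jI: "j \<in> {l \<in> Pa E i. kind M l = Continuous}" using j by simp
  have "(\<lambda>t. nat_par M i (z(j := t))) differentiable at (z j)"
    "(\<lambda>t. pd j (nat_par M i) (z(j := t))) differentiable at (z j)"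
    using C2 zD jI unfolding C2_in_def C1_in_def by blast+
  then show "((\<lambda>t. nat_par M i (z(j := t))) has_real_derivative pd j (nat_par M i) z) (at (z j))"
    "((\<lambda>t. pd j (nat_par M i) (z(j := t))) has_real_derivative
        curv Continuous j (nat_par M i) z) (at (z j))"
    by (simp_all add: pd_def DERIV_deriv_iff_real_differentiable numeral_2_eq_2)
qed

lemma nat_par_has_derivs:
  assumes i: "i \<in> {1..d}" and j: "j \<in> Pa E i" "kind M j = Continuous"
    and z: "z \<in> supp_int_prod M (Pa E i - {j}) \<or> z \<in> supp_int_prod M (Pa E i)" and t: "t \<in> supp_int M j"
  shows "((\<lambda>t. nat_par M i (z(j := t))) has_real_derivative pd j (nat_par M i) (z(j := t))) (at t)"
    "((\<lambda>t. pd j (nat_par M i) (z(j := t))) has_real_derivative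
        curv Continuous j (nat_par M i) (z(j := t))) (at t)"
proof -
  have "z(j := t) \<in> supp_int_prod M (Pa E i)"
    using upd_in_supp_int_prod[of z M j "Pa E i - {j}" t] z t j(1) by (auto simp: insert_absorb)
  from nat_par_derivs[OF i j this] show
    "((\<lambda>t. nat_par M i (z(j := t))) has_real_derivative pd j (nat_par M i) (z(j := t))) (at t)"
    "((\<lambda>t. pd j (nat_par M i) (z(j := t))) has_real_derivative
        curv Continuous j (nat_par M i) (z(j := t))) (at t)" by simp_all
qed

lemma curv_at_nat_par:
  assumes i: "i \<in> {1..d}" and j: "j \<in> Pa E i"
    and z: "z \<in> supp_int_prod M (Pa E i)" "z j \<in> adm M j"
  shows "curv_at (kind M j) j (nat_par M i) z (curv (kind M j) j (nat_par M i) z)"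
proof (cases "kind M j")
  case Continuous
  have zj: "z j \<in> supp_int M j" using z(2) adm_subset by blast
  have "has_d2 (\<lambda>t. nat_par M i (z(j := t))) (curv Continuous j (nat_par M i) (z(j := z j))) (z j)"
    using nat_par_has_derivs[OF i j Continuous disjI2[OF z(1)]] open_supp_int[OF Continuous] zj
    by (intro has_d2I[where S="supp_int M j" and f'="\<lambda>t. pd j (nat_par M i) (z(j := t))"]) blast+
  then show ?thesis by (simp add: Continuous)
qed simp

text \<open>Existence is the whole point: the value depends on the parents of \<open>i\<close> but
  not on x_i, and is absorbed into the constant of \<open>curv_at_child_factor\<close>.\<close>

lemma curv_at_log_partition:
  assumes i: "i \<in> {1..d}" and j: "j \<in> Pa E i"
    and z: "z \<in> supp_int_prod M (Pa E i)" "z j \<in> adm M j"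
  shows "\<exists>a. curv_at (kind M j) j (\<lambda>y. log_partition M i (nat_par M i y)) z a"
proof (cases "kind M j")
  case Continuous
  have Pa: "Pa E i \<noteq> {}" using j by blast
  have bm: "carrier_dens M i \<in> borel_measurable borel"
    using nonsource[OF i Pa] by (simp add: nonsource_regular_def)
  obtain A' A'' where A: "\<And>t. t \<in> interior (natural_domain M i) \<Longrightarrow> (log_partition M i has_real_derivative A' t) (at t)"
    "\<And>t. t \<in> interior (natural_domain M i) \<Longrightarrow> (A' has_real_derivative A'' t) (at t)"
    using log_partition_twice_differentiable[OF sets_nu bm AE_carrier_pos[OF i Pa]
          not_AE_nu_False[OF supports[OF i]]] by blast
  have "has_d2 (\<lambda>t. nat_par M i (z(j := t))) (curv Continuous j (nat_par M i) z) (z j)"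
    using curv_at_nat_par[OF assms] by (simp add: Continuous)
  moreover have "nat_par M i (z(j := z j)) \<in> interior (natural_domain M i)"
    using nat_par_interior[OF i Pa z(1)] by simp
  ultimately have "\<exists>c. has_d2 (\<lambda>t. log_partition M i (nat_par M i (z(j := t)))) c (z j)"
    using A by (intro has_d2_comp[where f="\<lambda>t. nat_par M i (z(j := t))" and h="log_partition M i" and U="interior (natural_domain M i)" and h'=A'
          and w="A'' (nat_par M i (z(j := z j)))"]) auto
  then show ?thesis using Continuous by simp
qed simp

text \<open>In ln b(u) + u \<eta> - A(\<eta>) the coordinate x_j enters only through \<eta>, so the
  curvature is affine in the child value u. The constant \<open>a\<close> is chosen before
  \<open>u\<close>.\<close>

lemma curv_at_child_factor:
  assumes i: "i \<in> {1..d}" and j: "j \<in> Pa E i"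
    and x: "restrict x (Pa E i) \<in> supp_int_prod M (Pa E i)" "x j \<in> adm M j"
  shows "\<exists>a. \<forall>u\<in>supp_int M i. curv_at (kind M j) j (\<lambda>y. ln (cond_dens E M i y)) (x(i := u))
    (u * curv (kind M j) j (nat_par M i) (restrict x (Pa E i)) + a)"
proof -
  let ?z = "restrict x (Pa E i)" and ?k = "kind M j"
  have Pa: "Pa E i \<noteq> {}" using j by blast
  have ip: "i \<notin> Pa E i" "j \<noteq> i" using j dag_irrefl[OF dag] by (auto simp: Pa_def)
  have zj: "?z j \<in> adm M j" using x j by simp
  obtain a where a: "curv_at ?k j (\<lambda>y. log_partition M i (nat_par M i y)) ?z a"
    using curv_at_log_partition[OF i j x(1) zj] by blast
  \<comment> \<open>Passes from functions of the parent coordinates to functions of the full point: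
    restriction to the parents commutes with updates of x_j and ignores x_i.\<close>
  have lift: "curv_at ?k j (\<lambda>y. f (restrict y (Pa E i))) (x(i := u)) v"
    if f: "curv_at ?k j f ?z v" for f :: "(nat \<Rightarrow> real) \<Rightarrow> real" and v u
  proof -
    have r: "restrict (x(i := u, j := t)) (Pa E i) = ?z(j := t)" for t
      using ip(1) j by (auto simp: restrict_def)
    have r': "restrict (x(i := u)) (Pa E i) = ?z" using ip(1) by (auto simp: restrict_def)
    show ?thesis using f j ip by (cases ?k) (auto simp: r r')
  qed
  have "curv_at ?k j (\<lambda>y. ln (cond_dens E M i y)) (x(i := u))
     (u * curv ?k j (nat_par M i) ?z + (- a))" if u: "u \<in> supp_int M i" for u
  proof -
    have b: "0 < carrier_dens M i u" using u nonsource[OF i Pa] by (simp add: nonsource_regular_def)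
    have "curv_at ?k j (\<lambda>y. ln (carrier_dens M i u) + (u * nat_par M i (restrict y (Pa E i)) +
        (-1) * log_partition M i (nat_par M i (restrict y (Pa E i))))) (x(i := u))
        (0 + (u * curv ?k j (nat_par M i) ?z + (-1) * a))"
      by (intro curv_at_add curv_at_const curv_at_cmult lift[OF a] lift[OF curv_at_nat_par[OF i j x(1) zj]])
    then have c: "curv_at ?k j (\<lambda>y. ln (carrier_dens M i u) + (u * nat_par M i (restrict y (Pa E i)) +
        (-1) * log_partition M i (nat_par M i (restrict y (Pa E i))))) (x(i := u))
        (u * curv ?k j (nat_par M i) ?z + (- a))" by simp
    show ?thesis
    proof (rule curv_at_cong[OF c])
      show "(x(i := u)) j \<in> admissible_values ?k (var_supp M j)" using x ip by (simp add: adm_def)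
      fix t
      have "(x(i := u, j := t)) i = u" using ip by simp
      then show "ln (carrier_dens M i u) + (u * nat_par M i (restrict (x(i := u, j := t)) (Pa E i)) +
        (-1) * log_partition M i (nat_par M i (restrict (x(i := u, j := t)) (Pa E i))))
        = ln (cond_dens E M i (x(i := u, j := t)))"
        using Pa b by (simp add: cond_dens_def Let_def ln_mult)
    qed
  qed
  then show ?thesis by blast
qed

lemma curv_at_other_factor:
  assumes "l \<noteq> j" "j \<notin> Pa E l"
  shows "curv_at k j (\<lambda>y. ln (cond_dens E M l y)) x 0"
proof -
  have "cond_dens E M l (x(j := t)) = cond_dens E M l x" for t
    using assms by (intro cond_dens_cong) auto
  then show ?thesis by (cases k) (auto simp: has_d2_const)
qed

lemma curv_at_ln_qdens:
  assumes R: "R \<subseteq> {1..d}" "j \<in> R" and x: "x \<in> supp_int_prod M R" "x j \<in> adm M j"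
    and v: "\<And>l. l \<in> R \<Longrightarrow> curv_at (kind M j) j (\<lambda>y. ln (cond_dens E M l y)) x (v l)"
  shows "curv_at (kind M j) j (\<lambda>y. ln (qdens R y)) x (\<Sum>l\<in>R. v l)"
proof (rule curv_at_cong)
  show "curv_at (kind M j) j (\<lambda>y. \<Sum>l\<in>R. ln (cond_dens E M l y)) x (\<Sum>l\<in>R. v l)"
    using v by (intro curv_at_sum finite_subset[OF R(1) finite_atLeastAtMost])
  show "x j \<in> admissible_values (kind M j) (var_supp M j)" using x by (simp add: adm_def)
  fix t assume t: "t \<in> support_interior (kind M j) (var_supp M j)"
  have "x(j := t) \<in> supp_int_prod M R"
    using upd_in_supp_int_prod'[OF x(1) R(2)] t by (simp add: supp_int_def)
  then have "0 < cond_dens E M l (x(j := t))" if "l \<in> R" for l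
    using that R(1) in_supp_int_prodD[of "x(j := t)" M R l] by (intro cond_dens_pos) auto
  then have "cond_dens E M l (x(j := t)) \<noteq> 0" if "l \<in> R" for l using that by (metis less_irrefl)
  then show "(\<Sum>l\<in>R. ln (cond_dens E M l (x(j := t)))) = ln (qdens R (x(j := t)))"
    unfolding qdens_def
    by (subst ln_prod) (auto intro: finite_subset[OF R(1) finite_atLeastAtMost]
        \<open>\<And>l. l \<in> R \<Longrightarrow> 0 < cond_dens E M l (x(j := t))\<close>)
qed

text \<open>A single \<kappa> describes both curvatures, so that constancy of the own-factor
  curvature, assumed for points of the full product, carries over to the marginal on
  \<open>R\<close>.\<close>

lemma curv_ln_qdens_sink:
  assumes R: "R \<subseteq> {1..d}" and s: "sink_in E R j"
  shows "\<exists>\<kappa>. (\<forall>x\<in>supp_int_prod M R. x j \<in> adm M j \<longrightarrow>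
      curv (kind M j) j (\<lambda>y. ln (qdens R y)) x = \<kappa> (x j)) \<and>
    (\<forall>x. x j \<in> adm M j \<longrightarrow> own_curvature E M j x = \<kappa> (x j))"
proof -
  have j: "j \<in> R" "j \<in> {1..d}" using s R by (auto simp: sink_in_def)
  obtain \<kappa> where \<kappa>: "\<And>x. x j \<in> adm M j \<Longrightarrow>
    curv_at (kind M j) j (\<lambda>y. ln (cond_dens E M j y)) x (\<kappa> (x j))" using curv_at_own_factor[OF j(2)] by blast
  have fR: "finite R" by (rule finite_subset[OF R(1) finite_atLeastAtMost])
  show ?thesis
  proof (intro exI[of _ \<kappa>] conjI ballI allI impI)
    fix x assume x: "x \<in> supp_int_prod M R" "x j \<in> adm M j"
    have "curv_at (kind M j) j (\<lambda>y. ln (qdens R y)) x (\<Sum>l\<in>R. if l = j then \<kappa> (x j) else 0)"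
    proof (rule curv_at_ln_qdens[OF R j(1) x])
      fix l assume "l \<in> R"
      then show "curv_at (kind M j) j (\<lambda>y. ln (cond_dens E M l y)) x (if l = j then \<kappa> (x j) else 0)"
        using \<kappa>[of x, OF x(2)] s curv_at_other_factor[of l j] by (auto simp: sink_in_def Pa_def)
    qed
    then have "curv_at (kind M j) j (\<lambda>y. ln (qdens R y)) x (\<kappa> (x j))" using fR j(1) by simp
    then show "curv (kind M j) j (\<lambda>y. ln (qdens R y)) x = \<kappa> (x j)" by (rule curv_at_imp_curv)
  next
    fix x assume "x j \<in> adm M j"
    then show "own_curvature E M j x = \<kappa> (x j)"
      unfolding own_curvature_def by (intro curv_at_imp_curv \<kappa>)
  qed
qed

text \<open>
  No factor other than that of the last child \<open>i\<close> has both \<open>x\<^sub>i\<close> and \<open>x\<^sub>j\<close> as arguments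
  (for the own factor of \<open>j\<close>, \<open>x\<^sub>i\<close> does not enter the curvature).
\<close>

lemma curv_ln_qdens_last_child:
  assumes R: "R \<subseteq> {1..d}" "\<And>l. l \<in> R \<Longrightarrow> Pa E l \<subseteq> R"
    and ji: "j \<in> R" "i \<in> R" "(j, i) \<in> E"
    and last: "\<And>l. l \<in> R \<Longrightarrow> (j, l) \<in> E \<Longrightarrow> (i, l) \<notin> E"
    and x: "x \<in> supp_int_prod M R" "x j \<in> adm M j"
  shows "\<exists>C. \<forall>u\<in>supp_int M i. curv (kind M j) j (\<lambda>y. ln (qdens R y)) (x(i := u))
     = C + u * curv (kind M j) j (nat_par M i) (restrict x (Pa E i))"
proof -
  let ?k = "kind M j"
  have ne: "j \<noteq> i" using ji dag_irrefl[OF dag] by auto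
  have fR: "finite R" by (rule finite_subset[OF R(1) finite_atLeastAtMost])
  have jp: "j \<in> Pa E i" using ji by (simp add: Pa_def)
  obtain \<kappa> where \<kappa>: "\<And>x. x j \<in> adm M j \<Longrightarrow>
    curv_at ?k j (\<lambda>y. ln (cond_dens E M j y)) x (\<kappa> (x j))"
    using curv_at_own_factor ji(1) R(1) by blast
  have res: "restrict x (Pa E l) \<in> supp_int_prod M (Pa E l)" if "l \<in> R" for l
    using restrict_in_supp_int_prod[OF x(1) R(2)[OF that]] .
  have i: "i \<in> {1..d}" using ji R by blast
  obtain a where a: "\<And>u. u \<in> supp_int M i \<Longrightarrow> curv_at ?k j (\<lambda>y. ln (cond_dens E M i y)) (x(i := u))
    (u * curv ?k j (nat_par M i) (restrict x (Pa E i)) + a)"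
    using curv_at_child_factor[OF i jp res[OF ji(2)] x(2)] by blast
  have "\<exists>w. \<forall>u\<in>supp_int M i. curv_at ?k j (\<lambda>y. ln (cond_dens E M l y)) (x(i := u)) w"
    if l: "l \<in> R - {i}" for l
  proof -
    consider "l = j" | "l \<noteq> j" "j \<notin> Pa E l" | "j \<in> Pa E l" by blast
    then show ?thesis
    proof cases
      case 1
      then show ?thesis using \<kappa>[of "x(i := _)"] x(2) ne by (intro exI[of _ "\<kappa> (x j)"]) auto
    next
      case 2
      then show ?thesis using curv_at_other_factor by blast
    next
      case 3
      have lV: "l \<in> {1..d}" using l R(1) by blast
      have il: "i \<notin> Pa E l" using last[of l] l 3 by (auto simp: Pa_def)
      have "x l \<in> supp_int M l" using in_supp_int_prodD[OF x(1)] l by blast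
      then obtain w where w: "curv_at ?k j (\<lambda>y. ln (cond_dens E M l y)) (x(l := x l)) w"
        using curv_at_child_factor[OF lV 3 res x(2)] l by blast
      have e: "cond_dens E M l (x(i := u, j := t)) = cond_dens E M l (x(j := t))"
        "cond_dens E M l (x(i := u)) = cond_dens E M l x" for u t
        using il l by (auto intro!: cond_dens_cong)
      have "curv_at ?k j (\<lambda>y. ln (cond_dens E M l y)) (x(i := u)) w" for u
        using w ne by (cases ?k) (auto simp: e)
      then show ?thesis by blast
    qed
  qed
  then obtain w where w: "\<And>l u. l \<in> R - {i} \<Longrightarrow> u \<in> supp_int M i \<Longrightarrow>
      curv_at ?k j (\<lambda>y. ln (cond_dens E M l y)) (x(i := u)) (w l)" by metis
  let ?c = "curv ?k j (nat_par M i) (restrict x (Pa E i))"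
  have "curv ?k j (\<lambda>y. ln (qdens R y)) (x(i := u)) = ((\<Sum>l\<in>R - {i}. w l) + a) + u * ?c"
    if u: "u \<in> supp_int M i" for u
  proof -
    have xu: "x(i := u) \<in> supp_int_prod M R" using upd_in_supp_int_prod'[OF x(1) ji(2) u] .
    have "curv_at ?k j (\<lambda>y. ln (qdens R y)) (x(i := u)) (\<Sum>l\<in>R. if l = i then u * ?c + a else w l)"
      using ne x a[OF u] w u by (intro curv_at_ln_qdens[OF R(1) ji(1) xu]) auto
    then have "curv ?k j (\<lambda>y. ln (qdens R y)) (x(i := u)) = (\<Sum>l\<in>R. if l = i then u * ?c + a else w l)"
      by (rule curv_at_imp_curv)
    also have "\<dots> = (u * ?c + a) + (\<Sum>l\<in>R - {i}. w l)"
      by (subst sum.remove[OF fR ji(2)]) (auto intro!: sum.cong)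
    finally show ?thesis by simp
  qed
  then show ?thesis by blast
qed

end

section \<open>Recognising sinks\<close>

text \<open>Functions that agree near a point have the same \<open>deriv\<close> near it, arbitrary
  values included; no differentiability is involved, in contrast to \<open>curv_at\<close>.\<close>

lemma curv_cong:
  assumes "x j \<in> admissible_values k S"
    "\<And>t. t \<in> support_interior k S \<Longrightarrow> f (x(j := t)) = g (x(j := t))"
  shows "curv k j f x = curv k j g x"
proof (cases k)
  case Continuous
  have ev: "\<forall>\<^sub>F t in nhds (x j). f (x(j := t)) = g (x(j := t))"
    using eventually_nhds_in_open[of "interior S" "x j"] assms Continuous by (auto elim!: eventually_mono)
  then have "\<forall>\<^sub>F t in nhds (x j). \<forall>\<^sub>F s in nhds t. f (x(j := s)) = g (x(j := s))"
    by (simp add: eventually_eventually)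
  then have "\<forall>\<^sub>F t in nhds (x j). deriv (\<lambda>t. f (x(j := t))) t = deriv (\<lambda>t. g (x(j := t))) t"
    by eventually_elim (rule deriv_cong_ev, auto)
  then have "deriv (deriv (\<lambda>t. f (x(j := t)))) (x j) = deriv (deriv (\<lambda>t. g (x(j := t)))) (x j)"
    by (rule deriv_cong_ev) simp
  then show ?thesis using Continuous by (simp add: numeral_2_eq_2)
next
  case Count
  then have "f (x(j := x j)) = g (x(j := x j))" using assms(1) by (intro assms(2)) auto
  then show ?thesis using assms Count by auto
qed

lemma continuous_on_restrict:
  fixes A :: "nat set"
  shows "continuous_on D (\<lambda>x :: nat \<Rightarrow> real. restrict x A)"
proof (rule continuous_on_coordinatewise_then_product)
  fix i show "continuous_on D (\<lambda>x. restrict x A i)"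
    by (cases "i \<in> A") (auto intro: continuous_on_subset[OF continuous_on_product_coordinates])
qed

context glm_supports
begin

text \<open>For count variables this is where supports with at least three elements enter.\<close>

lemma adm_nonempty:
  assumes "j \<in> {1..d}"
  shows "adm M j \<noteq> {}"
proof (cases "kind M j")
  case Continuous
  then show ?thesis using supports[OF assms] by (simp add: adm_def)
next
  case Count
  let ?S = "var_supp M j"
  have S: "?S \<subseteq> \<int>" "infinite ?S \<or> 3 \<le> card ?S"
    and cv: "\<And>a b c. a \<in> ?S \<Longrightarrow> b \<in> ?S \<Longrightarrow> c \<in> \<int> \<Longrightarrow> a \<le> c \<Longrightarrow> c \<le> b \<Longrightarrow> c \<in> ?S"
    using supports[OF assms, unfolded Count valid_support.simps] by (elim conjE; blast)+
  obtain T where "T \<subseteq> ?S" "card T = 3"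
    using S(2) infinite_arbitrarily_large[of ?S 3] obtain_subset_with_card_n[of 3 ?S] by metis
  then obtain a b c where abc: "a \<in> ?S" "b \<in> ?S" "c \<in> ?S" "a \<noteq> b" "a \<noteq> c" "b \<noteq> c"
    by (auto simp: card_3_iff)
  then have "a \<in> \<int>" "b \<in> \<int>" "c \<in> \<int>" using S(1) by auto
  then obtain p q r where pqr: "a = of_int p" "b = of_int q" "c = of_int r" by (auto elim!: Ints_cases)
  \<comment> \<open>The extremes of three distinct integers differ by at least 2, so
    \<open>lo\<close>, \<open>lo\<close> + 1 and \<open>lo\<close> + 2 all lie in the
    support.\<close>
  define lo hi where "lo = min p (min q r)" and "hi = max p (max q r)"
  have "of_int lo \<in> ?S" "of_int hi \<in> ?S" using abc pqr by (auto simp: lo_def hi_def min_def max_def)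
  moreover have "lo + 2 \<le> hi" using abc pqr by (auto simp: lo_def hi_def min_def max_def)
  ultimately have "of_int lo \<in> ?S" "of_int lo + 1 \<in> ?S" "of_int lo + 2 \<in> ?S"
    using cv[of "of_int lo" "of_int hi" "of_int lo + 1"] cv[of "of_int lo" "of_int hi" "of_int lo + 2"]
    by auto
  then show ?thesis by (auto simp: adm_def Count)
qed

lemma not_AE_PiM_False:
  assumes I: "finite I" "I \<subseteq> {1..d}"
    and D: "\<And>i. i \<in> I \<Longrightarrow> D i \<subseteq> supp_int M i" "\<And>i. i \<in> I \<Longrightarrow> D i \<noteq> {}"
      "\<And>i. i \<in> I \<Longrightarrow> kind M i = Continuous \<Longrightarrow> open (D i)"
  shows "\<not> (AE x in Pi\<^sub>M I (nu M). x \<notin> Pi\<^sub>E I D)"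
proof
  assume ae: "AE x in Pi\<^sub>M I (nu M). x \<notin> Pi\<^sub>E I D"
  have "Pi\<^sub>E I D \<noteq> {}" using D(2) by (simp add: PiE_eq_empty_iff)
  then obtain x where "x \<in> Pi\<^sub>E I D" by blast
  \<comment> \<open>On a null box the constant function 1 would vanish almost everywhere, hence
    everywhere.\<close>
  then have "(\<lambda>_. 1::real) x = 0"
    by (rule eq_0_if_AE_eq_0[OF I D(1) D(3), rotated -1]) (use ae in auto)
  then show False by simp
qed

text \<open>The reference measures may be infinite, so this is not a marginalisation: for almost
  every choice of the other coordinates the slice gives the claim, and the other coordinates do not
  form a null space.\<close>

lemma AE_PiM_component:
  assumes I: "finite I" "I \<subseteq> {1..d}" "j \<in> I" and ae: "AE x in Pi\<^sub>M I (nu M). Q (x j)"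
  shows "AE u in nu M j. Q u"
proof (rule ccontr)
  assume n: "\<not> ?thesis"
  have I': "insert j (I - {j}) = I" using I by blast
  have "AE x in Pi\<^sub>M (I - {j}) (nu M). AE u in nu M j. Q ((x(j := u)) j)"
    by (rule AE_PiM_insert) (use I ae in \<open>auto simp only: I' finite_Diff fun_upd_same\<close>)
  then have "AE x in Pi\<^sub>M (I - {j}) (nu M). x \<notin> Pi\<^sub>E (I - {j}) (supp_int M)"
    by eventually_elim (use n in simp)
  moreover have "\<not> (AE x in Pi\<^sub>M (I - {j}) (nu M). x \<notin> Pi\<^sub>E (I - {j}) (supp_int M))"
    using I supp_int_nonempty open_supp_int by (intro not_AE_PiM_False) auto
  ultimately show False by contradiction
qed

end

section \<open>From almost-everywhere curvature to sinks\<close>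

context semi_glm
begin

text \<open>The density is positive on the support interiors, so \<open>P\<close> and the product
  reference measure have the same null sets. The premise on the right costs nothing and hands
  membership in the interiors to later proofs.\<close>

lemma AE_P_iff:
  "(AE x in P. Q x) \<longleftrightarrow> (AE x in Pi\<^sub>M {1..d} (nu M). x \<in> supp_int_prod M {1..d} \<longrightarrow> Q x)"
proof -
  have [measurable]: "joint_dens M \<in> borel_measurable (Pi\<^sub>M {1..d} (nu M))"
    using joint_measurable by (subst measurable_cong_sets[OF sets_PiM_cong[OF refl sets_nu] refl])
  have s: "AE x in Pi\<^sub>M {1..d} (nu M). x \<in> supp_int_prod M {1..d}" by (rule AE_supp_int_prod) auto
  have "(AE x in P. Q x) \<longleftrightarrow> (AE x in Pi\<^sub>M {1..d} (nu M). 0 < ennreal (joint_dens M x) \<longrightarrow> Q x)"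
    unfolding P_eq by (rule AE_density) measurable
  also have "\<dots> \<longleftrightarrow> (AE x in Pi\<^sub>M {1..d} (nu M). x \<in> supp_int_prod M {1..d} \<longrightarrow> Q x)"
  proof
    assume "AE x in Pi\<^sub>M {1..d} (nu M). 0 < ennreal (joint_dens M x) \<longrightarrow> Q x"
    then show "AE x in Pi\<^sub>M {1..d} (nu M). x \<in> supp_int_prod M {1..d} \<longrightarrow> Q x"
      by eventually_elim (use joint_pos in auto)
  next
    assume "AE x in Pi\<^sub>M {1..d} (nu M). x \<in> supp_int_prod M {1..d} \<longrightarrow> Q x"
    with s show "AE x in Pi\<^sub>M {1..d} (nu M). 0 < ennreal (joint_dens M x) \<longrightarrow> Q x"
      by eventually_elim auto
  qed
  finally show ?thesis .
qed

lemma C2_in_nat_par: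
  assumes "i \<in> {1..d}" "Pa E i \<noteq> {}"
  shows "C2_in {l \<in> Pa E i. kind M l = Continuous}
    {x \<in> supp_int_prod M (Pa E i). \<forall>l\<in>Pa E i. kind M l = Count \<longrightarrow> x l = w l} (nat_par M i)"
  using nonsource[OF assms] unfolding nonsource_regular_def by blast

lemma continuous_on_nat_par:
  assumes "i \<in> {1..d}" "Pa E i \<noteq> {}"
  shows "continuous_on {x \<in> supp_int_prod M (Pa E i). \<forall>l\<in>Pa E i. kind M l = Count \<longrightarrow> x l = w l}
    (nat_par M i)"
  using C2_in_nat_par[OF assms, of w] unfolding C2_in_def C1_in_def by blast

text \<open>Provides the continuity demanded by \<open>eq_0_if_AE_eq_0\<close>. For continuous
  \<open>j\<close> it is part of the C2 regularity; for count \<open>j\<close> the curvature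
  combines values of \<eta> on three slices.\<close>

lemma continuous_on_curv_nat_par:
  assumes i: "i \<in> {1..d}" and j: "j \<in> Pa E i"
  shows "continuous_on {z \<in> supp_int_prod M (Pa E i). z j \<in> adm M j \<and>
      (\<forall>l\<in>Pa E i. kind M l = Count \<longrightarrow> z l = w l)} (curv (kind M j) j (nat_par M i))"
    (is "continuous_on ?D _")
proof (cases "kind M j")
  case Continuous
  have ne: "Pa E i \<noteq> {}" using j by blast
  have "continuous_on {x \<in> supp_int_prod M (Pa E i). \<forall>l\<in>Pa E i. kind M l = Count \<longrightarrow> x l = w l}
     (pd j (pd j (nat_par M i)))"
    using C2_in_nat_par[OF i ne, of w] j Continuous unfolding C2_in_def C1_in_def by blast
  moreover have "pd j (pd j (nat_par M i)) = curv (kind M j) j (nat_par M i)"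
    by (simp add: fun_eq_iff pd_def Continuous numeral_2_eq_2)
  ultimately show ?thesis by (auto intro: continuous_on_subset)
next
  case Count
  have ne: "Pa E i \<noteq> {}" using j by blast
  \<comment> \<open>Moving coordinate \<open>j\<close> by \<open>c\<close> carries the slice frozen
    at \<open>w\<close> into the slice frozen at \<open>w(j := w j + c)\<close>, where continuity is
    again available.\<close>
  have shift: "continuous_on ?D (\<lambda>z. nat_par M i (z(j := z j + c)))"
    if c: "\<And>t. t \<in> adm M j \<Longrightarrow> t + c \<in> supp_int M j" for c
  proof (rule continuous_on_compose2[OF continuous_on_nat_par[OF i ne, of "w(j := w j + c)"]])
    show "continuous_on ?D (\<lambda>z. z(j := z j + c))"
    proof (rule continuous_on_coordinatewise_then_product)
      fix l show "continuous_on ?D (\<lambda>z. (z(j := z j + c)) l)"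
        by (cases "l = j") (auto intro!: continuous_intros
            continuous_on_subset[OF continuous_on_product_coordinates])
    qed
    show "(\<lambda>z. z(j := z j + c)) ` ?D \<subseteq> {x \<in> supp_int_prod M (Pa E i).
        \<forall>l\<in>Pa E i. kind M l = Count \<longrightarrow> x l = (w(j := w j + c)) l}"
      using c j Count by (auto intro!: upd_in_supp_int_prod')
  qed
  have ad: "t \<in> supp_int M j" "t + 1 \<in> supp_int M j" "t + 2 \<in> supp_int M j" if "t \<in> adm M j" for t
    using that by (auto simp: adm_def Count supp_int_def)
  have "continuous_on ?D (\<lambda>z. nat_par M i (z(j := z j + 2)) - 2 * nat_par M i (z(j := z j + 1))
      + nat_par M i (z(j := z j + 0)))"
    using ad by (intro continuous_intros shift) auto
  then show ?thesis by (simp add: Count)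
qed

text \<open>If the curvature vanished at all admissible points, it would do so along the line on
  which nonlinearity is witnessed, and \<eta> would be affine there.\<close>

lemma nonlinear_curv_nat_par:
  assumes nl: "nonlinear_glm E M" and ji: "(j, i) \<in> E"
  shows "\<exists>z\<in>supp_int_prod M (Pa E i). z j \<in> adm M j \<and> curv (kind M j) j (nat_par M i) z \<noteq> 0"
proof (rule ccontr)
  assume "\<not> ?thesis"
  then have zero: "curv (kind M j) j (nat_par M i) z = 0"
    if "z \<in> supp_int_prod M (Pa E i)" "z j \<in> adm M j" for z using that by blast
  have i: "i \<in> {1..d}" and j: "j \<in> {1..d}" using dag ji by (auto simp: dag_def)
  have jp: "j \<in> Pa E i" using ji by (simp add: Pa_def)
  obtain z where z: "z \<in> supp_int_prod M (Pa E i - {j})"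
    and na: "\<not> affine_fun_on (supp_int M j) (\<lambda>t. nat_par M i (z(j := t)))"
    using nl ji unfolding nonlinear_glm_def by blast
  have zt: "z(j := t) \<in> supp_int_prod M (Pa E i)" if "t \<in> supp_int M j" for t
    using upd_in_supp_int_prod[OF disjI2[OF z] that] jp by (simp add: insert_absorb)
  have "affine_fun_on (supp_int M j) (\<lambda>t. nat_par M i (z(j := t)))"
  proof (cases "kind M j")
    case Continuous
    have "curv Continuous j (nat_par M i) (z(j := t)) = 0" if "t \<in> supp_int M j" for t
      using zero[OF zt[OF that]] that Continuous by (simp add: adm_def supp_int_def)
    then show ?thesis
      using nat_par_has_derivs[OF i jp Continuous disjI1[OF z]] open_supp_int[OF Continuous]
        convex_supp_int[OF supports[OF j] Continuous]
      by (intro affine_fun_on_if_deriv2_zero[where g'="\<lambda>t. pd j (nat_par M i) (z(j := t))"]) metis+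
  next
    case Count
    have s: "supp_int M j = var_supp M j" by (simp add: supp_int_def Count)
    show ?thesis unfolding s
    proof (rule affine_fun_on_if_difference2_zero)
      show "valid_support Count (var_supp M j)" using supports[OF j] unfolding Count .
      fix t assume t: "t \<in> var_supp M j" "t + 1 \<in> var_supp M j" "t + 2 \<in> var_supp M j"
      then show "nat_par M i (z(j := t + 2)) - 2 * nat_par M i (z(j := t + 1)) + nat_par M i (z(j := t)) = 0"
        using zero[OF zt[of t]] by (simp add: s adm_def Count)
    qed
  qed
  with na show False by contradiction
qed

text \<open>The common core of the variance criterion, the score criterion and identifiability.
  \<psi> is an arbitrary function, not assumed measurable, and "almost everywhere" refers to the
  reference measure rather than to a conditional law.\<close>

lemma sink_if_AE_curv_coordinate:
  assumes nl: "nonlinear_glm E M" and R: "ancestral d E R" and jR: "j \<in> R"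
    and ae: "AE x in Pi\<^sub>M {1..d} (nu M). x \<in> supp_int_prod M {1..d} \<longrightarrow> x j \<in> adm M j \<longrightarrow>
      curv (kind M j) j (\<lambda>y. ln (qdens R y)) (restrict x R) = \<psi> (x j)"
  shows "sink_in E R j"
proof (rule ccontr)
  assume "\<not> ?thesis"
  from ex_last_child[OF dag jR this] obtain i where i: "i \<in> R" "(j, i) \<in> E"
    and last: "\<And>l. l \<in> R \<Longrightarrow> (j, l) \<in> E \<Longrightarrow> (i, l) \<notin> E" by blast
  let ?k = "kind M j" and ?V = "{1..d} - {i}"
  have RV: "R \<subseteq> {1..d}" using ancestral_subset[OF R] .
  have iV: "i \<in> {1..d}" using i(1) RV by blast
  have PaR: "Pa E l \<subseteq> R" if "l \<in> R" for l using ancestral_Pa_subset[OF R dag that] .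
  have ne: "j \<noteq> i" using i dag_irrefl[OF dag] by auto
  have jp: "j \<in> Pa E i" using i by (simp add: Pa_def)
  have ip: "i \<notin> Pa E i" using dag_irrefl[OF dag] by (simp add: Pa_def)
  have PaV: "Pa E i \<subseteq> ?V" using Pa_V ip by blast
  have ins: "insert i ?V = {1..d}" using iV by blast
  let ?c = "\<lambda>x. curv ?k j (nat_par M i) (restrict x (Pa E i))"
  \<comment> \<open>The box on which the curvature of \<eta> in x_j is meaningful: admissible values
    for \<open>j\<close>, support interiors for the other coordinates.\<close>
  define D where "D l = (if l = j then adm M j else supp_int M l)" for l
  have "AE x in Pi\<^sub>M ?V (nu M). AE u in nu M i. x(i := u) \<in> supp_int_prod M {1..d} \<longrightarrow>
      (x(i := u)) j \<in> adm M j \<longrightarrow>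
      curv ?k j (\<lambda>y. ln (qdens R y)) (restrict (x(i := u)) R) = \<psi> ((x(i := u)) j)"
  proof (rule AE_PiM_insert)
    show "insert i ?V \<subseteq> {1..d}" unfolding ins ..
    show "AE x in Pi\<^sub>M (insert i ?V) (nu M). x \<in> supp_int_prod M {1..d} \<longrightarrow> x j \<in> adm M j \<longrightarrow>
      curv ?k j (\<lambda>y. ln (qdens R y)) (restrict x R) = \<psi> (x j)"
      unfolding ins by (rule ae)
  qed auto
  then have "AE x in Pi\<^sub>M ?V (nu M). x \<in> Pi\<^sub>E ?V D \<longrightarrow> ?c x = 0"
  proof eventually_elim
    case (elim x)
    show ?case
    proof (rule impI, rule ccontr)
      assume xD: "x \<in> Pi\<^sub>E ?V D" and c0: "?c x \<noteq> 0"
      have jV: "j \<in> ?V" using jR RV ne by blast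
      have xj: "x j \<in> adm M j" using PiE_mem[OF xD jV] by (simp add: D_def)
      have "D l \<subseteq> supp_int M l" for l using adm_subset by (auto simp: D_def)
      then have xV: "x \<in> supp_int_prod M ?V" using xD PiE_mono[of ?V D "supp_int M"]
        unfolding supp_int_prod_def by blast
      have xu: "x(i := u) \<in> supp_int_prod M {1..d}" if "u \<in> supp_int M i" for u
        using upd_in_supp_int_prod[OF disjI2[OF xV] that] unfolding ins .
      obtain u0 where u0: "u0 \<in> supp_int M i" using supp_int_nonempty[OF iV] by blast
      define X where "X = restrict (x(i := u0)) R"
      have X: "X \<in> supp_int_prod M R" "X j \<in> adm M j"
        using restrict_in_supp_int_prod[OF xu[OF u0] RV] xj jR ne by (auto simp: X_def)
      obtain C where C: "\<And>u. u \<in> supp_int M i \<Longrightarrow> curv ?k j (\<lambda>y. ln (qdens R y)) (X(i := u))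
          = C + u * curv ?k j (nat_par M i) (restrict X (Pa E i))"
        using curv_ln_qdens_last_child[OF RV PaR jR i last X] by blast
      have "restrict X (Pa E i) = restrict x (Pa E i)"
      proof (rule ext)
        fix l show "restrict X (Pa E i) l = restrict x (Pa E i) l"
          using PaR[OF i(1)] ip by (cases "l \<in> Pa E i") (auto simp: X_def)
      qed
      moreover have "X(i := u) = restrict (x(i := u)) R" for u
        using i(1) by (auto simp: X_def restrict_def)
      ultimately have C': "curv ?k j (\<lambda>y. ln (qdens R y)) (restrict (x(i := u)) R) = C + u * ?c x"
        if "u \<in> supp_int M i" for u using C[OF that] by simp
      \<comment> \<open>With nonzero slope the affine equation determines x_i, so x_i would be
        almost everywhere equal to one number.\<close>
      have "AE u in nu M i. u = (\<psi> (x j) - C) / ?c x"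
        using elim AE_nu_supp_int[OF supports[OF iV]]
      proof eventually_elim
        case (elim u)
        then have "C + u * ?c x = \<psi> (x j)" using C'[of u] xu[of u] xj ne by simp
        then show ?case using c0 by (simp add: field_simps)
      qed
      then show False using not_AE_nu_eq[OF supports[OF iV]] by blast
    qed
  qed
  \<comment> \<open>Continuity turns the almost-everywhere vanishing of the curvature of \<eta> into
    vanishing on the whole box.\<close>
  then have zero: "?c x = 0" if "x \<in> Pi\<^sub>E ?V D" for x
  proof (rule eq_0_if_AE_eq_0[of ?V D ?c, rotated -2])
    show "continuous_on {x \<in> Pi\<^sub>E ?V D. \<forall>l\<in>?V. kind M l = Count \<longrightarrow> x l = w l} ?c" for w
    proof (rule continuous_on_compose2[OF continuous_on_curv_nat_par[OF iV jp, of w] continuous_on_restrict])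
      show "(\<lambda>x. restrict x (Pa E i)) ` {x \<in> Pi\<^sub>E ?V D. \<forall>l\<in>?V. kind M l = Count \<longrightarrow> x l = w l}
        \<subseteq> {z \<in> supp_int_prod M (Pa E i). z j \<in> adm M j \<and> (\<forall>l\<in>Pa E i. kind M l = Count \<longrightarrow> z l = w l)}"
      proof safe
        fix x assume x: "x \<in> Pi\<^sub>E ?V D" "\<forall>l\<in>?V. kind M l = Count \<longrightarrow> x l = w l"
        have xl: "x l \<in> D l" if "l \<in> Pa E i" for l using x(1) PaV that by blast
        have "D l \<subseteq> supp_int M l" for l using adm_subset by (auto simp: D_def)
        then show "restrict x (Pa E i) \<in> supp_int_prod M (Pa E i)"
          using xl by (fastforce simp: supp_int_prod_def)
        show "restrict x (Pa E i) j \<in> adm M j" using xl[OF jp] jp by (simp add: D_def)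
        fix l assume "l \<in> Pa E i" "kind M l = Count"
        then show "restrict x (Pa E i) l = w l" using x(2) PaV by auto
      qed
    qed
    show "x \<in> Pi\<^sub>E ?V D" by (rule that)
  qed (use adm_subset open_supp_int in \<open>auto simp: D_def adm_def\<close>)
  \<comment> \<open>The point of nonzero curvature has only the parents of \<open>i\<close> as
    coordinates; it is extended to all coordinates but \<open>i\<close>.\<close>
  obtain z where z: "z \<in> supp_int_prod M (Pa E i)" "z j \<in> adm M j" "curv ?k j (nat_par M i) z \<noteq> 0"
    using nonlinear_curv_nat_par[OF nl i(2)] by blast
  obtain x where x: "x \<in> supp_int_prod M ?V" "restrict x (Pa E i) = z"
    using ex_extension[OF PaV _ z(1)] by blast
  have "x j = z j" using x(2) jp by (metis restrict_apply')
  then have "x \<in> Pi\<^sub>E ?V D" using x(1) z(2) by (auto simp: supp_int_prod_def D_def PiE_iff)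
  then have "?c x = 0" by (rule zero)
  then show False using z(3) unfolding x(2) by contradiction
qed

section \<open>Conditional curvature scores\<close>

lemma curv_H_eq:
  assumes R: "ancestral d E R" and j: "j \<in> R" and x: "x \<in> supp_int_prod M R" "x j \<in> adm M j"
  shows "curv_H d M R j x = curv (kind M j) j (\<lambda>y. ln (qdens R y)) x"
proof -
  have "curv (kind M j) j (\<lambda>y. ln (marg_dens d M R y)) x = curv (kind M j) j (\<lambda>y. ln (qdens R y)) x"
  proof (rule curv_cong[of x, OF x(2)[unfolded adm_def]])
    fix t assume "t \<in> support_interior (kind M j) (var_supp M j)"
    then have "x(j := t) \<in> supp_int_prod M R"
      using upd_in_supp_int_prod'[OF x(1) j] by (simp add: supp_int_def)
    then show "ln (marg_dens d M R (x(j := t))) = ln (qdens R (x(j := t)))"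
      by (simp add: marg_dens_eq[OF R])
  qed
  then show ?thesis using x by (simp add: curv_H_def admissible_dom_def adm_def)
qed

lemma adm_borel: "j \<in> {1..d} \<Longrightarrow> adm M j \<in> sets borel"
proof -
  assume j: "j \<in> {1..d}"
  show ?thesis
  proof (cases "kind M j")
    case Count
    have "countable (var_supp M j)" using supports[OF j] countable_valid_support unfolding Count by blast
    moreover have "adm M j \<subseteq> var_supp M j" by (auto simp: adm_def Count)
    ultimately have "countable (adm M j)" by (rule countable_subset[rotated])
    show ?thesis by (rule sets.countable[OF _ \<open>countable (adm M j)\<close>]) simp
  qed (simp add: adm_def)
qed

lemma restrict_measurable_P:
  assumes "R \<subseteq> {1..d}"
  shows "(\<lambda>x. restrict x R) \<in> P \<rightarrow>\<^sub>M Pi\<^sub>M R (\<lambda>_. borel)"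
proof -
  have "(\<lambda>x. restrict x R) \<in> Pi\<^sub>M {1..d} (\<lambda>_. borel) \<rightarrow>\<^sub>M Pi\<^sub>M R (\<lambda>_. borel)"
    using assms by (rule measurable_restrict_subset)
  moreover have "sets P = sets (Pi\<^sub>M {1..d} (\<lambda>_. borel))"
    unfolding P_eq by (simp cong: sets_PiM_cong)
  ultimately show ?thesis by (simp cong: measurable_cong_sets)
qed

definition adm_set :: "nat set \<Rightarrow> nat \<Rightarrow> (nat \<Rightarrow> real) set" where
  "adm_set R j = {x \<in> space (marg_law R P). x j \<in> adm M j}"

lemma cond_law_eq: "cond_law M P R j = uniform_measure (marg_law R P) (adm_set R j)"
  by (simp add: cond_law_def adm_set_def adm_def)

lemma space_marg_law: "space (marg_law R P) = (\<Pi>\<^sub>E i\<in>R. UNIV)"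
  by (simp add: marg_law_def space_PiM)

lemma prob_space_marg_law: "R \<subseteq> {1..d} \<Longrightarrow> prob_space (marg_law R P)"
  unfolding marg_law_def by (rule prob_space.prob_space_distr[OF prob restrict_measurable_P])

lemma adm_set_measurable:
  assumes "R \<subseteq> {1..d}" "j \<in> R"
  shows "adm_set R j \<in> sets (marg_law R P)"
proof -
  have [measurable]: "adm M j \<in> sets borel" using adm_borel assms by blast
  have "{x \<in> space (Pi\<^sub>M R (\<lambda>_. borel :: real measure)). x j \<in> adm M j} \<in> sets (Pi\<^sub>M R (\<lambda>_. borel))"
    using assms(2) by measurable
  then show ?thesis by (simp add: adm_set_def marg_law_def)
qed

lemma AE_marg_lawD:
  assumes R: "R \<subseteq> {1..d}" and ae: "AE x in marg_law R P. Q x"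
  shows "AE x in Pi\<^sub>M {1..d} (nu M). x \<in> supp_int_prod M {1..d} \<longrightarrow> Q (restrict x R)"
  using AE_distrD[OF restrict_measurable_P[OF R] ae[unfolded marg_law_def]] unfolding AE_P_iff .

text \<open>Admissible values exist, and they form an open set or consist of atoms; so conditioning
  on them yields a probability measure.\<close>

lemma adm_set_not_null:
  assumes R: "R \<subseteq> {1..d}" "j \<in> R"
  shows "emeasure (marg_law R P) (adm_set R j) \<noteq> 0"
proof
  assume "emeasure (marg_law R P) (adm_set R j) = 0"
  then have "AE x in marg_law R P. x \<notin> adm_set R j"
    using AE_iff_null_sets[OF adm_set_measurable[OF R]] adm_set_measurable[OF R] by (simp add: null_sets_def)
  from AE_marg_lawD[OF R(1) this]
  have "AE x in Pi\<^sub>M {1..d} (nu M). x \<notin> Pi\<^sub>E {1..d} (\<lambda>l. if l = j then adm M j else supp_int M l)"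
  proof eventually_elim
    case (elim x)
    show ?case
    proof
      assume x: "x \<in> Pi\<^sub>E {1..d} (\<lambda>l. if l = j then adm M j else supp_int M l)"
      have jV: "j \<in> {1..d}" using R by blast
      have "x \<in> supp_int_prod M {1..d}"
        using x adm_subset[of M j] by (auto simp: supp_int_prod_def PiE_iff split: if_splits)
      moreover have "x j \<in> adm M j" using x jV by (auto simp: PiE_iff split: if_splits)
      ultimately show False using elim R(2) by (simp add: adm_set_def space_marg_law)
    qed
  qed
  moreover have "\<not> (AE x in Pi\<^sub>M {1..d} (nu M). x \<notin> Pi\<^sub>E {1..d} (\<lambda>l. if l = j then adm M j else supp_int M l))"
    using adm_subset adm_nonempty supp_int_nonempty open_supp_int
    by (intro not_AE_PiM_False) (auto simp: adm_def)
  ultimately show False by contradiction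
qed

lemma adm_set_finite: "R \<subseteq> {1..d} \<Longrightarrow> emeasure (marg_law R P) (adm_set R j) < \<infinity>"
  using finite_measure.emeasure_finite[OF prob_space.finite_measure[OF prob_space_marg_law], of R]
  by (simp add: less_top)

lemma prob_space_cond_law:
  assumes R: "R \<subseteq> {1..d}" "j \<in> R"
  shows "prob_space (cond_law M P R j)"
  unfolding cond_law_eq using adm_set_not_null[OF R] adm_set_finite[OF R(1), of j]
  by (intro prob_space_uniform_measure) auto

lemma AE_cond_lawD:
  assumes R: "R \<subseteq> {1..d}" "j \<in> R" and ae: "AE x in cond_law M P R j. Q x"
  shows "AE x in Pi\<^sub>M {1..d} (nu M). x \<in> supp_int_prod M {1..d} \<longrightarrow> x j \<in> adm M j \<longrightarrow> Q (restrict x R)"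
proof -
  have "AE x in marg_law R P. x \<in> adm_set R j \<longrightarrow> Q x"
    using ae unfolding cond_law_eq AE_uniform_measure[OF adm_set_not_null[OF R] adm_set_finite[OF R(1)]] .
  from AE_marg_lawD[OF R(1) this] show ?thesis
    by eventually_elim (use R(2) in \<open>auto simp: adm_set_def space_marg_law\<close>)
qed

lemma AE_cond_lawI:
  assumes R: "R \<subseteq> {1..d}" "j \<in> R"
    and Q: "\<And>x. x \<in> supp_int_prod M R \<Longrightarrow> x j \<in> adm M j \<Longrightarrow> Q x"
  shows "AE x in cond_law M P R j. Q x"
  unfolding cond_law_eq
proof (rule AE_uniform_measureI[OF adm_set_measurable[OF R]])
  have "Pi\<^sub>E R (supp_int M) \<in> sets (Pi\<^sub>M R (\<lambda>_. borel))"
    using R(1) supports supp_int_borel finite_subset[OF R(1)] by (intro sets_PiM_I_finite) auto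
  then have m: "{x \<in> space (Pi\<^sub>M R (\<lambda>_. borel)). x \<in> supp_int_prod M R} \<in> sets (Pi\<^sub>M R (\<lambda>_. borel))"
    by (auto simp: supp_int_prod_def intro: sets.sets_Collect)
  have "AE x in P. restrict x R \<in> supp_int_prod M R"
    unfolding AE_P_iff by (rule AE_I2) (use R restrict_in_supp_int_prod in blast)
  then have "AE x in marg_law R P. x \<in> supp_int_prod M R"
    unfolding marg_law_def AE_distr_iff[OF restrict_measurable_P[OF R(1)] m] .
  then show "AE x in marg_law R P. x \<in> adm_set R j \<longrightarrow> Q x"
    by eventually_elim (use Q in \<open>auto simp: adm_set_def\<close>)
qed

lemma curv_variance_eq_0:
  assumes R: "R \<subseteq> {1..d}" "j \<in> R"
    and c: "AE x in cond_law M P R j. curv_H d M R j x = c"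
    and [measurable]: "curv_H d M R j \<in> borel_measurable (cond_law M P R j)"
  shows "curv_variance d M P R j = 0"
proof -
  interpret prob_space "cond_law M P R j" by (rule prob_space_cond_law[OF R])
  have m: "(\<integral>x. curv_H d M R j x \<partial>cond_law M P R j) = c"
    using integral_cong_AE[OF _ _ c] by (simp add: prob_space)
  have "(\<integral>x. (curv_H d M R j x - c)\<^sup>2 \<partial>cond_law M P R j) = (\<integral>x. 0 \<partial>cond_law M P R j)"
    using c by (intro integral_cong_AE) auto
  then show ?thesis by (simp add: curv_variance_def m)
qed

lemma AE_eq_if_curv_variance_eq_0:
  assumes R: "R \<subseteq> {1..d}" "j \<in> R"
    and [measurable]: "curv_H d M R j \<in> borel_measurable (cond_law M P R j)"
    and sq: "integrable (cond_law M P R j) (\<lambda>x. (curv_H d M R j x)\<^sup>2)"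
    and 0: "curv_variance d M P R j = 0"
  shows "\<exists>c. AE x in cond_law M P R j. curv_H d M R j x = c"
proof -
  interpret prob_space "cond_law M P R j" by (rule prob_space_cond_law[OF R])
  have int: "integrable (cond_law M P R j) (curv_H d M R j)"
    using sq by (rule square_integrable_imp_integrable[rotated]) simp
  let ?m = "expectation (curv_H d M R j)"
  have "integrable (cond_law M P R j) (\<lambda>x. (curv_H d M R j x - ?m)\<^sup>2)"
    using int sq by (simp add: power2_diff)
  moreover have "expectation (\<lambda>x. (curv_H d M R j x - ?m)\<^sup>2) = 0" using 0 by (simp add: curv_variance_def)
  ultimately have "AE x in cond_law M P R j. (curv_H d M R j x - ?m)\<^sup>2 = 0"
    by (subst (asm) integral_nonneg_eq_0_iff_AE) auto
  then show ?thesis by auto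
qed

lemma subalgebra_sigma_coord:
  assumes "R \<subseteq> {1..d}" "j \<in> R"
  shows "subalgebra (cond_law M P R j) (sigma_coord (cond_law M P R j) j)"
proof -
  have s: "sets (cond_law M P R j) = sets (Pi\<^sub>M R (\<lambda>_. borel))"
    by (simp add: cond_law_def marg_law_def)
  have m: "(\<lambda>x. x j) \<in> cond_law M P R j \<rightarrow>\<^sub>M borel"
    using measurable_component_singleton[OF assms(2), of "\<lambda>_. borel :: real measure"]
    by (subst measurable_cong_sets[OF s refl])
  show ?thesis unfolding subalgebra_def sigma_coord_def
    using measurable_sets[OF m] by (auto simp: sets_vimage_algebra2)
qed

text \<open>The level set of \<open>h\<close> through \<open>x\<close> is a preimage under the
  coordinate \<open>j\<close>, so it also contains \<open>y\<close>.\<close>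

lemma sigma_coord_measurable_imp_eq:
  fixes h :: "(nat \<Rightarrow> real) \<Rightarrow> real"
  assumes h: "h \<in> borel_measurable (sigma_coord Q j)" and xy: "x \<in> space Q" "y \<in> space Q" "x j = y j"
  shows "h x = h y"
proof -
  have "h -` {h x} \<inter> space (sigma_coord Q j) \<in> sets (sigma_coord Q j)"
    using h by (rule measurable_sets) simp
  then obtain A where A: "h -` {h x} \<inter> space Q = (\<lambda>x. x j) -` A \<inter> space Q"
    unfolding sigma_coord_def by (auto simp: sets_vimage_algebra2)
  have "x \<in> h -` {h x} \<inter> space Q" using xy by simp
  then have "y \<in> (\<lambda>x. x j) -` A \<inter> space Q" using xy unfolding A by simp
  then show ?thesis unfolding A[symmetric] by simp
qed

lemma curv_score_eq_0:
  assumes R: "R \<subseteq> {1..d}" "j \<in> R"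
    and c: "AE x in cond_law M P R j. curv_H d M R j x = c"
    and [measurable]: "curv_H d M R j \<in> borel_measurable (cond_law M P R j)"
  shows "curv_score d M P R j = 0"
proof -
  let ?Q = "cond_law M P R j" and ?H = "curv_H d M R j"
  let ?F = "sigma_coord ?Q j"
  interpret prob_space ?Q by (rule prob_space_cond_law[OF R])
  interpret finite_measure_subalgebra ?Q ?F
    by unfold_locales (rule subalgebra_sigma_coord[OF R])
  let ?h = "real_cond_exp ?Q ?F ?H"
  have "AE x in ?Q. ?h x = real_cond_exp ?Q ?F (\<lambda>_. c) x"
    using c by (rule real_cond_exp_cong) auto
  moreover have "AE x in ?Q. real_cond_exp ?Q ?F (\<lambda>_. c) x = c"
    by (rule real_cond_exp_F_meas) auto
  ultimately have "AE x in ?Q. (?H x - ?h x)\<^sup>2 = 0" using c by eventually_elim simp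
  then have "AE x in ?Q. cond_variance ?Q ?F ?H x = real_cond_exp ?Q ?F (\<lambda>_. 0) x"
    unfolding cond_variance_def by (rule real_cond_exp_cong) auto
  moreover have "AE x in ?Q. real_cond_exp ?Q ?F (\<lambda>_. 0) x = 0"
    by (rule real_cond_exp_F_meas) auto
  ultimately have "AE x in ?Q. cond_variance ?Q ?F ?H x = 0" by eventually_elim simp
  then have "(\<integral>x. cond_variance ?Q ?F ?H x \<partial>?Q) = (\<integral>x. 0 \<partial>?Q)"
    by (intro integral_cong_AE) (auto simp: cond_variance_def)
  then show ?thesis by (simp add: curv_score_def)
qed

text \<open>By the tower property the score is the mean of (H - E[H | x_j])^2. If it is zero, H
  equals its conditional expectation almost surely.\<close>

lemma AE_coordinate_if_curv_score_eq_0: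
  assumes R: "R \<subseteq> {1..d}" "j \<in> R"
    and [measurable]: "curv_H d M R j \<in> borel_measurable (cond_law M P R j)"
    and sq: "integrable (cond_law M P R j) (\<lambda>x. (curv_H d M R j x)\<^sup>2)"
    and 0: "curv_score d M P R j = 0"
  shows "\<exists>\<psi>. AE x in cond_law M P R j. curv_H d M R j x = \<psi> (x j)"
proof -
  let ?Q = "cond_law M P R j" and ?H = "curv_H d M R j"
  let ?F = "sigma_coord ?Q j"
  interpret prob_space ?Q by (rule prob_space_cond_law[OF R])
  interpret finite_measure_subalgebra ?Q ?F
    by unfold_locales (rule subalgebra_sigma_coord[OF R])
  have int: "integrable ?Q ?H"
    using sq by (rule square_integrable_imp_integrable[rotated]) simp
  define h where "h = real_cond_exp ?Q ?F ?H"
  have hF: "h \<in> borel_measurable ?F" by (simp add: h_def)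
  have [measurable]: "h \<in> borel_measurable ?Q" by (simp add: h_def)
  \<comment> \<open>Conditional Jensen inequality for the square.\<close>
  have h2: "integrable ?Q (\<lambda>x. (h x)\<^sup>2)"
    unfolding h_def
    by (rule integrable_convex_cond_exp[where q="\<lambda>x. x\<^sup>2" and I=UNIV, OF int])
      (use sq emeasure_finite in \<open>auto simp: convex_power2\<close>)
  have Y: "integrable ?Q (\<lambda>x. (?H x - h x)\<^sup>2)"
  proof (rule Bochner_Integration.integrable_bound)
    show "integrable ?Q (\<lambda>x. 2 * (?H x)\<^sup>2 + 2 * (h x)\<^sup>2)" using sq h2 by simp
    show "AE x in ?Q. norm ((?H x - h x)\<^sup>2) \<le> norm (2 * (?H x)\<^sup>2 + 2 * (h x)\<^sup>2)"
    proof (rule AE_I2)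
      fix x
      have "0 \<le> (?H x + h x)\<^sup>2" by simp
      then have "(?H x - h x)\<^sup>2 \<le> 2 * (?H x)\<^sup>2 + 2 * (h x)\<^sup>2"
        by (simp add: power2_sum power2_diff)
      then show "norm ((?H x - h x)\<^sup>2) \<le> norm (2 * (?H x)\<^sup>2 + 2 * (h x)\<^sup>2)" by simp
    qed
  qed simp
  have "(\<integral>x. (?H x - h x)\<^sup>2 \<partial>?Q) = 0"
    using real_cond_exp_int(2)[OF Y] 0 by (simp add: curv_score_def cond_variance_def h_def)
  then have ae: "AE x in ?Q. (?H x - h x)\<^sup>2 = 0"
    using Y by (subst (asm) integral_nonneg_eq_0_iff_AE) auto
  \<comment> \<open>\<open>h\<close> is constant on the fibres of coordinate \<open>j\<close>, so
    evaluating it at any chosen point of the fibre gives a function of x_j.\<close>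
  define \<psi> where "\<psi> t = h (SOME y. y \<in> space ?Q \<and> y j = t)" for t
  have \<psi>: "h x = \<psi> (x j)" if x: "x \<in> space ?Q" for x
  proof -
    let ?y = "SOME y. y \<in> space ?Q \<and> y j = x j"
    have "?y \<in> space ?Q \<and> ?y j = x j" by (rule someI[of _ x]) (use x in simp)
    then show ?thesis unfolding \<psi>_def using sigma_coord_measurable_imp_eq[OF hF x, of ?y] by simp
  qed
  have "AE x in ?Q. x \<in> space ?Q" by simp
  with ae have "AE x in ?Q. ?H x = \<psi> (x j)" by eventually_elim (use \<psi> in auto)
  then show ?thesis by blast
qed

lemma curvature_criterion:
  assumes nl: "nonlinear_glm E M" and cc: "constant_own_curvature d E M"
    and mc: "moment_condition d E M P" and R: "ancestral d E R" "j \<in> R"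
  shows "(curv_variance d M P R j = 0 \<longleftrightarrow> curv_score d M P R j = 0) \<and>
    (curv_score d M P R j = 0 \<longleftrightarrow> sink_in E R j)"
proof -
  let ?Q = "cond_law M P R j" and ?H = "curv_H d M R j"
  note RV = ancestral_subset[OF R(1)]
  have jV: "j \<in> {1..d}" using RV R(2) by blast
  have meas: "?H \<in> borel_measurable ?Q" and sq: "integrable ?Q (\<lambda>x. (?H x)\<^sup>2)"
    using mc R unfolding moment_condition_def by blast+
  \<comment> \<open>Serves both criteria: zero variance supplies a constant \<psi>, zero score a
    function of x_j.\<close>
  have sink: "sink_in E R j" if psi: "AE x in ?Q. ?H x = \<psi> (x j)" for \<psi>
  proof (rule sink_if_AE_curv_coordinate[OF nl R])
    show "AE x in Pi\<^sub>M {1..d} (nu M). x \<in> supp_int_prod M {1..d} \<longrightarrow> x j \<in> adm M j \<longrightarrow>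
      curv (kind M j) j (\<lambda>y. ln (qdens R y)) (restrict x R) = \<psi> (x j)"
      using AE_cond_lawD[OF RV R(2) psi]
    proof eventually_elim
      case (elim x)
      show ?case
      proof (intro impI)
        assume x: "x \<in> supp_int_prod M {1..d}" "x j \<in> adm M j"
        have "restrict x R \<in> supp_int_prod M R" "restrict x R j \<in> adm M j"
          using restrict_in_supp_int_prod[OF x(1) RV] x(2) R(2) by auto
        then have "?H (restrict x R) = curv (kind M j) j (\<lambda>y. ln (qdens R y)) (restrict x R)"
          by (rule curv_H_eq[OF R])
        then show "curv (kind M j) j (\<lambda>y. ln (qdens R y)) (restrict x R) = \<psi> (x j)"
          using elim x R(2) by simp
      qed
    qed
  qed
  have const: "\<exists>c. AE x in ?Q. ?H x = c" if s: "sink_in E R j"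
  proof -
    obtain \<kappa> where \<kappa>: "\<And>x. x \<in> supp_int_prod M R \<Longrightarrow> x j \<in> adm M j \<Longrightarrow>
        curv (kind M j) j (\<lambda>y. ln (qdens R y)) x = \<kappa> (x j)"
      "\<And>x. x j \<in> adm M j \<Longrightarrow> own_curvature E M j x = \<kappa> (x j)"
      using curv_ln_qdens_sink[OF RV s] by blast
    obtain c where c: "\<And>x. x \<in> admissible_dom M {1..d} j \<Longrightarrow> own_curvature E M j x = c"
      using cc jV unfolding constant_own_curvature_def by blast
    have "?H x = c" if x: "x \<in> supp_int_prod M R" "x j \<in> adm M j" for x
    proof -
      \<comment> \<open>Constancy of the own-factor curvature is stated for points with all
        coordinates, so the point of \<open>R\<close> is extended first.\<close>
      obtain y where y: "y \<in> supp_int_prod M {1..d}" "restrict y R = x"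
        using ex_extension[OF RV order.refl x(1)] by blast
      have yj: "y j = x j" using y(2) R(2) by auto
      then have "own_curvature E M j y = c"
        using y(1) x(2) by (intro c) (simp add: admissible_dom_def adm_def)
      then show ?thesis using \<kappa>(2)[of y] \<kappa>(1)[OF x] curv_H_eq[OF R x] yj x(2) by simp
    qed
    then show ?thesis using AE_cond_lawI[OF RV R(2), of "\<lambda>x. ?H x = c"] by blast
  qed
  have "curv_variance d M P R j = 0 \<Longrightarrow> sink_in E R j"
    using AE_eq_if_curv_variance_eq_0[OF RV R(2) meas sq] sink[of "\<lambda>_. _"] by blast
  moreover have "curv_score d M P R j = 0 \<Longrightarrow> sink_in E R j"
    using AE_coordinate_if_curv_score_eq_0[OF RV R(2) meas sq] sink by blast
  moreover have "sink_in E R j \<Longrightarrow> curv_variance d M P R j = 0 \<and> curv_score d M P R j = 0"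
    using const curv_variance_eq_0[OF RV R(2) _ meas] curv_score_eq_0[OF RV R(2) _ meas] by blast
  ultimately show ?thesis by blast
qed

end

section \<open>Identifiability\<close>

text \<open>Endpoints of the support are invisible to the measure. Two models of one law may differ
  in them, so comparisons go through the interiors.\<close>

lemma nu_eq_density_supp_int:
  assumes v: "valid_support (kind M j) (var_supp M j)" and k: "kind M j = Continuous"
  shows "nu M j = density lborel (indicator (supp_int M j))"
proof -
  have [measurable]: "var_supp M j \<in> sets borel" "supp_int M j \<in> sets borel"
    using valid_support_borel[OF v] supp_int_borel[OF v] by auto
  have nu: "nu M j = density lborel (indicator (var_supp M j))" by (simp add: nu_def k)
  have "AE u in lborel. 0 < (indicator (var_supp M j) u :: ennreal) \<longrightarrow> u \<in> supp_int M j"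
    using AE_nu_supp_int[OF v] unfolding nu by (subst (asm) AE_density) auto
  then have "AE u in lborel. (indicator (var_supp M j) u :: ennreal) = indicator (supp_int M j) u"
    by eventually_elim (use supp_int_subset[of M j] in \<open>auto split: split_indicator split_indicator_asm\<close>)
  then show ?thesis unfolding nu by (intro density_cong) auto
qed

context semi_glm
begin

text \<open>Makes the product of the factors the continuous version of the joint density, which the
  law determines at every point of the interiors.\<close>

lemma continuous_on_cond_dens:
  assumes ac: "all_continuous d M" and j: "j \<in> {1..d}" and B: "insert j (Pa E j) \<subseteq> B"
  shows "continuous_on (supp_int_prod M B) (cond_dens E M j)"
proof -
  have k: "kind M l = Continuous" if "l \<in> {1..d}" for l using ac that by (simp add: all_continuous_def)
  define b where "b = (if Pa E j = {} then src_dens M j else carrier_dens M j)"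
  have bpos: "0 < b u" if "u \<in> supp_int M j" for u
    using that source[OF j] nonsource[OF j] by (auto simp: b_def source_regular_def nonsource_regular_def)
  have "C2_real_on (supp_int M j) (\<lambda>u. ln (b u))"
    using source[OF j] nonsource[OF j] k[OF j] by (auto simp: b_def source_regular_def nonsource_regular_def)
  then have "continuous_on (supp_int M j) (\<lambda>u. ln (b u))"
    unfolding C2_real_on_def by (meson DERIV_continuous_on has_field_derivative_at_within)
  \<comment> \<open>Regularity is assumed for the logarithm of \<open>b\<close>; positivity allows
    \<open>b\<close> to be recovered as its exponential.\<close>
  then have "continuous_on (supp_int M j) (\<lambda>u. exp (ln (b u)))" by (rule continuous_on_exp)
  then have cb: "continuous_on (supp_int M j) b"
    by (rule continuous_on_eq) (use bpos in simp)
  have coord: "continuous_on (supp_int_prod M B) (\<lambda>x. x j)"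
    by (rule continuous_on_subset[OF continuous_on_product_coordinates]) simp
  have cbj: "continuous_on (supp_int_prod M B) (\<lambda>x. b (x j))"
    using B by (intro continuous_on_compose2[OF cb coord]) (auto dest: in_supp_int_prodD)
  show ?thesis
  proof (cases "Pa E j = {}")
    case True
    then show ?thesis using cbj by (simp add: cond_dens_def b_def)
  next
    case False
    have e: "{x \<in> supp_int_prod M (Pa E j). \<forall>l\<in>Pa E j. kind M l = Count \<longrightarrow> x l = w l}
        = supp_int_prod M (Pa E j)" for w
      using k Pa_V[of j] by fastforce
    have c\<eta>: "continuous_on (supp_int_prod M (Pa E j)) (nat_par M j)"
      using continuous_on_nat_par[OF j False] unfolding e .
    have res: "restrict x (Pa E j) \<in> supp_int_prod M (Pa E j)" if "x \<in> supp_int_prod M B" for x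
      using restrict_in_supp_int_prod[OF that] B by blast
    have c\<eta>': "continuous_on (supp_int_prod M B) (\<lambda>x. nat_par M j (restrict x (Pa E j)))"
      by (rule continuous_on_compose2[OF c\<eta> continuous_on_restrict]) (use res in blast)
    have bm: "carrier_dens M j \<in> borel_measurable borel"
      using nonsource[OF j False] by (simp add: nonsource_regular_def)
    obtain A' A'' where A: "\<And>t. t \<in> interior (natural_domain M j) \<Longrightarrow> (log_partition M j has_real_derivative A' t) (at t)"
      "\<And>t. t \<in> interior (natural_domain M j) \<Longrightarrow> (A' has_real_derivative A'' t) (at t)"
      using log_partition_twice_differentiable[OF sets_nu bm AE_carrier_pos[OF j False]
            not_AE_nu_False[OF supports[OF j]]] by blast
    have cA: "continuous_on (interior (natural_domain M j)) (log_partition M j)"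
      using A(1) by (meson DERIV_continuous_on has_field_derivative_at_within)
    have "continuous_on (supp_int_prod M B) (\<lambda>x. log_partition M j (nat_par M j (restrict x (Pa E j))))"
      by (rule continuous_on_compose2[OF cA c\<eta>']) (use res nat_par_interior[OF j False] in blast)
    then show ?thesis using False cbj c\<eta>' coord
      by (simp add: cond_dens_def Let_def b_def) (intro continuous_intros)
  qed
qed

lemma continuous_on_qdens:
  assumes "all_continuous d M"
  shows "continuous_on (supp_int_prod M {1..d}) (qdens {1..d})"
  unfolding qdens_def using Pa_V by (intro continuous_intros continuous_on_cond_dens assms) auto

lemma AE_P_component:
  assumes "j \<in> {1..d}" "AE x in P. Q (x j)"
  shows "AE u in nu M j. Q u"
proof -
  have "AE x in Pi\<^sub>M {1..d} (nu M). x \<in> supp_int_prod M {1..d}" by (rule AE_supp_int_prod) auto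
  moreover have "AE x in Pi\<^sub>M {1..d} (nu M). x \<in> supp_int_prod M {1..d} \<longrightarrow> Q (x j)"
    using assms(2) unfolding AE_P_iff .
  ultimately have "AE x in Pi\<^sub>M {1..d} (nu M). Q (x j)" by eventually_elim auto
  then show ?thesis by (intro AE_PiM_component[OF _ _ assms(1)]) auto
qed

lemma AE_P_supp_int: "j \<in> {1..d} \<Longrightarrow> AE x in P. x j \<in> supp_int M j"
  unfolding AE_P_iff by (rule AE_I2) (auto dest: in_supp_int_prodD)

lemma qdens_remove_sink:
  assumes "finite R" "sink_in E R s"
  shows "qdens R x = qdens (R - {s}) x * cond_dens E M s x"
  using prod.remove[of R s "\<lambda>l. cond_dens E M l x"] assms by (simp add: qdens_def sink_in_def mult.commute)

text \<open>Let changing x_k turn the natural parameter b into a. If the density did not notice,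
  then u (a - b) = A(a) - A(b) for every support value u, and two values of u force a = b.\<close>

lemma parent_if_cond_dens_depends:
  assumes j: "j \<in> {1..d}" and k: "k \<in> Pa E j" and R: "insert j (Pa E j) \<subseteq> R" "R \<subseteq> {1..d}"
  shows "\<exists>x\<in>supp_int_prod M R. \<exists>t\<in>supp_int M k. cond_dens E M j (x(k := t)) \<noteq> cond_dens E M j x"
proof (rule ccontr)
  assume "\<not> ?thesis"
  then have same: "cond_dens E M j (x(k := t)) = cond_dens E M j x"
    if "x \<in> supp_int_prod M R" "t \<in> supp_int M k" for x t using that by blast
  have Pa: "Pa E j \<noteq> {}" using k by blast
  have jp: "j \<notin> Pa E j" "k \<noteq> j" using k dag_irrefl[OF dag] by (auto simp: Pa_def)
  obtain z t where z: "z \<in> supp_int_prod M (Pa E j)" "t \<in> supp_int M k"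
      "nat_par M j (z(k := t)) \<noteq> nat_par M j z"
    using nonsource[OF j Pa] k unfolding nonsource_regular_def by blast
  have PR: "Pa E j \<subseteq> R" using R by blast
  obtain x where x: "x \<in> supp_int_prod M R" "restrict x (Pa E j) = z"
    using ex_extension[OF PR R(2) z(1)] by blast
  define a b where "a = nat_par M j (z(k := t))" and "b = nat_par M j z"
  define A where "A = log_partition M j"
  have eq: "u * (a - b) = A a - A b" if u: "u \<in> supp_int M j" for u
  proof -
    have xu: "x(j := u) \<in> supp_int_prod M R" using upd_in_supp_int_prod'[OF x(1) _ u] R by blast
    have r: "restrict (x(j := u)) (Pa E j) = z" "restrict (x(j := u, k := t)) (Pa E j) = z(k := t)"
      using x(2) by (simp_all add: restrict_upd[OF k] restrict_upd_notin[OF jp(1)])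
    have c: "0 < carrier_dens M j u" using nonsource[OF j Pa] u by (simp add: nonsource_regular_def)
    have "carrier_dens M j u * exp (u * a - A a) = carrier_dens M j u * exp (u * b - A b)"
      using same[OF xu z(2)] Pa r jp by (simp add: cond_dens_def Let_def a_def b_def A_def)
    then show ?thesis using c by (simp add: algebra_simps)
  qed
  obtain u v where uv: "u \<in> supp_int M j" "v \<in> supp_int M j" "u \<noteq> v"
    using supp_int_minus_singleton[OF supports[OF j]] supp_int_nonempty[OF j] by blast
  have "(u - v) * (a - b) = 0" using eq[OF uv(1)] eq[OF uv(2)] by (simp add: algebra_simps)
  then show False using uv(3) z(3) by (simp add: a_def b_def)
qed

end

section \<open>Two models of the same law, the first one continuous\<close>

locale two_glms = A: semi_glm d E M P + B: semi_glm d E' M' P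
  for d E M E' M' P +
  assumes ac: "all_continuous d M"
begin

lemma kind: "j \<in> {1..d} \<Longrightarrow> kind M j = Continuous"
  using ac by (simp add: all_continuous_def)

text \<open>A count variable would concentrate its coordinate on a countable set, which is null for
  Lebesgue measure.\<close>

lemma kind': "j \<in> {1..d} \<Longrightarrow> kind M' j = Continuous"
proof (rule ccontr)
  assume j: "j \<in> {1..d}" and "kind M' j \<noteq> Continuous"
  then have K: "kind M' j = Count" by (cases "kind M' j") auto
  have c: "countable (supp_int M' j)"
    using countable_valid_support[OF B.supports[OF j, unfolded K]]
    unfolding supp_int_def K support_interior.simps .
  have 1: "AE u in nu M j. u \<in> supp_int M' j"
    using A.AE_P_component[OF j B.AE_P_supp_int[OF j]] .
  have "AE u in lborel. u \<notin> supp_int M' j"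
    using countable_imp_null_set_lborel[OF c] by (rule AE_not_in)
  then have 2: "AE u in nu M j. u \<notin> supp_int M' j"
    unfolding nu_eq_density_supp_int[OF A.supports[OF j] kind[OF j]]
    using supp_int_borel[OF A.supports[OF j]] by (subst AE_density) auto
  from 1 2 have "AE u in nu M j. False" by eventually_elim simp
  then show False using not_AE_nu_False[OF A.supports[OF j]] by contradiction
qed

end

text \<open>The part outside the closure of the other interior is open and null, hence empty; and an
  open convex set is the interior of its closure.\<close>

lemma supp_int_subset_if_AE:
  assumes v: "valid_support (kind M j) (var_supp M j)" "kind M j = Continuous"
    and v': "valid_support (kind M' j) (var_supp M' j)" "kind M' j = Continuous"
    and ae: "AE u in nu M j. u \<in> supp_int M' j"
  shows "supp_int M j \<subseteq> supp_int M' j"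
proof -
  let ?U = "supp_int M j - closure (supp_int M' j)"
  have oU: "open ?U" using open_supp_int[of M j] v(2) by (intro open_Diff) auto
  have "AE u in nu M j. u \<notin> ?U" using ae by eventually_elim (use closure_subset in blast)
  then have "emeasure (nu M j) ?U = 0"
    using oU AE_iff_null_sets[of ?U "nu M j"] by (auto simp: null_sets_def)
  then have "?U = {}" using emeasure_nu_open_pos[OF v oU] by force
  then have "supp_int M j \<subseteq> interior (closure (supp_int M' j))"
    using open_supp_int[of M j] v(2) by (intro interior_maximal) auto
  also have "\<dots> = supp_int M' j"
    using convex_interior_closure[OF convex_supp_int[OF v']] open_supp_int[of M' j] v'(2)
    by (simp add: interior_open)
  finally show ?thesis .
qed

context two_glms
begin

lemma supp_int_eq: "j \<in> {1..d} \<Longrightarrow> supp_int M j = supp_int M' j"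
  using supp_int_subset_if_AE[OF A.supports kind B.supports kind' A.AE_P_component[OF _ B.AE_P_supp_int]]
    supp_int_subset_if_AE[OF B.supports kind' A.supports kind B.AE_P_component[OF _ A.AE_P_supp_int]]
  by blast

lemma supp_int_prod_eq: "I \<subseteq> {1..d} \<Longrightarrow> supp_int_prod M I = supp_int_prod M' I"
  unfolding supp_int_prod_def using supp_int_eq by (intro PiE_cong) auto

lemma nu_eq: "j \<in> {1..d} \<Longrightarrow> nu M j = nu M' j"
  using nu_eq_density_supp_int[OF A.supports kind] nu_eq_density_supp_int[OF B.supports kind']
    supp_int_eq by simp

lemma PiM_nu_eq: "I \<subseteq> {1..d} \<Longrightarrow> Pi\<^sub>M I (nu M) = Pi\<^sub>M I (nu M')"
  using nu_eq by (intro PiM_cong) auto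

text \<open>Densities with respect to a sigma-finite measure are unique almost everywhere;
  continuity of both products removes the exceptional set.\<close>

lemma qdens_V_eq:
  assumes x: "x \<in> supp_int_prod M {1..d}"
  shows "A.qdens {1..d} x = B.qdens {1..d} x"
proof -
  let ?N = "Pi\<^sub>M {1..d} (nu M)"
  have sN: "sets ?N = sets (Pi\<^sub>M {1..d} (\<lambda>_. borel))" by (rule sets_PiM_cong) auto
  have m: "(\<lambda>x. ennreal (joint_dens M x)) \<in> borel_measurable ?N"
    "(\<lambda>x. ennreal (joint_dens M' x)) \<in> borel_measurable ?N"
    using A.joint_measurable B.joint_measurable
    by (simp_all add: measurable_cong_sets[OF sN refl])
  have sf: "sigma_finite_measure ?N"
    unfolding A.PiM_nu[OF order.refl] by (rule A.sigma_finite) simp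
  have "density ?N (\<lambda>x. ennreal (joint_dens M x)) = density ?N (\<lambda>x. ennreal (joint_dens M' x))"
    using A.P_eq B.P_eq PiM_nu_eq[OF order.refl] by simp
  then have "AE x in ?N. ennreal (joint_dens M x) = ennreal (joint_dens M' x)"
    using sigma_finite_measure.density_unique_iff[OF sf m] by simp
  then have ae: "AE x in ?N. x \<in> Pi\<^sub>E {1..d} (supp_int M) \<longrightarrow> A.qdens {1..d} x - B.qdens {1..d} x = 0"
  proof eventually_elim
    case (elim x)
    show ?case
    proof
      assume "x \<in> Pi\<^sub>E {1..d} (supp_int M)"
      then have x: "x \<in> supp_int_prod M {1..d}" "x \<in> supp_int_prod M' {1..d}"
        using supp_int_prod_eq[of "{1..d}"] by (auto simp: supp_int_prod_def)
      have "joint_dens M x = joint_dens M' x"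
        using elim A.joint_pos[OF x(1)] B.joint_pos[OF x(2)] by simp
      then show "A.qdens {1..d} x - B.qdens {1..d} x = 0"
        using A.joint_eq[OF x(1)] B.joint_eq[OF x(2)] by (simp add: A.qdens_def B.qdens_def)
    qed
  qed
  have ac': "all_continuous d M'" using kind' by (simp add: all_continuous_def)
  have "continuous_on (supp_int_prod M {1..d}) (\<lambda>x. A.qdens {1..d} x - B.qdens {1..d} x)"
    using A.continuous_on_qdens[OF ac] B.continuous_on_qdens[OF ac'] supp_int_prod_eq[of "{1..d}"]
    by (intro continuous_intros) auto
  then have c: "continuous_on {x \<in> Pi\<^sub>E {1..d} (supp_int M). \<forall>i\<in>{1..d}. kind M i = Count \<longrightarrow> x i = w i}
     (\<lambda>x. A.qdens {1..d} x - B.qdens {1..d} x)" for w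
    by (rule continuous_on_subset) (auto simp: supp_int_prod_def)
  have "A.qdens {1..d} x - B.qdens {1..d} x = 0"
    by (rule A.eq_0_if_AE_eq_0[OF _ _ _ _ c ae x[unfolded supp_int_prod_def]])
      (auto simp: open_supp_int)
  then show ?thesis by simp
qed

text \<open>\<open>R\<close> is ancestral in both graphs, so integrating the common joint density
  over the remaining coordinates yields either product.\<close>

lemma qdens_eq:
  assumes R: "ancestral d E R" "ancestral d E' R" and x: "x \<in> supp_int_prod M R"
  shows "A.qdens R x = B.qdens R x"
proof -
  let ?W = "{1..d} - R"
  note RV = ancestral_subset[OF R(1)]
  have x': "x \<in> supp_int_prod M' R" using x supp_int_prod_eq[OF RV] by simp
  have "AE y in Pi\<^sub>M ?W (nu M). y \<in> supp_int_prod M ?W" by (rule A.AE_supp_int_prod) auto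
  then have "AE y in Pi\<^sub>M ?W (nu M). ennreal (joint_dens M (merge R ?W (x, y)))
      = ennreal (joint_dens M' (merge R ?W (x, y)))"
  proof eventually_elim
    case (elim y)
    let ?m = "merge R ?W (x, y)"
    have m: "?m \<in> supp_int_prod M {1..d}" using A.merge_in_supp_int_prod[OF x elim RV] .
    then have m': "?m \<in> supp_int_prod M' {1..d}" using supp_int_prod_eq by simp
    show ?case using A.joint_eq[OF m] B.joint_eq[OF m'] qdens_V_eq[OF m]
      by (simp add: A.qdens_def B.qdens_def)
  qed
  then have "(\<integral>\<^sup>+y. ennreal (joint_dens M (merge R ?W (x, y))) \<partial>Pi\<^sub>M ?W (nu M))
     = (\<integral>\<^sup>+y. ennreal (joint_dens M' (merge R ?W (x, y))) \<partial>Pi\<^sub>M ?W (nu M))"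
    by (rule nn_integral_cong_AE)
  also have "\<dots> = (\<integral>\<^sup>+y. ennreal (joint_dens M' (merge R ?W (x, y))) \<partial>Pi\<^sub>M ?W B.nu')"
    by (simp add: PiM_nu_eq B.PiM_nu)
  finally have "ennreal (A.qdens R x) = ennreal (B.qdens R x)"
    using A.nn_integral_joint_merge[OF R(1) x] B.nn_integral_joint_merge[OF R(2) x']
    by (simp add: A.PiM_nu)
  then show ?thesis using A.qdens_pos[OF RV x] B.qdens_pos[OF RV x'] by simp
qed

lemma adm_eq: "j \<in> {1..d} \<Longrightarrow> adm M j = supp_int M j"
  using kind by (simp add: adm_def supp_int_def)

lemma adm_eq': "j \<in> {1..d} \<Longrightarrow> adm M' j = supp_int M' j"
  using kind' by (simp add: adm_def supp_int_def)

text \<open>The common marginal density mediates: being a sink in the first graph makes its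
  curvature a function of x_j alone, and in the second, nonlinear model only a sink has this
  property.\<close>

lemma sink_transfer:
  assumes nl': "nonlinear_glm E' M'"
    and R: "ancestral d E R" "ancestral d E' R" and s: "sink_in E R j"
  shows "sink_in E' R j"
proof -
  note RV = ancestral_subset[OF R(1)]
  have j: "j \<in> R" "j \<in> {1..d}" using s RV by (auto simp: sink_in_def)
  obtain \<kappa> where \<kappa>: "\<And>x. x \<in> supp_int_prod M R \<Longrightarrow> x j \<in> adm M j \<Longrightarrow>
      curv (kind M j) j (\<lambda>y. ln (A.qdens R y)) x = \<kappa> (x j)"
    using A.curv_ln_qdens_sink[OF RV s] by blast
  show ?thesis
  proof (rule B.sink_if_AE_curv_coordinate[OF nl' R(2) j(1), of \<kappa>], rule AE_I2, intro impI)
    fix x assume x: "x \<in> supp_int_prod M' {1..d}" "x j \<in> adm M' j"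
    have xR': "restrict x R \<in> supp_int_prod M' R" using restrict_in_supp_int_prod[OF x(1) RV] .
    then have xR: "restrict x R \<in> supp_int_prod M R" using supp_int_prod_eq[OF RV] by simp
    have xj: "restrict x R j \<in> adm M j"
      using x(2) j adm_eq[OF j(2)] adm_eq'[OF j(2)] supp_int_eq[OF j(2)] by simp
    have "curv (kind M j) j (\<lambda>y. ln (A.qdens R y)) (restrict x R)
        = curv (kind M j) j (\<lambda>y. ln (B.qdens R y)) (restrict x R)"
    proof (rule curv_cong[of "restrict x R", OF xj[unfolded adm_def]])
      fix t assume "t \<in> support_interior (kind M j) (var_supp M j)"
      then have "(restrict x R)(j := t) \<in> supp_int_prod M R"
        using upd_in_supp_int_prod'[OF xR j(1)] by (simp add: supp_int_def)
      then show "ln (A.qdens R ((restrict x R)(j := t))) = ln (B.qdens R ((restrict x R)(j := t)))"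
        by (simp add: qdens_eq[OF R])
    qed
    then show "curv (kind M' j) j (\<lambda>y. ln (B.qdens R y)) (restrict x R) = \<kappa> (x j)"
      using \<kappa>[OF xR xj] j by (simp add: kind kind')
  qed
qed

text \<open>The factor of a common sink is the quotient of the products over \<open>R\<close> and
  over \<open>R - {s}\<close>, and both products agree between the models.\<close>

lemma cond_dens_eq:
  assumes R: "ancestral d E R" "ancestral d E' R" and s: "sink_in E R s" "sink_in E' R s"
    and x: "x \<in> supp_int_prod M R"
  shows "cond_dens E M s x = cond_dens E' M' s x"
proof -
  note fR = ancestral_finite[OF R(1)] and RV = ancestral_subset[OF R(1)]
  have r: "ancestral d E (R - {s})" "ancestral d E' (R - {s})"
    using R s by (auto intro: ancestral.remove_sink)
  \<comment> \<open>The products over \<open>R - {s}\<close> were compared at extensional points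
    only, so \<open>x\<close> is restricted; no remaining factor reads x_s.\<close>
  let ?y = "restrict x (R - {s})"
  have y: "?y \<in> supp_int_prod M (R - {s})" using restrict_in_supp_int_prod[OF x Diff_subset] .
  have qy: "A.qdens (R - {s}) x = A.qdens (R - {s}) ?y"
    unfolding A.qdens_def
  proof (intro prod.cong refl cond_dens_cong)
    fix l i assume l: "l \<in> R - {s}"
    show "x l = ?y l" using l by simp
    assume "i \<in> Pa E l"
    then have "i \<in> R - {s}" using ancestral_Pa_subset[OF r(1) A.dag l] by blast
    then show "x i = ?y i" by simp
  qed
  have qy': "B.qdens (R - {s}) x = B.qdens (R - {s}) ?y"
    unfolding B.qdens_def
  proof (intro prod.cong refl cond_dens_cong)
    fix l i assume l: "l \<in> R - {s}"
    show "x l = ?y l" using l by simp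
    assume "i \<in> Pa E' l"
    then have "i \<in> R - {s}" using ancestral_Pa_subset[OF r(2) B.dag l] by blast
    then show "x i = ?y i" by simp
  qed
  have "0 < A.qdens (R - {s}) ?y" using A.qdens_pos[OF _ y] RV by blast
  moreover have "A.qdens (R - {s}) ?y = B.qdens (R - {s}) ?y" using qdens_eq[OF r y] .
  ultimately show ?thesis
    using qdens_eq[OF R x] A.qdens_remove_sink[OF fR s(1), of x] B.qdens_remove_sink[OF fR s(2), of x] qy qy'
    by simp
qed

text \<open>If \<open>k\<close> were a parent in one graph only, the common conditional density
  would vary with x_k according to one model and not according to the other.\<close>

lemma Pa_eq_sink:
  assumes R: "ancestral d E R" "ancestral d E' R" and s: "sink_in E R s" "sink_in E' R s"
  shows "Pa E s = Pa E' s"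
proof -
  note RV = ancestral_subset[OF R(1)]
  have sR: "s \<in> R" "s \<in> {1..d}" using s RV by (auto simp: sink_in_def)
  have P: "insert s (Pa E s) \<subseteq> R" "insert s (Pa E' s) \<subseteq> R"
    using ancestral_Pa_subset[OF R(1) A.dag sR(1)] ancestral_Pa_subset[OF R(2) B.dag sR(1)] sR by auto
  have kR: "k \<noteq> s" if "k \<in> Pa E s \<or> k \<in> Pa E' s" for k
    using that dag_irrefl[OF A.dag] dag_irrefl[OF B.dag] by (auto simp: Pa_def)
  have "k \<in> Pa E' s" if k: "k \<in> Pa E s" for k
  proof (rule ccontr)
    assume n: "k \<notin> Pa E' s"
    obtain x t where x: "x \<in> supp_int_prod M R" "t \<in> supp_int M k"
        "cond_dens E M s (x(k := t)) \<noteq> cond_dens E M s x"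
      using A.parent_if_cond_dens_depends[OF sR(2) k P(1) RV] by blast
    have xt: "x(k := t) \<in> supp_int_prod M R" using upd_in_supp_int_prod'[OF x(1) _ x(2)] k P(1) by blast
    have "cond_dens E' M' s (x(k := t)) = cond_dens E' M' s x"
      using n kR[OF disjI1[OF k]] by (intro cond_dens_cong) auto
    then show False using cond_dens_eq[OF R s x(1)] cond_dens_eq[OF R s xt] x(3) by simp
  qed
  moreover have "k \<in> Pa E s" if k: "k \<in> Pa E' s" for k
  proof (rule ccontr)
    assume n: "k \<notin> Pa E s"
    obtain x t where x: "x \<in> supp_int_prod M' R" "t \<in> supp_int M' k"
        "cond_dens E' M' s (x(k := t)) \<noteq> cond_dens E' M' s x"
      using B.parent_if_cond_dens_depends[OF sR(2) k P(2) RV] by blast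
    have xt: "x(k := t) \<in> supp_int_prod M' R" using upd_in_supp_int_prod'[OF x(1) _ x(2)] k P(2) by blast
    have "cond_dens E M s (x(k := t)) = cond_dens E M s x"
      using n kR[OF disjI2[OF k]] by (intro cond_dens_cong) auto
    then show False
      using cond_dens_eq[OF R s] x(1,3) xt supp_int_prod_eq[OF RV] by simp
  qed
  ultimately show ?thesis by blast
qed

text \<open>The sink \<open>s\<close> of the first graph is a sink of the second one too, so
  \<open>R - {s}\<close> stays ancestral for both and the induction continues.\<close>

lemma Pa_eq:
  assumes nl': "nonlinear_glm E' M'"
  shows "ancestral d E R \<Longrightarrow> ancestral d E' R \<Longrightarrow> \<forall>j\<in>R. Pa E j = Pa E' j"
proof (induction rule: ancestral_induct[OF A.dag, consumes 1, case_names empty step])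
  case (step R s)
  have s': "sink_in E' R s" by (rule sink_transfer[OF nl' step(1,5,2)])
  have "\<forall>j\<in>R - {s}. Pa E j = Pa E' j"
    using step(4) ancestral.remove_sink[OF step(5) s'] by blast
  then show ?case using Pa_eq_sink[OF step(1,5,2) s'] by blast
qed simp

lemma edges_eq:
  assumes "nonlinear_glm E' M'"
  shows "E = E'"
proof -
  have "\<forall>j\<in>{1..d}. Pa E j = Pa E' j" by (rule Pa_eq[OF assms]) (rule ancestral.all)+
  moreover have "E \<subseteq> {1..d} \<times> {1..d}" "E' \<subseteq> {1..d} \<times> {1..d}"
    using A.dag B.dag by (auto simp: dag_def)
  ultimately show ?thesis unfolding Pa_def by blast
qed

end

section \<open>Gaussian additive noise models\<close>

lemma ln_normal_density:
  assumes "0 < \<sigma>"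
  shows "ln (normal_density \<mu> \<sigma> u) = ln (1 / sqrt (2 * pi * \<sigma>\<^sup>2)) + - (u - \<mu>)\<^sup>2 / (2 * \<sigma>\<^sup>2)"
proof -
  have "0 < 1 / sqrt (2 * pi * \<sigma>\<^sup>2)" using assms by simp
  then show ?thesis unfolding normal_density_def by (subst ln_mult) auto
qed

lemma ln_normal_density_derivs:
  assumes "0 < \<sigma>"
  shows "((\<lambda>u. ln (normal_density \<mu> \<sigma> u)) has_real_derivative - (u - \<mu>) / \<sigma>\<^sup>2) (at u)"
    "((\<lambda>u. - (u - \<mu>) / \<sigma>\<^sup>2) has_real_derivative - 1 / \<sigma>\<^sup>2) (at u)"
  unfolding ln_normal_density[OF assms]
  using assms by (auto intro!: derivative_eq_intros simp: field_simps power2_eq_square)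

lemma C2_real_on_ln_normal_density:
  "0 < \<sigma> \<Longrightarrow> C2_real_on S (\<lambda>u. ln (normal_density \<mu> \<sigma> u))"
  unfolding C2_real_on_def using ln_normal_density_derivs
  by (intro exI[of _ "\<lambda>u. - (u - \<mu>) / \<sigma>\<^sup>2"] exI[of _ "\<lambda>_. - 1 / \<sigma>\<^sup>2"]) auto

lemma nn_integral_normal_density:
  "0 < \<sigma> \<Longrightarrow> (\<integral>\<^sup>+u. ennreal (normal_density \<mu> \<sigma> u) \<partial>lborel) = 1"
  by (subst nn_integral_eq_integral) auto

lemma normal_density_shift: "normal_density \<mu> \<sigma> u = normal_density 0 \<sigma> (u - \<mu>)"
  by (simp add: normal_density_def)

text \<open>Completing the square. Tilting by t moves the mean to \<sigma>^2 t, so mean f requires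
  \<eta> = f / \<sigma>^2, and A(t) = \<sigma>^2 t^2 / 2.\<close>

lemma normal_density_exp_tilt:
  assumes "0 < \<sigma>"
  shows "normal_density 0 \<sigma> u * exp (u * t) = exp (\<sigma>\<^sup>2 * t\<^sup>2 / 2) * normal_density (\<sigma>\<^sup>2 * t) \<sigma> u"
proof -
  have "- u\<^sup>2 / (2 * \<sigma>\<^sup>2) + u * t = \<sigma>\<^sup>2 * t\<^sup>2 / 2 + - (u - \<sigma>\<^sup>2 * t)\<^sup>2 / (2 * \<sigma>\<^sup>2)"
    using assms by (simp add: field_simps power2_eq_square)
  then have "exp (- u\<^sup>2 / (2 * \<sigma>\<^sup>2)) * exp (u * t)
      = exp (\<sigma>\<^sup>2 * t\<^sup>2 / 2) * exp (- (u - \<sigma>\<^sup>2 * t)\<^sup>2 / (2 * \<sigma>\<^sup>2))"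
    unfolding exp_add[symmetric] by simp
  then show ?thesis by (simp add: normal_density_def)
qed

text \<open>\<open>pd\<close> reads values along coordinate lines, so equality on \<open>D\<close>
  transfers to it when \<open>D\<close> contains these lines.\<close>

lemma C1_in_cong:
  assumes D: "\<And>x i t. x \<in> D \<Longrightarrow> i \<in> I \<Longrightarrow> x(i := t) \<in> D"
    and eq: "\<And>x. x \<in> D \<Longrightarrow> g x = h x" and g: "C1_in I D g"
  shows "C1_in I D h"
proof -
  have e: "(\<lambda>t. g (x(i := t))) = (\<lambda>t. h (x(i := t)))" if "x \<in> D" "i \<in> I" for x i
    using D[OF that] eq by blast
  have p: "pd i g x = pd i h x" if "x \<in> D" "i \<in> I" for x i
    by (simp add: pd_def e[OF that])
  have "continuous_on D h" using g eq by (auto simp: C1_in_def intro: continuous_on_eq)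
  moreover have "continuous_on D (pd i h)" if "i \<in> I" for i
    using g p[OF _ that] that by (auto simp: C1_in_def intro: continuous_on_eq)
  moreover have "(\<lambda>t. h (x(i := t))) differentiable at (x i)" if "x \<in> D" "i \<in> I" for x i
    using g that unfolding C1_in_def e[OF that, symmetric] by blast
  ultimately show ?thesis by (simp add: C1_in_def)
qed

lemma pd_cdiv:
  assumes "(\<lambda>t. f (x(i := t))) differentiable at (x i)"
  shows "pd i (\<lambda>y. f y / c) x = pd i f x / c"
  unfolding pd_def using assms
  by (intro DERIV_imp_deriv DERIV_cdivide) (simp add: DERIV_deriv_iff_real_differentiable)

lemma C1_in_cdiv:
  assumes "C1_in I D f"
  shows "C1_in I D (\<lambda>x. f x / c)"
proof -
  have p: "pd i (\<lambda>y. f y / c) x = pd i f x / c" if "x \<in> D" "i \<in> I" for x i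
    using assms that by (intro pd_cdiv) (auto simp: C1_in_def)
  have "continuous_on D (pd i (\<lambda>y. f y / c))" if "i \<in> I" for i
  proof (rule continuous_on_eq)
    show "continuous_on D (\<lambda>x. pd i f x / c)"
      using assms that unfolding C1_in_def divide_inverse by (intro continuous_intros) auto
  qed (simp add: p that)
  moreover have "continuous_on D (\<lambda>x. f x / c)"
    using assms unfolding C1_in_def divide_inverse by (intro continuous_intros) auto
  moreover have "(\<lambda>t. f (x(i := t)) / c) differentiable at (x i)" if "x \<in> D" "i \<in> I" for x i
  proof -
    have "(\<lambda>t. f (x(i := t))) differentiable at (x i)" using assms that by (simp add: C1_in_def)
    then show ?thesis unfolding real_differentiable_def by (auto intro: DERIV_cdivide)
  qed
  ultimately show ?thesis by (simp add: C1_in_def)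
qed

lemma C2_in_cdiv:
  assumes D: "\<And>x i t. x \<in> D \<Longrightarrow> i \<in> I \<Longrightarrow> x(i := t) \<in> D" and f: "C2_in I D f"
  shows "C2_in I D (\<lambda>x. f x / c)"
proof -
  have "C1_in I D (pd i (\<lambda>x. f x / c))" if i: "i \<in> I" for i
  proof (rule C1_in_cong[OF D])
    show "C1_in I D (\<lambda>x. pd i f x / c)" using f i by (intro C1_in_cdiv) (simp add: C2_in_def)
    show "pd i f x / c = pd i (\<lambda>x. f x / c) x" if "x \<in> D" for x
      using f i that by (intro pd_cdiv[symmetric]) (auto simp: C2_in_def C1_in_def)
  qed
  then show ?thesis using f by (simp add: C2_in_def C1_in_cdiv)
qed

text \<open>Continuity refers to the product topology on all of
  \<open>nat \<Rightarrow> real\<close>, measurability to the coordinates in \<open>A\<close>. The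
  identity between the two is measurable because the other coordinates are constantly
  \<open>undefined\<close>.\<close>

lemma continuous_on_imp_measurable_PiM:
  fixes g :: "(nat \<Rightarrow> real) \<Rightarrow> real"
  assumes "continuous_on (A \<rightarrow>\<^sub>E UNIV) g"
  shows "g \<in> borel_measurable (Pi\<^sub>M A (\<lambda>_. borel))"
proof -
  have "(\<lambda>x. x) \<in> Pi\<^sub>M A (\<lambda>_. borel :: real measure) \<rightarrow>\<^sub>M borel"
  proof (rule measurable_coordinatewise_then_product)
    fix i :: nat
    show "(\<lambda>x. x i) \<in> borel_measurable (Pi\<^sub>M A (\<lambda>_. borel :: real measure))"
    proof (cases "i \<in> A")
      case False
      then have "x i = undefined" if "x \<in> space (Pi\<^sub>M A (\<lambda>_. borel :: real measure))" for x
        using that by (auto simp: space_PiM PiE_iff extensional_def)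
      then show ?thesis by (subst measurable_cong[where g="\<lambda>_. undefined"]) auto
    qed simp
  qed
  then have "(\<lambda>x. x) \<in> Pi\<^sub>M A (\<lambda>_. borel :: real measure) \<rightarrow>\<^sub>M restrict_space borel (A \<rightarrow>\<^sub>E UNIV)"
    by (intro measurable_restrict_space2) (auto simp: space_PiM)
  from measurable_compose[OF this borel_measurable_continuous_on_restrict[OF assms]]
  show ?thesis .
qed

interpretation lborel_product: product_sigma_finite "\<lambda>_ :: nat. lborel :: real measure"
  by standard

lemma sets_PiM_lborel: "sets (Pi\<^sub>M A (\<lambda>_ :: nat. lborel :: real measure)) = sets (Pi\<^sub>M A (\<lambda>_. borel))"
  by (rule sets_PiM_cong) auto

lemma PiM_density_lborel:
  fixes \<phi> :: "nat \<Rightarrow> real \<Rightarrow> real"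
  assumes I: "finite I" and [measurable]: "\<And>i. \<phi> i \<in> borel_measurable borel"
    and \<phi>: "\<And>i u. 0 \<le> \<phi> i u" "\<And>i. i \<in> I \<Longrightarrow> (\<integral>\<^sup>+u. ennreal (\<phi> i u) \<partial>lborel) = 1"
  shows "Pi\<^sub>M I (\<lambda>i. density lborel (\<lambda>u. ennreal (\<phi> i u)))
    = density (Pi\<^sub>M I (\<lambda>_. lborel)) (\<lambda>x. ennreal (\<Prod>i\<in>I. \<phi> i (x i)))"
proof -
  \<comment> \<open>Normalisation is assumed for indices in \<open>I\<close> only; Lebesgue measure
    elsewhere makes the whole family sigma-finite.\<close>
  define N where "N i = (if i \<in> I then density lborel (\<lambda>u. ennreal (\<phi> i u)) else lborel)" for i
  have "sigma_finite_measure (N i)" for i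
  proof (cases "i \<in> I")
    case True
    then have "prob_space (N i)"
      using \<phi>(2)[OF True] by (intro prob_spaceI) (simp add: N_def emeasure_density)
    then show ?thesis by (simp add: prob_space_imp_sigma_finite)
  qed (simp add: N_def sigma_finite_lborel)
  then interpret product_sigma_finite N by (simp add: product_sigma_finite_def)
  have N: "Pi\<^sub>M I (\<lambda>i. density lborel (\<lambda>u. ennreal (\<phi> i u))) = Pi\<^sub>M I N"
    by (rule PiM_cong) (auto simp: N_def)
  have [measurable]: "(\<lambda>x. \<phi> i (x i)) \<in> borel_measurable (Pi\<^sub>M I (\<lambda>_. lborel))" if "i \<in> I" for i
    using that by measurable
  show ?thesis unfolding N
  proof (rule PiM_eqI[OF I, symmetric])
    show "sets (density (Pi\<^sub>M I (\<lambda>_. lborel)) (\<lambda>x. ennreal (\<Prod>i\<in>I. \<phi> i (x i)))) = sets (Pi\<^sub>M I N)"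
      unfolding sets_density by (rule sets_PiM_cong) (auto simp: N_def)
    fix A assume "\<And>i. i \<in> I \<Longrightarrow> A i \<in> sets (N i)"
    then have A [measurable]: "A i \<in> sets borel" if "i \<in> I" for i using that by (force simp: N_def)
    have "Pi\<^sub>E I A \<in> sets (Pi\<^sub>M I (\<lambda>_. lborel))" using A by (intro sets_PiM_I_finite I) auto
    then have "emeasure (density (Pi\<^sub>M I (\<lambda>_. lborel)) (\<lambda>x. ennreal (\<Prod>i\<in>I. \<phi> i (x i)))) (Pi\<^sub>E I A)
      = (\<integral>\<^sup>+x. ennreal (\<Prod>i\<in>I. \<phi> i (x i)) * indicator (Pi\<^sub>E I A) x \<partial>Pi\<^sub>M I (\<lambda>_. lborel))"
      by (intro emeasure_density) auto
    also have "\<dots> = (\<integral>\<^sup>+x. (\<Prod>i\<in>I. ennreal (\<phi> i (x i)) * indicator (A i) (x i)) \<partial>Pi\<^sub>M I (\<lambda>_. lborel))"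
    proof (rule nn_integral_cong)
      fix x :: "nat \<Rightarrow> real" assume x: "x \<in> space (Pi\<^sub>M I (\<lambda>_. lborel))"
      have "indicator (Pi\<^sub>E I A) x = (\<Prod>i\<in>I. indicator (A i) (x i) :: ennreal)"
      proof (cases "\<forall>i\<in>I. x i \<in> A i")
        case True
        then show ?thesis using x by (auto simp: indicator_def space_PiM PiE_iff)
      next
        case False
        then show ?thesis using I by (auto simp: indicator_def PiE_iff prod_zero_iff)
      qed
      then show "ennreal (\<Prod>i\<in>I. \<phi> i (x i)) * indicator (Pi\<^sub>E I A) x
        = (\<Prod>i\<in>I. ennreal (\<phi> i (x i)) * indicator (A i) (x i))"
        using \<phi>(1) by (simp add: prod.distrib prod_ennreal)
    qed
    also have "\<dots> = (\<Prod>i\<in>I. \<integral>\<^sup>+u. ennreal (\<phi> i u) * indicator (A i) u \<partial>lborel)"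
      by (intro lborel_product.product_nn_integral_prod I) auto
    also have "\<dots> = (\<Prod>i\<in>I. emeasure (N i) (A i))"
      by (intro prod.cong refl) (simp add: N_def emeasure_density)
    finally show "emeasure (density (Pi\<^sub>M I (\<lambda>_. lborel)) (\<lambda>x. ennreal (\<Prod>i\<in>I. \<phi> i (x i)))) (Pi\<^sub>E I A)
      = (\<Prod>i\<in>I. emeasure (N i) (A i))" .
  qed
qed

section \<open>The residual map of an additive noise model\<close>

locale additive_noise =
  fixes d :: nat and E :: "(nat \<times> nat) set" and f :: "nat \<Rightarrow> (nat \<Rightarrow> real) \<Rightarrow> real"
  assumes dag: "dag d E"
    and f_cont: "i \<in> {1..d} \<Longrightarrow> continuous_on (Pa E i \<rightarrow>\<^sub>E UNIV) (f i)"
begin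

definition resid :: "nat \<Rightarrow> (nat \<Rightarrow> real) \<Rightarrow> real" where
  "resid i x = x i - f i (restrict x (Pa E i))"

definition resids :: "nat set \<Rightarrow> (nat \<Rightarrow> real) \<Rightarrow> nat \<Rightarrow> real" where
  "resids R x = (\<lambda>i\<in>R. resid i x)"

lemma f_measurable:
  assumes "i \<in> {1..d}" "Pa E i \<subseteq> R"
  shows "(\<lambda>x. f i (restrict x (Pa E i))) \<in> borel_measurable (Pi\<^sub>M R (\<lambda>_. borel))"
  by (rule measurable_compose[OF measurable_restrict_subset[OF assms(2)]
        continuous_on_imp_measurable_PiM[OF f_cont[OF assms(1)]]])

lemma resids_measurable:
  assumes R: "ancestral d E R"
  shows "resids R \<in> Pi\<^sub>M R (\<lambda>_. borel) \<rightarrow>\<^sub>M Pi\<^sub>M R (\<lambda>_. borel)"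
proof -
  have "(\<lambda>x. \<lambda>i\<in>R. resid i x) \<in> Pi\<^sub>M R (\<lambda>_. borel) \<rightarrow>\<^sub>M Pi\<^sub>M R (\<lambda>_. borel)"
  proof (rule measurable_restrict)
    fix i assume i: "i \<in> R"
    then have "(\<lambda>x. x i) \<in> borel_measurable (Pi\<^sub>M R (\<lambda>_. borel :: real measure))" by simp
    moreover have "(\<lambda>x. f i (restrict x (Pa E i))) \<in> borel_measurable (Pi\<^sub>M R (\<lambda>_. borel))"
      using f_measurable ancestral_subset[OF R] ancestral_Pa_subset[OF R dag i] i by blast
    ultimately show "(\<lambda>x. resid i x) \<in> borel_measurable (Pi\<^sub>M R (\<lambda>_. borel))"
      unfolding resid_def by (rule borel_measurable_diff)
  qed
  then show ?thesis by (simp add: resids_def[abs_def])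
qed

text \<open>The shear: x_s enters only its own residual, and there as a translation by a function of
  the other coordinates.\<close>

lemma resids_upd_sink:
  assumes s: "sink_in E R s"
  shows "resids R (x(s := u)) = (resids (R - {s}) x)(s := u - f s (restrict x (Pa E s)))"
proof (rule ext)
  fix i
  have sp: "s \<notin> Pa E s" using dag_irrefl[OF dag] by (simp add: Pa_def)
  have sR: "s \<in> R" using s by (simp add: sink_in_def)
  show "resids R (x(s := u)) i = ((resids (R - {s}) x)(s := u - f s (restrict x (Pa E s)))) i"
  proof (cases "i \<in> R \<and> i \<noteq> s")
    case True
    then have "s \<notin> Pa E i" using s by (auto simp: sink_in_def Pa_def)
    then show ?thesis using True by (simp add: resids_def resid_def restrict_upd_notin)
  next
    case False
    then consider "i = s" | "i \<notin> R" "i \<noteq> s" using sR by blast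
    then show ?thesis
      using sR by cases (simp_all add: resids_def resid_def restrict_upd_notin[OF sp])
  qed
qed

text \<open>Integrate the sink first and use translation invariance of Lebesgue measure. The
  quantifier over \<open>g\<close> stands inside the induction because the hypothesis is applied to
  another function.\<close>

lemma nn_integral_resids:
  assumes "ancestral d E R"
  shows "\<forall>g\<in>borel_measurable (Pi\<^sub>M R (\<lambda>_. borel)).
    (\<integral>\<^sup>+x. g (resids R x) \<partial>Pi\<^sub>M R (\<lambda>_. lborel)) = (\<integral>\<^sup>+x. g x \<partial>Pi\<^sub>M R (\<lambda>_. lborel))"
  using assms
proof (induction rule: ancestral_induct[OF dag, consumes 1, case_names empty step])
  case empty
  then show ?case by (simp add: resids_def[abs_def] PiM_empty nn_integral_count_space_finite)
next
  case (step R s)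
  let ?R = "R - {s}"
  have sR: "s \<in> R" "insert s ?R = R" using step(2) by (auto simp: sink_in_def)
  have fR: "finite ?R" using ancestral_finite[OF step(1)] by simp
  show ?case
  proof
    fix g :: "(nat \<Rightarrow> real) \<Rightarrow> ennreal" assume g: "g \<in> borel_measurable (Pi\<^sub>M R (\<lambda>_. borel))"
    have g' [measurable]: "g \<in> borel_measurable (Pi\<^sub>M (insert s ?R) (\<lambda>_. lborel))"
      using g unfolding sR(2) by (simp add: measurable_cong_sets[OF sets_PiM_lborel refl])
    have "(\<lambda>x. g (resids R x)) \<in> borel_measurable (Pi\<^sub>M R (\<lambda>_. borel))"
      by (rule measurable_compose[OF resids_measurable[OF step(1)] g])
    then have gr: "(\<lambda>x. g (resids R x)) \<in> borel_measurable (Pi\<^sub>M (insert s ?R) (\<lambda>_. lborel))"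
      unfolding sR(2) by (simp add: measurable_cong_sets[OF sets_PiM_lborel refl])
    \<comment> \<open>The function to which the induction hypothesis is applied: \<open>g\<close>
      integrated over the coordinate of the sink.\<close>
    define h where "h e = (\<integral>\<^sup>+u. g (e(s := u)) \<partial>lborel)" for e
    have "(\<lambda>(e, u). g (e(s := u))) \<in> borel_measurable (Pi\<^sub>M ?R (\<lambda>_. lborel) \<Otimes>\<^sub>M lborel)"
      using measurable_compose[OF measurable_add_dim g'] by (simp add: case_prod_beta')
    then have "h \<in> borel_measurable (Pi\<^sub>M ?R (\<lambda>_. lborel))"
      unfolding h_def[abs_def] by (rule lborel.borel_measurable_nn_integral)
    then have h: "h \<in> borel_measurable (Pi\<^sub>M ?R (\<lambda>_. borel))"
      by (simp add: measurable_cong_sets[OF sets_PiM_lborel refl])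
    have "(\<integral>\<^sup>+x. g (resids R x) \<partial>Pi\<^sub>M R (\<lambda>_. lborel))
        = (\<integral>\<^sup>+x. (\<integral>\<^sup>+u. g (resids R (x(s := u))) \<partial>lborel) \<partial>Pi\<^sub>M ?R (\<lambda>_. lborel))"
      using lborel_product.product_nn_integral_insert[OF fR _ gr] unfolding sR(2) by simp
    also have "\<dots> = (\<integral>\<^sup>+x. h (resids ?R x) \<partial>Pi\<^sub>M ?R (\<lambda>_. lborel))"
    proof (rule nn_integral_cong)
      fix x :: "nat \<Rightarrow> real" assume "x \<in> space (Pi\<^sub>M ?R (\<lambda>_. lborel))"
      let ?e = "resids ?R x" and ?c = "f s (restrict x (Pa E s))"
      have e: "?e \<in> space (Pi\<^sub>M ?R (\<lambda>_. lborel))" by (simp add: resids_def space_PiM)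
      have "(\<lambda>u. g (?e(s := u))) \<in> borel_measurable lborel"
        by (rule measurable_compose[OF measurable_component_update[OF e] g']) simp
      then have "(\<integral>\<^sup>+u. g (?e(s := u)) \<partial>lborel) = (\<integral>\<^sup>+u. g (?e(s := u - ?c)) \<partial>lborel)"
        using nn_integral_real_affine[of "\<lambda>u. g (?e(s := u))" 1 "- ?c"] by simp
      then show "(\<integral>\<^sup>+u. g (resids R (x(s := u))) \<partial>lborel) = h ?e"
        by (simp add: h_def resids_upd_sink[OF step(2)])
    qed
    also have "\<dots> = (\<integral>\<^sup>+x. h x \<partial>Pi\<^sub>M ?R (\<lambda>_. lborel))" using step(4) h by blast
    also have "\<dots> = (\<integral>\<^sup>+x. g x \<partial>Pi\<^sub>M R (\<lambda>_. lborel))"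
      using lborel_product.product_nn_integral_insert[OF fR _ g'] unfolding sR(2) h_def by simp
    finally show "(\<integral>\<^sup>+x. g (resids R x) \<partial>Pi\<^sub>M R (\<lambda>_. lborel)) = (\<integral>\<^sup>+x. g x \<partial>Pi\<^sub>M R (\<lambda>_. lborel))" .
  qed
qed

text \<open>Needed to write every event about \<open>x\<close> as an event about the residuals,
  whose law is known.\<close>

lemma ex_resids_inverse:
  assumes "ancestral d E R"
  shows "\<exists>\<Phi> \<in> Pi\<^sub>M R (\<lambda>_. borel) \<rightarrow>\<^sub>M Pi\<^sub>M R (\<lambda>_. borel). \<forall>x \<in> R \<rightarrow>\<^sub>E UNIV. \<Phi> (resids R x) = x"
  using assms
proof (induction rule: ancestral_induct[OF dag, consumes 1, case_names empty step])
  case empty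
  show ?case by (rule bexI[of _ "\<lambda>x. x"]) (auto simp: resids_def)
next
  case (step R s)
  let ?R = "R - {s}" and ?B = "\<lambda>A. Pi\<^sub>M A (\<lambda>_ :: nat. borel :: real measure)"
  have sR: "s \<in> R" "insert s ?R = R" using step(2) by (auto simp: sink_in_def)
  have sV: "s \<in> {1..d}" using sR(1) ancestral_subset[OF step(1)] by blast
  have sp: "s \<notin> Pa E s" using dag_irrefl[OF dag] by (simp add: Pa_def)
  have Pas: "Pa E s \<subseteq> ?R" using ancestral_Pa_subset[OF step(1) dag sR(1)] sp by blast
  obtain \<Phi> where \<Phi>: "\<Phi> \<in> ?B ?R \<rightarrow>\<^sub>M ?B ?R" "\<And>x. x \<in> ?R \<rightarrow>\<^sub>E UNIV \<Longrightarrow> \<Phi> (resids ?R x) = x"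
    using step(4) by blast
  \<comment> \<open>The other coordinates are recovered first; they contain the parents of
    \<open>s\<close>, and adding \<open>f s\<close> to the residual gives x_s.\<close>
  define \<Psi> where "\<Psi> e = (\<Phi> (restrict e ?R))(s := e s + f s (restrict (\<Phi> (restrict e ?R)) (Pa E s)))" for e
  have m1: "(\<lambda>e. \<Phi> (restrict e ?R)) \<in> ?B R \<rightarrow>\<^sub>M ?B ?R"
    by (rule measurable_compose[OF measurable_restrict_subset \<Phi>(1)]) blast
  have m2: "(\<lambda>e. f s (restrict (\<Phi> (restrict e ?R)) (Pa E s))) \<in> borel_measurable (?B R)"
    by (rule measurable_compose[OF m1 f_measurable[OF sV Pas]])
  have m3: "(\<lambda>e. e s) \<in> borel_measurable (?B R)" using sR(1) by simp
  have "(\<lambda>e. (\<Phi> (restrict e ?R), e s + f s (restrict (\<Phi> (restrict e ?R)) (Pa E s))))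
      \<in> ?B R \<rightarrow>\<^sub>M ?B ?R \<Otimes>\<^sub>M borel"
    using m1 m2 m3 by (intro measurable_Pair borel_measurable_add)
  from measurable_compose[OF this measurable_add_dim[where i=s]]
  have "\<Psi> \<in> ?B R \<rightarrow>\<^sub>M ?B R" unfolding sR(2) by (simp add: \<Psi>_def[abs_def])
  moreover have "\<Psi> (resids R x) = x" if x: "x \<in> R \<rightarrow>\<^sub>E UNIV" for x
  proof -
    let ?y = "restrict x ?R"
    have "resids R (?y(s := x s)) = (resids ?R ?y)(s := x s - f s (restrict ?y (Pa E s)))"
      by (rule resids_upd_sink[OF step(2)])
    moreover have xy: "?y(s := x s) = x" using x sR by (auto simp: restrict_def PiE_iff extensional_def)
    moreover have "restrict ((resids ?R ?y)(s := t)) ?R = resids ?R ?y" for t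
      by (auto simp: resids_def restrict_def)
    moreover have "\<Phi> (resids ?R ?y) = ?y" by (rule \<Phi>(2)) simp
    ultimately show ?thesis by (simp add: \<Psi>_def)
  qed
  ultimately show ?case by blast
qed

end

section \<open>The GLM DAG of a Gaussian additive noise model\<close>

locale gaussian_noise = additive_noise +
  fixes P :: "(nat \<Rightarrow> real) measure" and \<tau> :: "nat \<Rightarrow> real"
  assumes d_pos: "1 \<le> d" and P_prob: "prob_space P"
    and sets_P: "sets P = sets (Pi\<^sub>M {1..d} (\<lambda>_. borel))"
    and f_C2: "i \<in> {1..d} \<Longrightarrow> C2_in (Pa E i) (Pa E i \<rightarrow>\<^sub>E UNIV) (f i)"
    and f_nonlinear: "(k, i) \<in> E \<Longrightarrow> \<exists>z\<in>(Pa E i - {k}) \<rightarrow>\<^sub>E UNIV. \<not> affine_fun_on UNIV (\<lambda>t. f i (z(k := t)))"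
    and \<tau>_pos: "i \<in> {1..d} \<Longrightarrow> 0 < \<tau> i"
    and noise: "i \<in> {1..d} \<Longrightarrow> distributed P lborel (resid i) (normal_density 0 (\<tau> i))"
    and indep: "prob_space.indep_vars P (\<lambda>_. borel) resid {1..d}"
begin

lemma distr_resids:
  "distr P (Pi\<^sub>M {1..d} (\<lambda>_. borel)) (resids {1..d})
    = density (Pi\<^sub>M {1..d} (\<lambda>_. lborel)) (\<lambda>x. ennreal (\<Prod>i\<in>{1..d}. normal_density 0 (\<tau> i) (x i)))"
proof -
  interpret prob_space P by (rule P_prob)
  have rv: "random_variable borel (resid i)" if "i \<in> {1..d}" for i
    using distributed_measurable[OF noise[OF that]] by simp
  have "distr P (Pi\<^sub>M {1..d} (\<lambda>_. borel)) (\<lambda>x. \<lambda>i\<in>{1..d}. resid i x)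
      = (\<Pi>\<^sub>M i\<in>{1..d}. distr P borel (resid i))"
    using indep_vars_iff_distr_eq_PiM'[where I="{1..d}" and M'="\<lambda>_. borel" and X=resid] rv indep d_pos by simp
  also have "\<dots> = (\<Pi>\<^sub>M i\<in>{1..d}. density lborel (\<lambda>u. ennreal (normal_density 0 (\<tau> i) u)))"
  proof (rule PiM_cong[OF refl])
    fix i assume i: "i \<in> {1..d}"
    have "distr P borel (resid i) = distr P lborel (resid i)" by (rule distr_cong) auto
    then show "distr P borel (resid i) = density lborel (\<lambda>u. ennreal (normal_density 0 (\<tau> i) u))"
      using distributed_distr_eq_density[OF noise[OF i]] by simp
  qed
  also have "\<dots> = density (Pi\<^sub>M {1..d} (\<lambda>_. lborel)) (\<lambda>x. ennreal (\<Prod>i\<in>{1..d}. normal_density 0 (\<tau> i) (x i)))"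
    by (rule PiM_density_lborel) (auto simp: nn_integral_normal_density \<tau>_pos)
  finally show ?thesis by (simp add: resids_def[abs_def])
qed

definition jdens :: "(nat \<Rightarrow> real) \<Rightarrow> real" where
  "jdens x = (\<Prod>i\<in>{1..d}. normal_density 0 (\<tau> i) (resid i x))"

lemma jdens_measurable: "jdens \<in> borel_measurable (Pi\<^sub>M {1..d} (\<lambda>_. borel))"
proof -
  have "(\<lambda>x. \<Prod>i\<in>{1..d}. normal_density 0 (\<tau> i) (resids {1..d} x i))
      \<in> borel_measurable (Pi\<^sub>M {1..d} (\<lambda>_. borel))"
    by (rule measurable_compose[OF resids_measurable[OF ancestral.all]]) measurable
  then show ?thesis by (simp add: jdens_def[abs_def] resids_def)
qed

text \<open>An event \<open>A\<close> is rewritten as an event \<open>C\<close> about the residuals;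
  its probability is an integral against their Gaussian product density, and
  \<open>nn_integral_resids\<close> carries this integral back to \<open>x\<close>.\<close>

lemma P_eq_density: "P = density (Pi\<^sub>M {1..d} (\<lambda>_. lborel)) (\<lambda>x. ennreal (jdens x))"
proof (rule measure_eqI)
  let ?V = "{1..d}" and ?B = "Pi\<^sub>M {1..d} (\<lambda>_ :: nat. borel :: real measure)"
    and ?L = "Pi\<^sub>M {1..d} (\<lambda>_ :: nat. lborel :: real measure)"
  show "sets P = sets (density ?L (\<lambda>x. ennreal (jdens x)))"
    using sets_P by (simp add: sets_PiM_lborel)
  fix A assume "A \<in> sets P"
  then have A: "A \<in> sets ?B" using sets_P by simp
  obtain \<Phi> where \<Phi>: "\<Phi> \<in> ?B \<rightarrow>\<^sub>M ?B" "\<And>x. x \<in> ?V \<rightarrow>\<^sub>E UNIV \<Longrightarrow> \<Phi> (resids ?V x) = x"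
    using ex_resids_inverse[OF ancestral.all] by blast
  define C where "C = \<Phi> -` A \<inter> space ?B"
  have C: "C \<in> sets ?B" unfolding C_def using \<Phi>(1) A by (rule measurable_sets)
  have sp: "space P = space ?B" using sets_P by (rule sets_eq_imp_space_eq)
  have CA: "resids ?V x \<in> C \<longleftrightarrow> x \<in> A" if "x \<in> space ?B" for x
    using that \<Phi>(2)[of x] by (auto simp: C_def space_PiM resids_def)
  have rm: "resids ?V \<in> P \<rightarrow>\<^sub>M ?B"
    using resids_measurable[OF ancestral.all] by (simp add: measurable_cong_sets[OF sets_P refl])
  define G where "G e = ennreal (\<Prod>i\<in>?V. normal_density 0 (\<tau> i) (e i)) * indicator C e" for e
  have G: "G \<in> borel_measurable ?B" unfolding G_def[abs_def] using C by measurable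
  have AB: "A \<subseteq> space ?B" using sets.sets_into_space[OF A] .
  have "A = resids ?V -` C \<inter> space P" unfolding sp using CA AB by blast
  then have "emeasure P A = emeasure (distr P ?B (resids ?V)) C"
    using emeasure_distr[OF rm C] by simp
  also have "\<dots> = (\<integral>\<^sup>+e. G e \<partial>?L)"
    unfolding distr_resids G_def using C by (subst emeasure_density) (auto simp: sets_PiM_lborel)
  also have "\<dots> = (\<integral>\<^sup>+x. G (resids ?V x) \<partial>?L)"
    using nn_integral_resids[OF ancestral.all] G by simp
  also have "\<dots> = (\<integral>\<^sup>+x. ennreal (jdens x) * indicator A x \<partial>?L)"
  proof (rule nn_integral_cong)
    fix x assume "x \<in> space ?L"
    then have "x \<in> space ?B" by (simp add: space_PiM)
    then show "G (resids ?V x) = ennreal (jdens x) * indicator A x"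
      using CA[of x] by (simp add: G_def jdens_def resids_def indicator_def)
  qed
  also have "\<dots> = emeasure (density ?L (\<lambda>x. ennreal (jdens x))) A"
    using A jdens_measurable
    by (subst emeasure_density) (auto simp: sets_PiM_lborel measurable_cong_sets[OF sets_PiM_lborel refl])
  finally show "emeasure P A = emeasure (density ?L (\<lambda>x. ennreal (jdens x))) A" .
qed

text \<open>\<open>\<lambda>_. undefined\<close> is the only point of
  \<open>{} \<rightarrow>\<^sub>E UNIV\<close>, so \<open>f j\<close> there is the mean of a source.
  For the other nodes, carrier and natural parameter are read off from
  \<open>normal_density_exp_tilt\<close>.\<close>

definition gmodel :: glm_model where
  "gmodel = \<lparr>kind = \<lambda>_. Continuous, var_supp = \<lambda>_. UNIV,
     src_dens = \<lambda>j. normal_density (f j (\<lambda>_. undefined)) (\<tau> j),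
     carrier_dens = \<lambda>j. normal_density 0 (\<tau> j),
     nat_par = \<lambda>j z. f j z / (\<tau> j)\<^sup>2, joint_dens = jdens\<rparr>"

lemma gmodel_simps [simp]:
  "kind gmodel j = Continuous" "var_supp gmodel j = UNIV"
  "src_dens gmodel j = normal_density (f j (\<lambda>_. undefined)) (\<tau> j)"
  "carrier_dens gmodel j = normal_density 0 (\<tau> j)"
  "nat_par gmodel j = (\<lambda>z. f j z / (\<tau> j)\<^sup>2)" "joint_dens gmodel = jdens"
  "supp_int gmodel j = UNIV" "supp_int_prod gmodel A = (A \<rightarrow>\<^sub>E UNIV)"
  by (simp_all add: gmodel_def supp_int_def supp_int_prod_def)

lemma nu_gmodel: "nu gmodel j = lborel"
  by (simp add: nu_def density_1 indicator_def)

lemma partition_fun_gmodel: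
  assumes "j \<in> {1..d}"
  shows "partition_fun gmodel j t = ennreal (exp ((\<tau> j)\<^sup>2 * t\<^sup>2 / 2))"
proof -
  have "partition_fun gmodel j t
      = (\<integral>\<^sup>+u. ennreal (exp ((\<tau> j)\<^sup>2 * t\<^sup>2 / 2)) * ennreal (normal_density ((\<tau> j)\<^sup>2 * t) (\<tau> j) u) \<partial>lborel)"
    unfolding partition_fun_def nu_gmodel gmodel_simps normal_density_exp_tilt[OF \<tau>_pos[OF assms]]
    by (simp add: ennreal_mult')
  also have "\<dots> = ennreal (exp ((\<tau> j)\<^sup>2 * t\<^sup>2 / 2))"
    by (subst nn_integral_cmult) (auto simp: nn_integral_normal_density[OF \<tau>_pos[OF assms]])
  finally show ?thesis .
qed

text \<open>Tilting the centred normal by f / \<tau>^2 moves its mean to f, and the factor produced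
  by the tilt cancels against the normaliser.\<close>

lemma cond_dens_gmodel:
  assumes j: "j \<in> {1..d}"
  shows "cond_dens E gmodel j x = normal_density 0 (\<tau> j) (resid j x)"
proof (cases "Pa E j = {}")
  case True
  then show ?thesis
    by (simp add: cond_dens_def resid_def normal_density_shift[of "f j (\<lambda>_. undefined)"] restrict_def)
next
  case False
  let ?\<phi> = "f j (restrict x (Pa E j))"
  have \<tau>: "0 < \<tau> j" using \<tau>_pos[OF j] .
  have e: "(\<tau> j)\<^sup>2 * (?\<phi> / (\<tau> j)\<^sup>2) = ?\<phi>" using \<tau> by simp
  have lp: "log_partition gmodel j t = (\<tau> j)\<^sup>2 * t\<^sup>2 / 2" for t
    by (simp add: log_partition_def partition_fun_gmodel[OF j])
  have ex: "exp (a - b) = exp a * exp (- b)" for a b :: real by (simp add: exp_add[symmetric])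
  have "cond_dens E gmodel j x = normal_density 0 (\<tau> j) (x j) * exp (x j * (?\<phi> / (\<tau> j)\<^sup>2))
      * exp (- ((\<tau> j)\<^sup>2 * (?\<phi> / (\<tau> j)\<^sup>2)\<^sup>2 / 2))"
    unfolding cond_dens_def Let_def lp gmodel_simps ex if_not_P[OF False] by (simp only: mult.assoc)
  also have "\<dots> = normal_density ?\<phi> (\<tau> j) (x j)"
    unfolding normal_density_exp_tilt[OF \<tau>] e by (simp add: exp_minus)
  finally show ?thesis by (simp add: resid_def normal_density_shift[of ?\<phi>])
qed

lemma semi_glm_dag_gmodel: "semi_glm_dag d E gmodel P"
  unfolding semi_glm_dag_def
proof (intro conjI ballI)
  show "dag d E" "prob_space P" by (fact dag P_prob)+
  show "valid_support (kind gmodel j) (var_supp gmodel j)" for j by simp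
  show "joint_dens gmodel \<in> borel_measurable (Pi\<^sub>M {1..d} (\<lambda>_. borel))"
    using jdens_measurable by simp
  show "P = density (Pi\<^sub>M {1..d} (nu gmodel)) (\<lambda>x. ennreal (joint_dens gmodel x))"
    using P_eq_density by (simp add: nu_gmodel[abs_def])
  show "0 < joint_dens gmodel x" for x
    unfolding gmodel_simps jdens_def by (intro prod_pos normal_density_pos \<tau>_pos)
  show "joint_dens gmodel x = (\<Prod>j\<in>{1..d}. cond_dens E gmodel j x)" for x
    by (simp add: jdens_def cond_dens_gmodel)
  fix j assume j: "j \<in> {1..d}"
  note \<tau> = \<tau>_pos[OF j]
  show "if Pa E j = {} then source_regular gmodel j else nonsource_regular E gmodel j"
  proof (cases "Pa E j = {}")
    case True
    then show ?thesis
      using \<tau> by (simp add: source_regular_def nu_gmodel nn_integral_normal_density normal_density_pos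
          C2_real_on_ln_normal_density)
  next
    case False
    have C2: "C2_in (Pa E j) (Pa E j \<rightarrow>\<^sub>E UNIV) (\<lambda>z. f j z / (\<tau> j)\<^sup>2)"
      by (rule C2_in_cdiv[OF _ f_C2[OF j]]) (auto simp: PiE_iff extensional_def)
    have nd: "natural_domain gmodel j = UNIV"
      by (simp add: natural_domain_def partition_fun_gmodel[OF j])
    \<comment> \<open>Nonconstancy in each parent follows from nonlinearity, a constant function
      being affine.\<close>
    have "\<exists>x\<in>Pa E j \<rightarrow>\<^sub>E UNIV. \<exists>t. f j (x(k := t)) \<noteq> f j x" if k: "k \<in> Pa E j" for k
    proof -
      obtain z where z: "z \<in> (Pa E j - {k}) \<rightarrow>\<^sub>E UNIV" "\<not> affine_fun_on UNIV (\<lambda>t. f j (z(k := t)))"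
        using f_nonlinear[of k j] k by (auto simp: Pa_def)
      let ?x = "z(k := 0)"
      have "\<exists>t. f j (?x(k := t)) \<noteq> f j ?x"
      proof (rule ccontr)
        assume "\<not> ?thesis"
        then have "f j (z(k := t)) = f j ?x + 0 * t" for t by simp
        then show False using z(2) unfolding affine_fun_on_def by blast
      qed
      moreover have "?x \<in> Pa E j \<rightarrow>\<^sub>E UNIV" using z(1) k by (auto simp: PiE_iff extensional_def)
      ultimately show ?thesis by blast
    qed
    then show ?thesis using False C2 \<tau>
      by (simp add: nonsource_regular_def nd normal_density_pos C2_real_on_ln_normal_density)
  qed
qed

lemma nonlinear_gmodel: "nonlinear_glm E gmodel"
  unfolding nonlinear_glm_def
proof clarify
  fix k i assume e: "(k, i) \<in> E"
  then have i: "i \<in> {1..d}" using dag by (auto simp: dag_def)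
  obtain z where z: "z \<in> (Pa E i - {k}) \<rightarrow>\<^sub>E UNIV" "\<not> affine_fun_on UNIV (\<lambda>t. f i (z(k := t)))"
    using f_nonlinear[OF e] by blast
  have "\<not> affine_fun_on UNIV (\<lambda>t. f i (z(k := t)) / (\<tau> i)\<^sup>2)"
  proof
    assume "affine_fun_on UNIV (\<lambda>t. f i (z(k := t)) / (\<tau> i)\<^sup>2)"
    then obtain a c where "\<And>t. f i (z(k := t)) / (\<tau> i)\<^sup>2 = a + c * t"
      unfolding affine_fun_on_def by blast
    then have "f i (z(k := t)) = a * (\<tau> i)\<^sup>2 + (c * (\<tau> i)\<^sup>2) * t" for t
      using \<tau>_pos[OF i] by (simp add: field_simps)
    then show False using z(2) unfolding affine_fun_on_def by blast
  qed
  then show "\<exists>z\<in>supp_int_prod gmodel (Pa E i - {k}).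
      \<not> affine_fun_on (supp_int gmodel k) (\<lambda>t. nat_par gmodel i (z(k := t)))"
    using z(1) by auto
qed

lemma constant_own_curvature_gmodel: "constant_own_curvature d E gmodel"
  unfolding constant_own_curvature_def
proof
  fix j assume j: "j \<in> {1..d}"
  have jp: "j \<notin> Pa E j" using dag_irrefl[OF dag] by (simp add: Pa_def)
  have "own_curvature E gmodel j x = - 1 / (\<tau> j)\<^sup>2" for x
  proof -
    have "ln (cond_dens E gmodel j (x(j := t)))
        = ln (normal_density (f j (restrict x (Pa E j))) (\<tau> j) t)" for t
      by (simp add: cond_dens_gmodel[OF j] resid_def restrict_upd_notin[OF jp]
          normal_density_shift[of "f j (restrict x (Pa E j))"])
    then have "own_curvature E gmodel j x
        = (deriv ^^ 2) (\<lambda>t. ln (normal_density (f j (restrict x (Pa E j))) (\<tau> j) t)) (x j)"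
      by (simp add: own_curvature_def)
    also have "\<dots> = - 1 / (\<tau> j)\<^sup>2"
      using ln_normal_density_derivs[OF \<tau>_pos[OF j]]
      by (intro has_d2_imp_deriv2 has_d2I[OF open_UNIV UNIV_I])
    finally show ?thesis .
  qed
  then show "\<exists>c. \<forall>x\<in>admissible_dom gmodel {1..d} j. own_curvature E gmodel j x = c" by blast
qed

end

lemma gaussian_anm_imp_glm:
  assumes "1 \<le> d" "gaussian_anm d E P"
  shows "\<exists>M. semi_glm_dag d E M P \<and> nonlinear_glm E M \<and> all_continuous d M \<and> constant_own_curvature d E M"
proof -
  have dag: "dag d E" using assms(2) by (simp add: gaussian_anm_def)
  obtain f \<tau> where
    C2: "\<forall>i\<in>{1..d}. C2_in (Pa E i) (Pa E i \<rightarrow>\<^sub>E UNIV) (f i)"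
    and nl: "\<forall>(k, i)\<in>E. \<exists>z\<in>(Pa E i - {k}) \<rightarrow>\<^sub>E UNIV. \<not> affine_fun_on UNIV (\<lambda>t. f i (z(k := t)))"
    and D: "\<forall>i\<in>{1..d}. 0 < (\<tau> i :: real) \<and>
      distributed P lborel (\<lambda>x. x i - f i (restrict x (Pa E i))) (normal_density 0 (\<tau> i))"
    and indep: "prob_space.indep_vars P (\<lambda>_. borel) (\<lambda>i x. x i - f i (restrict x (Pa E i))) {1..d}"
    using assms(2) unfolding gaussian_anm_def by (elim conjE exE) (rule that)
  interpret N: additive_noise d E f
    using dag C2 by unfold_locales (auto simp: C2_in_def C1_in_def)
  have res: "N.resid = (\<lambda>i x. x i - f i (restrict x (Pa E i)))"
    by (simp add: fun_eq_iff N.resid_def)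
  interpret gaussian_noise d E f P \<tau>
  proof (rule gaussian_noise.intro[OF N.additive_noise_axioms], rule gaussian_noise_axioms.intro)
    show "1 \<le> d" by fact
    show "prob_space P" "sets P = sets (Pi\<^sub>M {1..d} (\<lambda>_. borel))"
      using assms(2) unfolding gaussian_anm_def by blast+
    show "C2_in (Pa E i) (Pa E i \<rightarrow>\<^sub>E UNIV) (f i)" if "i \<in> {1..d}" for i using C2 that by blast
    show "\<exists>z\<in>(Pa E i - {k}) \<rightarrow>\<^sub>E UNIV. \<not> affine_fun_on UNIV (\<lambda>t. f i (z(k := t)))"
      if "(k, i) \<in> E" for k i using bspec[OF nl that] by simp
    show "0 < \<tau> i" "distributed P lborel (N.resid i) (normal_density 0 (\<tau> i))" if "i \<in> {1..d}" for i
      using bspec[OF D that] unfolding res by blast+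
    show "prob_space.indep_vars P (\<lambda>_. borel) N.resid {1..d}" unfolding res by (rule indep)
  qed
  have "all_continuous d gmodel" by (simp add: all_continuous_def)
  then show ?thesis
    using semi_glm_dag_gmodel nonlinear_gmodel constant_own_curvature_gmodel by blast
qed

section \<open>A continuous model that is not Gaussian\<close>

definition unif_model :: glm_model where
  "unif_model = \<lparr>kind = \<lambda>_. Continuous, var_supp = \<lambda>_. {0..1}, src_dens = \<lambda>_ _. 1,
     carrier_dens = \<lambda>_ _. 1, nat_par = \<lambda>_ _. 0, joint_dens = \<lambda>_. 1\<rparr>"

lemma unif_model_simps [simp]:
  "kind unif_model j = Continuous" "var_supp unif_model j = {0..1}" "src_dens unif_model j = (\<lambda>_. 1)"
  "joint_dens unif_model = (\<lambda>_. 1)" "supp_int unif_model j = {0<..<1}"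
  by (simp_all add: unif_model_def supp_int_def)

lemma emeasure_nu_unif_model: "emeasure (nu unif_model j) UNIV = 1"
  by (simp add: nu_def emeasure_density)

lemma semi_glm_dag_unif_model: "semi_glm_dag d {} unif_model (Pi\<^sub>M {1..d} (nu unif_model))"
proof -
  have "prob_space (Pi\<^sub>M {1..d} (nu unif_model))"
    by (intro prob_space_PiM prob_spaceI) (simp add: emeasure_nu_unif_model)
  moreover have "Pa {} j = {}" for j by (simp add: Pa_def)
  moreover have "dag d {}" by (simp add: dag_def acyclic_def)
  moreover have "source_regular unif_model j" for j
    using emeasure_nu_unif_model by (auto simp: source_regular_def C2_real_on_def intro!: exI[of _ "\<lambda>_. 0"])
  ultimately show ?thesis
    by (simp add: semi_glm_dag_def density_1 cond_dens_def is_interval_cc)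
qed

text \<open>Whatever the candidate graph, it has a source i, whose residual is x_i minus a constant.
  Under the uniform law this is bounded, whereas a normal density is positive everywhere.\<close>

lemma unif_model_not_gaussian:
  assumes d: "1 \<le> d"
  shows "\<not> gaussian_anm d E (Pi\<^sub>M {1..d} (nu unif_model))"
proof
  let ?P = "Pi\<^sub>M {1..d} (nu unif_model)"
  assume g: "gaussian_anm d E ?P"
  then have dag: "dag d E" by (simp add: gaussian_anm_def)
  then have wf: "wf E"
    unfolding dag_def by (elim conjE, intro finite_acyclic_wf) (rule finite_subset, auto)
  have "1 \<in> {1..d}" using d by simp
  from wf_eq_minimal[THEN iffD1, rule_format, OF wf this]
  obtain i where i: "i \<in> {1..d}" "\<And>k. (k, i) \<in> E \<Longrightarrow> k \<notin> {1..d}" by blast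
  then have Pa: "Pa E i = {}" using Pa_subset[OF dag, of i] unfolding Pa_def by blast
  obtain f \<tau> where \<tau>: "0 < \<tau> i"
    and D: "distributed ?P lborel (\<lambda>x. x i - f i (restrict x (Pa E i))) (normal_density 0 (\<tau> i))"
    using g i(1) unfolding gaussian_anm_def by blast
  define c where "c = f i (\<lambda>_. undefined)"
  have D': "distributed ?P lborel (\<lambda>x. x i - c) (normal_density 0 (\<tau> i))"
    using D by (simp add: Pa c_def restrict_def)
  interpret semi_glm d "{}" unif_model ?P by unfold_locales (rule semi_glm_dag_unif_model)
  \<comment> \<open>Since x_i < 1 almost surely, the residual avoids everything from 1 - c upwards;
    an interval of length one suffices for the contradiction.\<close>
  have "AE x in ?P. x i - c \<notin> {1 - c..2 - c}"
    using AE_P_supp_int[OF i(1)] by eventually_elim auto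
  then have "AE y in distr ?P lborel (\<lambda>x. x i - c). y \<notin> {1 - c..2 - c}"
    by (subst AE_distr_iff[OF distributed_measurable[OF D']]) simp_all
  then have "AE y in lborel. 0 < ennreal (normal_density 0 (\<tau> i) y) \<longrightarrow> y \<notin> {1 - c..2 - c}"
    unfolding distributed_distr_eq_density[OF D'] by (subst (asm) AE_density) auto
  then have "AE y in lborel. y \<notin> {1 - c..2 - c}"
    by eventually_elim (use normal_density_pos[OF \<tau>] in auto)
  then have "{1 - c..2 - c} \<in> null_sets lborel" by (subst AE_iff_null_sets) auto
  then show False by (simp add: null_sets_def)
qed

theorem corollary13:
  fixes d :: nat
  assumes "1 \<le> d"
  shows
    "(\<forall>E P. gaussian_anm d E P \<longrightarrow>
        (\<exists>M. semi_glm_dag d E M P \<and> nonlinear_glm E M \<and> all_continuous d M)) \<and>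
     (\<exists>E P. (\<exists>M. semi_glm_dag d E M P \<and> nonlinear_glm E M \<and> all_continuous d M) \<and>
        \<not> (\<exists>E'. gaussian_anm d E' P)) \<and>
     (\<forall>E E' P. (\<exists>M. semi_glm_dag d E M P \<and> nonlinear_glm E M \<and> all_continuous d M) \<and>
        (\<exists>M'. semi_glm_dag d E' M' P \<and> nonlinear_glm E' M') \<longrightarrow> E = E') \<and>
     (\<forall>E P. gaussian_anm d E P \<longrightarrow>
        (\<exists>M. semi_glm_dag d E M P \<and> nonlinear_glm E M \<and> constant_own_curvature d E M)) \<and>
     (\<forall>E M P. semi_glm_dag d E M P \<and> nonlinear_glm E M \<and> constant_own_curvature d E M \<and>
        moment_condition d E M P \<longrightarrow>
        (\<forall>R j. ancestral d E R \<and> R \<noteq> {} \<and> j \<in> R \<longrightarrow>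
          (curv_variance d M P R j = 0 \<longleftrightarrow> curv_score d M P R j = 0) \<and>
          (curv_score d M P R j = 0 \<longleftrightarrow> sink_in E R j)))"
proof (intro conjI)
  show "\<forall>E P. gaussian_anm d E P \<longrightarrow>
      (\<exists>M. semi_glm_dag d E M P \<and> nonlinear_glm E M \<and> all_continuous d M)"
    "\<forall>E P. gaussian_anm d E P \<longrightarrow>
      (\<exists>M. semi_glm_dag d E M P \<and> nonlinear_glm E M \<and> constant_own_curvature d E M)"
    using gaussian_anm_imp_glm[OF assms] by blast+
  \<comment> \<open>Nonlinearity is a condition on edges, so it holds vacuously for the empty
    graph.\<close>
  have "nonlinear_glm {} unif_model" "all_continuous d unif_model"
    by (simp_all add: nonlinear_glm_def all_continuous_def)
  then show "\<exists>E P. (\<exists>M. semi_glm_dag d E M P \<and> nonlinear_glm E M \<and> all_continuous d M) \<and>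
      \<not> (\<exists>E'. gaussian_anm d E' P)"
    using semi_glm_dag_unif_model unif_model_not_gaussian[OF assms] by blast
  show "\<forall>E E' P. (\<exists>M. semi_glm_dag d E M P \<and> nonlinear_glm E M \<and> all_continuous d M) \<and>
      (\<exists>M'. semi_glm_dag d E' M' P \<and> nonlinear_glm E' M') \<longrightarrow> E = E'"
  proof (intro allI impI, elim conjE exE)
    fix E E' P M M'
    assume "semi_glm_dag d E M P" "all_continuous d M" "semi_glm_dag d E' M' P"
      and nl': "nonlinear_glm E' M'"
    then interpret two_glms d E M E' M' P by unfold_locales
    show "E = E'" by (rule edges_eq[OF nl'])
  qed
  show "\<forall>E M P. semi_glm_dag d E M P \<and> nonlinear_glm E M \<and> constant_own_curvature d E M \<and>
      moment_condition d E M P \<longrightarrow>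
      (\<forall>R j. ancestral d E R \<and> R \<noteq> {} \<and> j \<in> R \<longrightarrow>
        (curv_variance d M P R j = 0 \<longleftrightarrow> curv_score d M P R j = 0) \<and>
        (curv_score d M P R j = 0 \<longleftrightarrow> sink_in E R j))"
    using semi_glm.curvature_criterion[OF semi_glm.intro] by blast
qed

end
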